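(* Let $\theta\in(0,1)$, $\alpha:=\frac{1-\theta}{2}$, and let $L=(L_t)_{t\in[0,T)}$ be a càdlàg martingale with $L_t\in L_2$ for all $t\in[0,T)$. Then the following assertions are equivalent: (1) $L^d\in\big(\ell_2^{-1/2}(H),\ell_\infty(H)\big)_{\theta,2}$. (2) $(\mathcal I_t^\alpha L)_{t\in[0,T)}$ is closable in $L_2$. (3) There is a $c>0$ such that $\mathbb E[L;\tau]_T\le c\|\tau\|_\theta$ for all $\tau\in\mathcal T$.
   Context: Fix $T\in(0,\infty)$ and a complete probability space $(\Omega,\mathcal F,\mathbb P)$ with a right-continuous filtration $(\mathcal F_t)_{t\in[0,T]}$ such that $\mathcal F_0$ is generated by the $\mathbb P$-null sets and $\mathcal F=\mathcal F_T$. $H:=L_2(\Omega,\mathcal F,\mathbb P)$; $L^d:=(L_{t_k})_{k=0}^\infty$ with $t_k:=T(1-2^{-k})$. For $q\in[1,\infty]$, $s\in\mathbb R$: $\ell_q^s(H):=\{(x_k)_{k\ge0}\subseteq H:\|(2^{ks}\|x_k\|_H)_{k\ge0}\|_{\ell_q}<\infty\}$, with this norm, and $\ell_q(H):=\ell_q^0(H)$. Real interpolation: for an interpolation couple $(E_0,E_1)$, $K(v,x;E_0,E_1):=\inf\{\|x_0\|_{E_0}+v\|x_1\|_{E_1}:x=x_0+x_1\}$, and $(E_0,E_1)_{\theta,q}$ is the set of $x\in E_0+E_1$ with $\|v\mapsto v^{-\theta}K(v,x;E_0,E_1)\|_{L_q((0,\infty),dv/v)}<\infty$. $\mathcal I_t^\alpha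 L:=\frac{\alpha}{T^\alpha}\int_0^T(T-u)^{\alpha-1}L_{u\wedge t}\,du$ (path-wise), $t\in[0,T)$; this is again a martingale. A martingale $(M_t)_{t\in[0,T)}$ is closable in $L_2$ if there is an $M_T\in L_2$ with $M_t=\mathbb E[M_T\mid\mathcal F_t]$ a.s. for $t\in[0,T)$ (equivalently $\sup_{t\in[0,T)}\|M_t\|_{L_2}<\infty$). $\mathcal T$ is the set of deterministic time-nets $\tau=\{t_i\}_{i=0}^n$, $0=t_0<\dots<t_n=T$, $n\in\mathbb N$; $\|\tau\|_\theta:=\sup_{i=1,\dots,n}\frac{t_i-t_{i-1}}{(T-t_{i-1})^{1-\theta}}$; $[L;\tau]_a:=\int_0^a\big|L_u-\sum_{i=1}^nL_{t_{i-1}}\mathbf 1_{(t_{i-1},t_i]}(u)\big|^2du$ for $a\in[0,T)$ and $[L;\tau]_T:=\lim_{a\uparrow T}[L;\tau]_a\in[0,\infty]$. *)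

theory Defs
  imports "HOL-Probability.Probability" "HOL-Library.Function_Algebras"
begin

text \<open>Elements of the Hilbert space \<open>H = L\<^sub>2\<close> are represented by functions, so its equality is
  almost sure equality; \<open>seq_eq\<close> is the resulting equality of H-valued sequences.\<close>

definition L2_space :: "'a measure \<Rightarrow> ('a \<Rightarrow> real) set" where
  "L2_space M = {f \<in> borel_measurable M. integrable M (\<lambda>\<omega>. (f \<omega>)\<^sup>2)}"

definition L2_norm :: "'a measure \<Rightarrow> ('a \<Rightarrow> real) \<Rightarrow> real" where
  "L2_norm M f = sqrt (\<integral>\<omega>. (f \<omega>)\<^sup>2 \<partial>M)"

definition seq_eq :: "'a measure \<Rightarrow> (nat \<Rightarrow> 'a \<Rightarrow> real) \<Rightarrow> (nat \<Rightarrow> 'a \<Rightarrow> real) \<Rightarrow> bool" where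
  "seq_eq M x y \<longleftrightarrow> (\<forall>k. AE \<omega> in M. x k \<omega> = y k \<omega>)"

text \<open>In the following two definitions, \<open>q\<close> ranges over \<open>[1, \<infinity>]\<close>.\<close>

definition in_lq :: "ennreal \<Rightarrow> (nat \<Rightarrow> real) \<Rightarrow> bool" where
  "in_lq q a \<longleftrightarrow>
     (if q = \<infinity> then bounded (range a) else summable (\<lambda>k. \<bar>a k\<bar> powr enn2real q))"

definition lq_norm :: "ennreal \<Rightarrow> (nat \<Rightarrow> real) \<Rightarrow> real" where
  "lq_norm q a =
     (if q = \<infinity> then (SUP k. \<bar>a k\<bar>)
      else (\<Sum>k. \<bar>a k\<bar> powr enn2real q) powr (1 / enn2real q))"

type_synonym 'v space_with_norm = "'v set \<times> ('v \<Rightarrow> real)"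

definition weighted_lq :: "'a measure \<Rightarrow> ennreal \<Rightarrow> real \<Rightarrow> (nat \<Rightarrow> 'a \<Rightarrow> real) space_with_norm" where
  "weighted_lq M q s =
     ({x. (\<forall>k. x k \<in> L2_space M) \<and> in_lq q (\<lambda>k. 2 powr (real k * s) * L2_norm M (x k))},
      \<lambda>x. lq_norm q (\<lambda>k. 2 powr (real k * s) * L2_norm M (x k)))"

text \<open>The argument \<open>eq\<close> is the equality of the ambient space of the couple; it is
  a parameter because the elements of our spaces are represented by functions.\<close>

definition sum_space ::
    "('v::plus \<Rightarrow> 'v \<Rightarrow> bool) \<Rightarrow> 'v space_with_norm \<Rightarrow> 'v space_with_norm \<Rightarrow> 'v set" where
  "sum_space eq E0 E1 = {x. \<exists>x0 \<in> fst E0. \<exists>x1 \<in> fst E1. eq x (x0 + x1)}"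

definition K_functional ::
    "('v::plus \<Rightarrow> 'v \<Rightarrow> bool) \<Rightarrow> 'v space_with_norm \<Rightarrow> 'v space_with_norm \<Rightarrow> real \<Rightarrow> 'v \<Rightarrow> real" where
  "K_functional eq E0 E1 v x =
     Inf {snd E0 x0 + v * snd E1 x1 | x0 x1. x0 \<in> fst E0 \<and> x1 \<in> fst E1 \<and> eq x (x0 + x1)}"

text \<open>Finiteness of the norm of \<open>g\<close> in \<open>L\<^sub>q((0,\<infinity>), dv/v)\<close>, for \<open>q\<close> in \<open>[1, \<infinity>]\<close>; the measure
  \<open>dv/v\<close> has the same null sets as the Lebesgue measure on \<open>(0,\<infinity>)\<close>.\<close>

definition Lq_finite :: "ennreal \<Rightarrow> (real \<Rightarrow> real) \<Rightarrow> bool" where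
  "Lq_finite q g \<longleftrightarrow>
     (if q = \<infinity> then \<exists>C. AE v in lborel. 0 < v \<longrightarrow> \<bar>g v\<bar> \<le> C
      else (\<integral>\<^sup>+v\<in>{0<..}. ennreal (\<bar>g v\<bar> powr enn2real q / v) \<partial>lborel) < \<infinity>)"

definition real_interpolation ::
    "('v::plus \<Rightarrow> 'v \<Rightarrow> bool) \<Rightarrow> 'v space_with_norm \<Rightarrow> 'v space_with_norm
      \<Rightarrow> real \<Rightarrow> ennreal \<Rightarrow> 'v set" where
  "real_interpolation eq E0 E1 \<theta> q =
     {x \<in> sum_space eq E0 E1. Lq_finite q (\<lambda>v. v powr (-\<theta>) * K_functional eq E0 E1 v x)}"

locale filtered_prob_space = prob_space M + complete_measure M
  for M :: "'a measure" +
  fixes F :: "real \<Rightarrow> 'a measure" and T :: real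
  assumes T_pos: "0 < T"
    and subalgebra_F: "\<And>t. t \<in> {0..T} \<Longrightarrow> subalgebra M (F t)"
    and F_mono: "\<And>s t. 0 \<le> s \<Longrightarrow> s \<le> t \<Longrightarrow> t \<le> T \<Longrightarrow> sets (F s) \<subseteq> sets (F t)"
    and F_right_continuous: "\<And>t. t \<in> {0..<T} \<Longrightarrow> sets (F t) = (\<Inter>s\<in>{t<..T}. sets (F s))"
    and F_zero: "sets (F 0) = sigma_sets (space M) (null_sets M)"
    and F_T: "sets (F T) = sets M"

text \<open>Processes are indexed by \<open>[0,T)\<close> and filtrations by \<open>[0,T]\<close>; values at other real numbers are
  irrelevant.\<close>

definition martingale ::
    "'a measure \<Rightarrow> (real \<Rightarrow> 'a measure) \<Rightarrow> real \<Rightarrow> (real \<Rightarrow> 'a \<Rightarrow> real) \<Rightarrow> bool" where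
  "martingale M F T X \<longleftrightarrow>
     (\<forall>t\<in>{0..<T}. X t \<in> borel_measurable (F t) \<and> integrable M (X t)) \<and>
     (\<forall>s\<in>{0..<T}. \<forall>t\<in>{s..<T}. AE \<omega> in M. real_cond_exp M (F s) (X t) \<omega> = X s \<omega>)"

definition cadlag :: "'a measure \<Rightarrow> real \<Rightarrow> (real \<Rightarrow> 'a \<Rightarrow> real) \<Rightarrow> bool" where
  "cadlag M T X \<longleftrightarrow>
     (\<forall>\<omega>\<in>space M.
        (\<forall>t\<in>{0..<T}. continuous (at_right t) (\<lambda>u. X u \<omega>)) \<and>
        (\<forall>t\<in>{0<..<T}. \<exists>l. ((\<lambda>u. X u \<omega>) \<longlongrightarrow> l) (at_left t)))"

definition closable_L2 ::
    "'a measure \<Rightarrow> (real \<Rightarrow> 'a measure) \<Rightarrow> real \<Rightarrow> (real \<Rightarrow> 'a \<Rightarrow> real) \<Rightarrow> bool" where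
  "closable_L2 M F T X \<longleftrightarrow>
     (\<exists>Y\<in>L2_space M. \<forall>t\<in>{0..<T}. AE \<omega> in M. X t \<omega> = real_cond_exp M (F t) Y \<omega>)"

definition frac_integral ::
    "real \<Rightarrow> real \<Rightarrow> (real \<Rightarrow> 'a \<Rightarrow> real) \<Rightarrow> real \<Rightarrow> 'a \<Rightarrow> real" where
  "frac_integral T \<alpha> L t \<omega> =
     \<alpha> / T powr \<alpha> * (LINT u:{0..T}|lborel. (T - u) powr (\<alpha> - 1) * L (min u t) \<omega>)"

definition dyadic_seq :: "real \<Rightarrow> (real \<Rightarrow> 'a \<Rightarrow> real) \<Rightarrow> nat \<Rightarrow> 'a \<Rightarrow> real" where
  "dyadic_seq T L k = L (T * (1 - 2 powr (- real k)))"

text \<open>A time-net \<open>0 = t\<^sub>0 < \<dots> < t\<^sub>n = T\<close> is the list of its \<open>n + 1\<close> points.\<close>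

definition time_nets :: "real \<Rightarrow> real list set" where
  "time_nets T = {\<tau>. \<tau> \<noteq> [] \<and> hd \<tau> = 0 \<and> last \<tau> = T \<and> sorted_wrt (<) \<tau>}"

definition net_norm :: "real \<Rightarrow> real \<Rightarrow> real list \<Rightarrow> real" where
  "net_norm T \<theta> \<tau> =
     (SUP i\<in>{1..<length \<tau>}. (\<tau> ! i - \<tau> ! (i - 1)) / (T - \<tau> ! (i - 1)) powr (1 - \<theta>))"

definition approx_error ::
    "(real \<Rightarrow> 'a \<Rightarrow> real) \<Rightarrow> real list \<Rightarrow> real \<Rightarrow> 'a \<Rightarrow> ennreal" where
  "approx_error L \<tau> a \<omega> =
     (\<integral>\<^sup>+u\<in>{0..a}. ennreal (\<bar>L u \<omega> -
         (\<Sum>i = 1..<length \<tau>. L (\<tau> ! (i - 1)) \<omega> * indicator {\<tau> ! (i - 1)<..\<tau> ! i} u)\<bar>\<^sup>2) \<partial>lborel)"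

definition approx_error_T ::
    "real \<Rightarrow> (real \<Rightarrow> 'a \<Rightarrow> real) \<Rightarrow> real list \<Rightarrow> 'a \<Rightarrow> ennreal" where
  "approx_error_T T L \<tau> \<omega> = Lim (at_left T) (\<lambda>a. approx_error L \<tau> a \<omega>)"

end

theory Submission
  imports Defs
begin


text \<open>
  Put \<open>a(u) = E L\<^sub>u\<^sup>2\<close>, a nondecreasing function. Each of the three assertions is equivalent to the
  finiteness of the energy \<open>J\<close>, the integral of \<open>(T - u) powr (-\<theta>) * a u\<close> over \<open>[0,T)\<close>, equivalently of its dyadic version
  \<open>\<Sum>k. 2 powr (-k (1 - \<theta>)) * a t\<^sub>k\<close>.

  Interpolation: at \<open>v \<approx> 2 powr (-k/2)\<close> the squared K-functional of the dyadic sequence lies, up to constants,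
  between \<open>2 powr (-k) a(t\<^sub>k)\<close> and the sum of \<open>2 powr (-m) a(t\<^sub>m)\<close> over \<open>m \<ge> k\<close>; the upper bound cuts the sequence at \<open>k\<close>.

  Closability: an \<open>L\<^sub>2\<close> martingale is closable iff its second moments are bounded. The fractional integral
  is the average of \<open>L\<close>, stopped at \<open>t\<close>, over a probability measure, so Fubini and \<open>E L\<^sub>u L\<^sub>v = a(min u v)\<close>
  give its second moment as a constant times \<open>J\<close> with \<open>a(min u t)\<close> in place of \<open>a(u)\<close>.

  Nets: the expected error of a net is the integral of \<open>a(u) - a(l(u))\<close>, where \<open>l(u)\<close> is the last node
  before \<open>u\<close>. A layer cake argument bounds it by \<open>(1 - \<theta>) J\<close> times the norm of the net. Conversely, in
  the coordinate \<open>u = T (1 - (1 - x) powr (1/\<theta>))\<close> equidistant nets have norm \<open>O(1/n)\<close>; the errors of two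
  such nets shifted against each other dominate the integral of \<open>(b(x) - b(x - 1/(2n))) u'(x)\<close> with
  \<open>b(x) = a(u(x))\<close>, and after summation by parts Fatou's lemma yields \<open>J < \<infinity>\<close> as \<open>n\<close> tends to infinity.
\<close>

section \<open>The energy of a nondecreasing function\<close>

text \<open>The weight (T - u)^(-\<theta>) has a different origin in each assertion. For
  interpolation, v^(-2\<theta>) at the scale v ~ 2^(-k/2) becomes 2^(\<theta> k), and multiplied by
  2^(-k) it is the weight of the dyadic energy. For closability, the averaging measure has a density
  of exponent \<alpha> - 1 and tails of exponent \<alpha>; the choice of \<alpha> says that 2
  \<alpha> - 1 = -\<theta>. For nets, the coordinate u(x) solves u' = const (T - u)^(1-\<theta>).
  Differentiating once more gives -u'' = const (T - u)^(-\<theta>) u', so the summation by parts,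
  which moves the difference from b to u', produces the energy integrand in the limit. The delicate
  direction leads from nets to the energy: errors see only increments of \<open>a\<close>, and
  integrability up to T is not known beforehand. Hence the integrals are kept away from x = 1, where
  they are finite and can be cancelled, and the limit is taken by Fatou's lemma, which asks only for
  bounded integrals.\<close>

lemma nn_integral_ge_suminf_disjoint:
  fixes c :: "nat \<Rightarrow> ennreal"
  assumes "disjoint_family A" and [measurable]: "\<And>k. A k \<in> sets N"
    and le: "\<And>k x. x \<in> A k \<Longrightarrow> c k \<le> g x"
  shows "(\<Sum>k. c k * emeasure N (A k)) \<le> (\<integral>\<^sup>+x. g x \<partial>N)"
proof -
  have "(\<Sum>k. c k * emeasure N (A k)) = (\<integral>\<^sup>+x. (\<Sum>k. c k * indicator (A k) x) \<partial>N)"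
    by (simp add: nn_integral_suminf nn_integral_cmult_indicator)
  also have "\<dots> \<le> (\<integral>\<^sup>+x. g x \<partial>N)"
  proof (rule nn_integral_mono)
    fix x
    show "(\<Sum>k. c k * indicator (A k) x) \<le> g x"
    proof (cases "\<exists>k. x \<in> A k")
      case True
      then obtain k where "x \<in> A k" by blast
      then show ?thesis
        using suminf_cmult_indicator[OF assms(1), of x k c] le by simp
    qed simp
  qed
  finally show ?thesis .
qed

text \<open>Overlaps of the sets \<open>A k\<close> only enlarge the right-hand side, so a covering
  of the support is enough here.\<close>

lemma nn_integral_le_suminf_cover:
  fixes c :: "nat \<Rightarrow> ennreal"
  assumes [measurable]: "\<And>k. A k \<in> sets N"
    and le: "\<And>x. g x \<noteq> 0 \<Longrightarrow> \<exists>k. x \<in> A k \<and> g x \<le> c k"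
  shows "(\<integral>\<^sup>+x. g x \<partial>N) \<le> (\<Sum>k. c k * emeasure N (A k))"
proof -
  have "(\<integral>\<^sup>+x. g x \<partial>N) \<le> (\<integral>\<^sup>+x. (\<Sum>k. c k * indicator (A k) x) \<partial>N)"
  proof (rule nn_integral_mono)
    fix x
    show "g x \<le> (\<Sum>k. c k * indicator (A k) x)"
    proof (cases "g x = 0")
      case False
      then obtain k where k: "x \<in> A k" "g x \<le> c k" using le by blast
      have "c k * indicator (A k) x \<le> (\<Sum>k. c k * indicator (A k) x)"
        using sum_le_suminf[OF summableI, of "{k}" "\<lambda>k. c k * indicator (A k) x"]
        by (simp del: sum_mult_indicator)
      then show ?thesis using k by auto
    qed simp
  qed
  also have "\<dots> = (\<Sum>k. c k * emeasure N (A k))"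
    by (simp add: nn_integral_suminf nn_integral_cmult_indicator)
  finally show ?thesis .
qed

lemma nn_integral_powr_tail:
  fixes \<theta> T v :: real
  assumes "\<theta> < 1" "v \<le> T"
  shows "(\<integral>\<^sup>+u\<in>{v..<T}. ennreal ((T - u) powr (-\<theta>)) \<partial>lborel) = ennreal ((T - v) powr (1 - \<theta>) / (1 - \<theta>))"
proof -
  have "((\<lambda>x. x powr (-\<theta>)) has_integral ((T - v) powr (-\<theta> + 1) / (-\<theta> + 1))) {0..T - v}"
    using assms by (intro has_integral_powr_from_0) auto
  then have "((\<lambda>x. if x \<in> {0..T - v} then x powr (-\<theta>) else 0) has_integral
      ((T - v) powr (1 - \<theta>) / (1 - \<theta>))) UNIV"
    by (subst has_integral_restrict_UNIV) (simp add: add.commute)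
  then have "(\<integral>\<^sup>+x. ennreal (if x \<in> {0..T - v} then x powr (-\<theta>) else 0) \<partial>lborel)
      = ennreal ((T - v) powr (1 - \<theta>) / (1 - \<theta>))"
    by (intro nn_integral_has_integral_lborel) auto
  also have "(\<integral>\<^sup>+x. ennreal (if x \<in> {0..T - v} then x powr (-\<theta>) else 0) \<partial>lborel)
     = (\<integral>\<^sup>+u. ennreal (if T + (-1) * u \<in> {0..T - v} then (T + (-1) * u) powr (-\<theta>) else 0) \<partial>lborel)"
    by (subst nn_integral_real_affine[where c = "-1" and t = T]) auto
  \<comment> \<open>The closed and the half-open interval differ at u = T, where the integrand is 0
    because \<open>0 powr _ = 0\<close>.\<close>
  also have "\<dots> = (\<integral>\<^sup>+u\<in>{v..<T}. ennreal ((T - u) powr (-\<theta>)) \<partial>lborel)"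
    by (intro nn_integral_cong) (auto simp: indicator_def)
  finally show ?thesis by simp
qed

lemma two_powr_minus_Suc: "(2::real) powr (- real (Suc k)) = 2 powr (- real k) / 2"
  by (simp add: powr_diff powr_minus field_simps)

lemma dyadic_covering:
  fixes T u :: real
  assumes "0 < T" "u \<in> {0..<T}"
  shows "\<exists>k::nat. u \<in> {T * (1 - 2 powr (- real k))..<T * (1 - 2 powr (- real (Suc k)))}"
proof -
  let ?y = "log 2 (T / (T - u))"
  have y: "0 \<le> ?y" using assms by (subst zero_le_log_cancel_iff) (auto simp: field_simps)
  define k where "k = nat \<lfloor>?y\<rfloor>"
  have k: "real k \<le> ?y" "?y < real (Suc k)" using y unfolding k_def by linarith+
  have p: "2 powr ?y = T / (T - u)" using assms by simp
  have "2 powr (real k) \<le> T / (T - u)" "T / (T - u) < 2 powr (real (Suc k))"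
    using powr_mono[OF k(1), of 2] powr_less_mono[OF k(2), of 2] unfolding p by auto
  then have "u \<in> {T * (1 - 2 powr (- real k))..<T * (1 - 2 powr (- real (Suc k)))}"
    using assms by (simp add: powr_minus field_simps del: of_nat_Suc)
  then show ?thesis ..
qed

text \<open>Collects what is deterministic; a martingale enters it only through the instance
  \<open>moment\<close>. Values of \<open>a\<close> outside [0,T) are arbitrary, hence the
  indicators in the measurability statements.\<close>

locale growth_profile =
  fixes T \<theta> :: real and a :: "real \<Rightarrow> real"
  assumes T_pos: "0 < T"
    and \<theta>: "0 < \<theta>" "\<theta> < 1"
    and a_mono: "mono_on {0..<T} a"
    and a_nonneg: "\<And>t. t \<in> {0..<T} \<Longrightarrow> 0 \<le> a t"
begin

definition energy :: ennreal where
  "energy = (\<integral>\<^sup>+u\<in>{0..<T}. ennreal ((T - u) powr (-\<theta>) * a u) \<partial>lborel)"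

definition dyadic_energy :: ennreal where
  "dyadic_energy = (\<Sum>k. ennreal (2 powr (- (1 - \<theta>) * real k) * a (T * (1 - 2 powr (- real k)))))"

lemma a_measurable [measurable]: "(\<lambda>u. indicator {0..<T} u * a u) \<in> borel_measurable borel"
proof -
  have "a \<in> borel_measurable (restrict_space borel {0..<T})"
    by (rule borel_measurable_mono_on_fnc[OF a_mono])
  then show ?thesis
    by (subst (asm) borel_measurable_restrict_space_iff) (auto simp: )
qed

lemma a_le: "0 \<le> s \<Longrightarrow> s \<le> t \<Longrightarrow> t < T \<Longrightarrow> a s \<le> a t"
  using a_mono by (auto simp: monotone_on_def)

lemma dyadic_in: "T * (1 - 2 powr (- real k)) \<in> {0..<T}"
  using T_pos by (auto simp: powr_minus field_simps) (simp add: powr_realpow)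

text \<open>Both factors of the energy integrand are nondecreasing, so on each dyadic interval their
  values at the left end point bound it from below. The factor 1/2 is the length of the k-th
  interval relative to T - t_k = T 2^(-k).\<close>

lemma dyadic_energy_le: "ennreal (T powr (1 - \<theta>) / 2) * dyadic_energy \<le> energy"
proof -
  let ?t = "\<lambda>k. T * (1 - 2 powr (- real k))"
  let ?A = "\<lambda>k. {?t k..<?t (Suc k)}"
  have mono: "?t m \<le> ?t k" if "m \<le> k" for m k
    using T_pos that by auto
  have disj: "disjoint_family ?A"
    unfolding disjoint_family_on_def
  proof (intro ballI impI)
    fix m n :: nat assume "m \<noteq> n"
    then consider "Suc m \<le> n" | "Suc n \<le> m" by linarith
    then show "?A m \<inter> ?A n = {}"
      by cases (use mono[of "Suc m" n] mono[of "Suc n" m] in \<open>auto simp del: of_nat_Suc\<close>)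
  qed
  have "ennreal (T powr (1 - \<theta>) / 2) * dyadic_energy
      = (\<Sum>k. ennreal (T powr (1 - \<theta>) / 2) * ennreal (2 powr (- (1 - \<theta>) * real k) * a (?t k)))"
    unfolding dyadic_energy_def by simp
  also have "\<dots> = (\<Sum>k. ennreal ((T * 2 powr (-real k)) powr (-\<theta>) * a (?t k)) * emeasure lborel (?A k))"
  proof (intro suminf_cong)
    fix k
    have "?t (Suc k) - ?t k = T * 2 powr (- real k) / 2"
      by (simp add: two_powr_minus_Suc field_simps del: of_nat_Suc)
    then have e: "emeasure lborel (?A k) = ennreal (T * 2 powr (- real k) / 2)"
      using mono[of k "Suc k"] by simp
    have *: "T powr (1 - \<theta>) / 2 * (2 powr (- (1 - \<theta>) * real k) * A)
        = (T * 2 powr (-real k)) powr (-\<theta>) * A * (T * 2 powr (- real k) / 2)" for A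
    proof -
      have "T powr (1 - \<theta>) = T powr (-\<theta>) * T" 
        using T_pos powr_add[of T "-\<theta>" 1] by simp
      moreover have "(2::real) powr (- (1 - \<theta>) * real k) = (2 powr (- real k)) powr (-\<theta>) * 2 powr (- real k)"
        unfolding powr_powr powr_add[symmetric] by (simp add: algebra_simps)
      ultimately show ?thesis using T_pos by (simp add: powr_mult)
    qed
    show "ennreal (T powr (1 - \<theta>) / 2) * ennreal (2 powr (- (1 - \<theta>) * real k) * a (?t k))
      = ennreal ((T * 2 powr (-real k)) powr (-\<theta>) * a (?t k)) * emeasure lborel (?A k)"
      using T_pos a_nonneg[OF dyadic_in[of k]] unfolding e
      by (subst (1 2) ennreal_mult[symmetric]) (auto simp only: * intro!: mult_nonneg_nonneg divide_nonneg_nonneg powr_ge_zero)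
  qed
  also have "\<dots> \<le> energy"
    unfolding energy_def
  proof (rule nn_integral_ge_suminf_disjoint[OF disj])
    fix k x assume x: "x \<in> ?A k"
    have x0: "0 \<le> x" "x < T"
      using x dyadic_in[of k] dyadic_in[of "Suc k"] unfolding atLeastLessThan_iff by linarith+
    have "(T * 2 powr (-real k)) powr (-\<theta>) \<le> (T - x) powr (-\<theta>)"
      using \<theta> x x0 by (intro powr_mono2') (auto simp: algebra_simps)
    moreover have "a (?t k) \<le> a x"
      using x x0 dyadic_in[of k] by (intro a_le) auto
    ultimately have "(T * 2 powr (-real k)) powr (-\<theta>) * a (?t k) \<le> (T - x) powr (-\<theta>) * a x"
      using a_nonneg[OF dyadic_in[of k]] by (intro mult_mono) auto
    then show "ennreal ((T * 2 powr (-real k)) powr (-\<theta>) * a (?t k)) \<le>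
        ennreal ((T - x) powr (-\<theta>) * a x) * indicator {0..<T} x"
      using x0 by (simp add: ennreal_leI)
  qed simp
  finally show ?thesis .
qed

text \<open>The same comparison with right end points. There T - t_(k+1) = T 2^(-(k+1)) is also the
  length of the interval, so no factor 1/2 arises; the resulting sum starts at index 1, and the
  missing term is nonnegative.\<close>

lemma energy_le: "energy \<le> ennreal (T powr (1 - \<theta>)) * dyadic_energy"
proof -
  let ?t = "\<lambda>k. T * (1 - 2 powr (- real k))"
  let ?A = "\<lambda>k. {?t k..<?t (Suc k)}"
  let ?e = "\<lambda>k. ennreal (2 powr (- (1 - \<theta>) * real k) * a (?t k))"
  have "energy \<le> (\<Sum>k. ennreal ((T * 2 powr (-real (Suc k))) powr (-\<theta>) * a (?t (Suc k))) * emeasure lborel (?A k))"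
    unfolding energy_def
  proof (rule nn_integral_le_suminf_cover)
    fix x assume "ennreal ((T - x) powr - \<theta> * a x) * indicator {0..<T} x \<noteq> 0"
    then have x: "x \<in> {0..<T}" by (auto simp: indicator_def split: if_splits)
    from dyadic_covering[OF T_pos x] obtain k where k: "x \<in> ?A k" by auto
    have "(T - x) powr (-\<theta>) \<le> (T * 2 powr (-real (Suc k))) powr (-\<theta>)"
      using \<theta> x k T_pos by (intro powr_mono2') (auto simp: algebra_simps)
    moreover have "a x \<le> a (?t (Suc k))"
      using x k dyadic_in[of "Suc k"] by (intro a_le) auto
    ultimately have "(T - x) powr (-\<theta>) * a x \<le> (T * 2 powr (-real (Suc k))) powr (-\<theta>) * a (?t (Suc k))"
      using a_nonneg[OF x] by (intro mult_mono) auto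
    then have "ennreal ((T - x) powr - \<theta> * a x) * indicator {0..<T} x
        \<le> ennreal ((T * 2 powr (-real (Suc k))) powr (-\<theta>) * a (?t (Suc k)))"
      using x by (simp add: ennreal_leI del: of_nat_Suc)
    then show "\<exists>k. x \<in> ?A k \<and> ennreal ((T - x) powr - \<theta> * a x) * indicator {0..<T} x
        \<le> ennreal ((T * 2 powr (-real (Suc k))) powr (-\<theta>) * a (?t (Suc k)))"
      using k by blast
  qed simp
  also have "\<dots> = (\<Sum>k. ennreal (T powr (1 - \<theta>)) * ?e (Suc k))"
  proof (intro suminf_cong)
    fix k
    have "?t (Suc k) - ?t k = T * 2 powr (- real (Suc k))"
      by (simp add: two_powr_minus_Suc field_simps del: of_nat_Suc)
    then have e: "emeasure lborel (?A k) = ennreal (T * 2 powr (- real (Suc k)))"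
      using T_pos by simp
    have *: "T powr (1 - \<theta>) * (2 powr (- (1 - \<theta>) * real (Suc k)) * A)
        = (T * 2 powr (-real (Suc k))) powr (-\<theta>) * A * (T * 2 powr (- real (Suc k)))" for A
    proof -
      have "T powr (1 - \<theta>) = T powr (-\<theta>) * T" 
        using T_pos powr_add[of T "-\<theta>" 1] by simp
      moreover have "(2::real) powr (- (1 - \<theta>) * real (Suc k)) = (2 powr (- real (Suc k))) powr (-\<theta>) * 2 powr (- real (Suc k))"
        unfolding powr_powr powr_add[symmetric] by (simp add: algebra_simps)
      ultimately show ?thesis using T_pos by (simp add: powr_mult)
    qed
    show "ennreal ((T * 2 powr (-real (Suc k))) powr (-\<theta>) * a (?t (Suc k))) * emeasure lborel (?A k)
      = ennreal (T powr (1 - \<theta>)) * ?e (Suc k)"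
      using T_pos a_nonneg[OF dyadic_in[of "Suc k"]] unfolding e
      by (subst (1 2) ennreal_mult[symmetric]) (auto simp only: * intro!: mult_nonneg_nonneg powr_ge_zero)
  qed
  also have "\<dots> = ennreal (T powr (1 - \<theta>)) * (\<Sum>k. ?e (Suc k))" by simp
  also have "\<dots> \<le> ennreal (T powr (1 - \<theta>)) * dyadic_energy"
  proof -
    have "(\<Sum>k. ?e (Suc k)) \<le> dyadic_energy" 
      unfolding dyadic_energy_def using suminf_offset[of ?e 1] by (simp del: of_nat_Suc)
    then show ?thesis by (rule mult_left_mono) simp
  qed
  finally show ?thesis .
qed

lemma energy_finite_iff: "energy < \<infinity> \<longleftrightarrow> dyadic_energy < \<infinity>"
proof
  assume "energy < \<infinity>"
  then have "ennreal (T powr (1 - \<theta>) / 2) * dyadic_energy < \<infinity>"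
    using dyadic_energy_le by (rule order.strict_trans1[rotated])
  then show "dyadic_energy < \<infinity>"
    using T_pos by (auto simp: ennreal_mult_less_top)
next
  assume "dyadic_energy < \<infinity>"
  then have "ennreal (T powr (1 - \<theta>)) * dyadic_energy < \<infinity>"
    by (simp add: ennreal_mult_less_top)
  then show "energy < \<infinity>" using energy_le by (rule order.strict_trans1[rotated])
qed

end


section \<open>Time-nets: the upper bound\<close>

text \<open>The strict inequality matches the intervals
  \<open>{\<tau> ! (i - 1)<..\<tau> ! i}\<close> of the step process: at a node it is the previous
  node that counts. At u = 0 no node of a time-net qualifies and the maximum is unspecified, so the
  statements about it assume 0 < u.\<close>

definition left_node :: "real list \<Rightarrow> real \<Rightarrow> real" where
  "left_node \<tau> u = Max {t \<in> set \<tau>. t < u}"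

lemma time_nets_nth_less:
  assumes "\<tau> \<in> time_nets T" "i < j" "j < length \<tau>"
  shows "\<tau> ! i < \<tau> ! j"
  using assms by (auto simp: time_nets_def sorted_wrt_nth_less)

lemma time_nets_nth_mono:
  assumes "\<tau> \<in> time_nets T" "i \<le> j" "j < length \<tau>"
  shows "\<tau> ! i \<le> \<tau> ! j"
  using time_nets_nth_less[OF assms(1), of i j] assms(2,3) by (cases "i = j") simp_all

lemma time_nets_nth_bounds:
  assumes "\<tau> \<in> time_nets T" "i < length \<tau>"
  shows "0 \<le> \<tau> ! i" "\<tau> ! i \<le> T"
proof -
  have *: "\<tau> ! 0 = 0" "\<tau> ! (length \<tau> - 1) = T"
    using assms by (auto simp: time_nets_def hd_conv_nth last_conv_nth)
  show "0 \<le> \<tau> ! i"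
    using time_nets_nth_less[OF assms(1), of 0 i] assms(2) * by (cases "i = 0") simp_all
  show "\<tau> ! i \<le> T"
  proof (cases "i = length \<tau> - 1")
    case False
    then have "i < length \<tau> - 1" "length \<tau> - 1 < length \<tau>" using assms(2) by linarith+
    then show ?thesis using time_nets_nth_less[OF assms(1), of i "length \<tau> - 1"] * by simp
  qed (use * in simp)
qed

lemma left_node_cases:
  assumes \<tau>: "\<tau> \<in> time_nets T" and u: "0 < u" "u \<le> T"
  obtains i where "i \<in> {1..<length \<tau>}" "u \<in> {\<tau> ! (i - 1)<..\<tau> ! i}" "left_node \<tau> u = \<tau> ! (i - 1)"
proof -
  have *: "\<tau> \<noteq> []" "\<tau> ! 0 = 0" "\<tau> ! (length \<tau> - 1) = T"
    using \<tau> by (auto simp: time_nets_def hd_conv_nth last_conv_nth)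
  define i where "i = (LEAST i. i < length \<tau> \<and> u \<le> \<tau> ! i)"
  have i: "i < length \<tau> \<and> u \<le> \<tau> ! i" unfolding i_def
    by (rule LeastI[of _ "length \<tau> - 1"]) (use * u in auto)
  have i0: "i \<noteq> 0" using i * u by (intro notI) auto
  have less: "\<tau> ! (i - 1) < u"
    using not_less_Least[of "i - 1" "\<lambda>i. i < length \<tau> \<and> u \<le> \<tau> ! i"] i i0
    unfolding i_def[symmetric] by auto
  have "left_node \<tau> u = \<tau> ! (i - 1)"
    unfolding left_node_def
  proof (rule Max_eqI)
    fix y assume "y \<in> {t \<in> set \<tau>. t < u}"
    then obtain j where j: "j < length \<tau>" "y = \<tau> ! j" "y < u" by (auto simp: in_set_conv_nth)
    have "j \<le> i - 1"
    proof (rule ccontr)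
      assume "\<not> j \<le> i - 1"
      then have "i \<le> j" using i0 by auto
      then have "\<tau> ! i \<le> \<tau> ! j" using time_nets_nth_mono[OF \<tau>, of i j] j by auto
      then show False using i j by auto
    qed
    then show "y \<le> \<tau> ! (i - 1)"
      using time_nets_nth_mono[OF \<tau>, of j "i - 1"] i j by auto
  qed (use i less in \<open>auto intro: nth_mem\<close>)
  then show ?thesis using that[of i] i i0 less by auto
qed

lemma left_node_bounds:
  assumes "\<tau> \<in> time_nets T" "0 < u" "u \<le> T"
  shows "0 \<le> left_node \<tau> u" "left_node \<tau> u < u"
  using left_node_cases[OF assms] time_nets_nth_bounds[OF assms(1)]
  by (smt (verit) atLeastLessThan_iff diff_le_self greaterThanAtMost_iff order_le_less_trans)+

lemma left_node_mono:
  assumes "\<tau> \<in> time_nets T" "0 < u" "u \<le> v"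
  shows "left_node \<tau> u \<le> left_node \<tau> v"
  unfolding left_node_def
proof (rule Max_mono)
  have "0 \<in> set \<tau>" using assms(1) hd_in_set[of \<tau>] by (auto simp: time_nets_def)
  then show "{t \<in> set \<tau>. t < u} \<noteq> {}" using assms by auto
qed (use assms in auto)

lemma step_process_left_node:
  fixes f :: "real \<Rightarrow> real"
  assumes \<tau>: "\<tau> \<in> time_nets T" and u: "0 < u" "u \<le> T"
  shows "(\<Sum>i = 1..<length \<tau>. f (\<tau> ! (i - 1)) * indicator {\<tau> ! (i - 1)<..\<tau> ! i} u) = f (left_node \<tau> u)"
proof -
  obtain i where i: "i \<in> {1..<length \<tau>}" "u \<in> {\<tau> ! (i - 1)<..\<tau> ! i}" "left_node \<tau> u = \<tau> ! (i - 1)"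
    using left_node_cases[OF assms] .
  have "u \<notin> {\<tau> ! (j - 1)<..\<tau> ! j}" if "j \<in> {1..<length \<tau>}" "j \<noteq> i" for j
  proof (cases "j < i")
    case True
    then have "\<tau> ! j \<le> \<tau> ! (i - 1)"
      using time_nets_nth_mono[OF \<tau>, of j "i - 1"] i by auto
    then show ?thesis using i by auto
  next
    case False
    then have "\<tau> ! i \<le> \<tau> ! (j - 1)"
      using time_nets_nth_mono[OF \<tau>, of i "j - 1"] i that by auto
    then show ?thesis using i by auto
  qed
  then have "(\<Sum>i = 1..<length \<tau>. f (\<tau> ! (i - 1)) * indicator {\<tau> ! (i - 1)<..\<tau> ! i} u)
     = (\<Sum>j = 1..<length \<tau>. if j = i then f (\<tau> ! (i - 1)) else 0)"
    using i by (intro sum.cong) (auto simp: indicator_def)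
  then show ?thesis using i by simp
qed

lemma net_norm_ge:
  assumes "i \<in> {1..<length \<tau>}"
  shows "(\<tau> ! i - \<tau> ! (i - 1)) / (T - \<tau> ! (i - 1)) powr (1 - \<theta>) \<le> net_norm T \<theta> \<tau>"
  unfolding net_norm_def using assms by (intro cSUP_upper) auto

lemma net_norm_nonneg:
  assumes "\<tau> \<in> time_nets T" "0 < T"
  shows "0 \<le> net_norm T \<theta> \<tau>"
proof -
  obtain i where i: "i \<in> {1..<length \<tau>}" using left_node_cases[OF assms(1), of T] assms by auto
  have "0 \<le> (\<tau> ! i - \<tau> ! (i - 1)) / (T - \<tau> ! (i - 1)) powr (1 - \<theta>)"
    using time_nets_nth_less[OF assms(1), of "i - 1" i] i by auto
  then show ?thesis using net_norm_ge[OF i] by (rule order_trans)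
qed

text \<open>The ratio \<open>(w - v) / (T - v)\<close> decreases in \<open>v\<close>, so the bound at the left node is the worst one.\<close>

lemma interval_length_le_net_norm:
  assumes \<tau>: "\<tau> \<in> time_nets T" and w: "0 < w" "w \<le> T" and \<theta>: "0 \<le> \<theta>"
    and v: "left_node \<tau> w \<le> v" "v < w"
  shows "w - v \<le> net_norm T \<theta> \<tau> * (T - v) powr (1 - \<theta>)"
proof -
  let ?h = "net_norm T \<theta> \<tau>"
  obtain i where i: "i \<in> {1..<length \<tau>}" "w \<in> {\<tau> ! (i - 1)<..\<tau> ! i}" "left_node \<tau> w = \<tau> ! (i - 1)"
    using left_node_cases[OF \<tau> w] .
  define l where "l = \<tau> ! (i - 1)"
  have l: "l \<le> v" "l < T" "v < T" using i v w by (auto simp: l_def)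
  have h: "0 \<le> ?h" using net_norm_nonneg[OF \<tau>] w by auto
  have "w - l \<le> \<tau> ! i - l" using i by auto
  also have "\<dots> \<le> ?h * (T - l) powr (1 - \<theta>)"
    using net_norm_ge[OF i(1), of T \<theta>, folded l_def] l by (simp add: pos_divide_le_eq)
  also have "(T - l) powr (1 - \<theta>) = (T - l) powr (-\<theta>) * (T - l)"
    using l powr_add[of "T - l" "-\<theta>" 1] by simp
  finally have 1: "(w - l) / (T - l) \<le> ?h * (T - l) powr (-\<theta>)"
    using l by (simp add: field_simps)
  have "(w - v) / (T - v) \<le> (w - l) / (T - l)"
  proof -
    have "0 \<le> (T - w) * (v - l)" using l w by simp
    then show ?thesis using l by (simp add: divide_simps) (simp add: algebra_simps)
  qed
  also have "\<dots> \<le> ?h * (T - v) powr (-\<theta>)"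
    using 1 h l \<theta> by (elim order_trans) (auto intro!: mult_left_mono powr_mono2')
  finally have "w - v \<le> ?h * ((T - v) powr (-\<theta>) * (T - v))"
    using l by (simp add: field_simps)
  also have "(T - v) powr (-\<theta>) * (T - v) = (T - v) powr (1 - \<theta>)"
    using l powr_add[of "T - v" "-\<theta>" 1] by simp
  finally show ?thesis .
qed

section \<open>Layer cake estimate for the error of a net\<close>

context growth_profile
begin

definition net_error :: "real list \<Rightarrow> ennreal" where
  "net_error \<tau> = (\<integral>\<^sup>+u\<in>{0<..<T}. ennreal (a u - a (left_node \<tau> u)) \<partial>lborel)"

lemma a_open_measurable [measurable]: "(\<lambda>u. indicator {0<..<T} u * a u) \<in> borel_measurable borel"
proof -
  have "(\<lambda>u. indicator {0<..<T} u * (indicator {0..<T} u * a u)) \<in> borel_measurable borel"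
    by measurable
  also have "(\<lambda>u. indicator {0<..<T} u * (indicator {0..<T} u * a u)) = (\<lambda>u. indicator {0<..<T} u * a u)"
    by (auto simp: indicator_def)
  finally show ?thesis .
qed

lemma a_left_node_measurable:
  assumes "\<tau> \<in> time_nets T"
  shows "(\<lambda>u. indicator {0<..<T} u * a (left_node \<tau> u)) \<in> borel_measurable borel"
proof -
  have "mono_on {0<..<T} (\<lambda>u. a (left_node \<tau> u))"
  proof (rule mono_onI)
    fix r s assume rs: "r \<in> {0<..<T}" "s \<in> {0<..<T}" "r \<le> s"
    then show "a (left_node \<tau> r) \<le> a (left_node \<tau> s)"
      using left_node_mono[OF assms, of r s] left_node_bounds[OF assms, of r]
        left_node_bounds[OF assms, of s] by (intro a_le) auto
  qed
  then have "(\<lambda>u. a (left_node \<tau> u)) \<in> borel_measurable (restrict_space borel {0<..<T})"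
    by (rule borel_measurable_mono_on_fnc)
  then show ?thesis
    by (subst (asm) borel_measurable_restrict_space_iff) auto
qed

lemma a_left_node:
  assumes "\<tau> \<in> time_nets T" "u \<in> {0<..<T}"
  shows "0 \<le> a (left_node \<tau> u)" "a (left_node \<tau> u) \<le> a u"
proof -
  have "0 \<le> left_node \<tau> u" "left_node \<tau> u < u" using left_node_bounds[OF assms(1), of u] assms(2) by auto
  then show "0 \<le> a (left_node \<tau> u)" "a (left_node \<tau> u) \<le> a u"
    using assms(2) by (auto intro!: a_nonneg a_le)
qed

text \<open>If a left node \<open>left_node \<tau> w\<close> lay beyond another point of the level
  set, \<open>a\<close> would already be at least \<open>y\<close> there; so every point of the set
  has its left node at or before the infimum \<open>v\<close>. Hence the set lies in an interval
  starting at \<open>v\<close> whose length is at most the net norm times (T - v)^(1-\<theta>),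
  which is (1-\<theta>) times the integral of (T - u)^(-\<theta>) over [v,T). Beyond
  \<open>v\<close> one has y \<le> a u by monotonicity.\<close>

lemma level_set_bound:
  assumes \<tau>: "\<tau> \<in> time_nets T"
  shows "emeasure lborel {u\<in>{0<..<T}. a (left_node \<tau> u) < y \<and> y \<le> a u}
    \<le> ennreal ((1 - \<theta>) * net_norm T \<theta> \<tau>) *
      (\<integral>\<^sup>+u\<in>{u\<in>{0<..<T}. 0 < y \<and> y \<le> a u}. ennreal ((T - u) powr (-\<theta>)) \<partial>lborel)"
    (is "emeasure _ ?S \<le> ennreal ((1 - \<theta>) * ?h) * ?I")
proof (cases "?S = {}")
  case False
  define v where "v = Inf ?S"
  have bdd: "bdd_below ?S" by (rule bdd_belowI[of _ 0]) auto
  have h: "0 \<le> ?h" using net_norm_nonneg[OF \<tau> T_pos] .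
  obtain w0 where w0: "w0 \<in> ?S" using False by auto
  have y: "0 < y" using w0 a_left_node(1)[OF \<tau>, of w0] by auto
  have v: "0 \<le> v" "v < T"
    using cInf_greatest[OF False, of 0] cInf_lower[OF w0 bdd] w0 by (auto simp: v_def)
  have left: "left_node \<tau> w \<le> v" if w: "w \<in> ?S" for w
    unfolding v_def
  proof (rule cInf_greatest[OF False])
    fix w' assume w': "w' \<in> ?S"
    show "left_node \<tau> w \<le> w'"
    proof (rule ccontr)
      assume "\<not> left_node \<tau> w \<le> w'"
      then have "a w' \<le> a (left_node \<tau> w)"
        using w w' left_node_bounds[OF \<tau>, of w] by (intro a_le) auto
      then show False using w w' by auto
    qed
  qed
  have "?S \<subseteq> {v..v + ?h * (T - v) powr (1 - \<theta>)}"
  proof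
    fix w assume w: "w \<in> ?S"
    have "v \<le> w" unfolding v_def by (rule cInf_lower[OF w bdd])
    moreover have "w \<le> v + ?h * (T - v) powr (1 - \<theta>)"
    proof (cases "v = w")
      case True then show ?thesis using h by simp
    next
      case False
      then have "w - v \<le> ?h * (T - v) powr (1 - \<theta>)"
        using \<open>v \<le> w\<close> left[OF w] w \<theta> by (intro interval_length_le_net_norm[OF \<tau>]) auto
      then show ?thesis by simp
    qed
    ultimately show "w \<in> {v..v + ?h * (T - v) powr (1 - \<theta>)}" by simp
  qed
  then have "emeasure lborel ?S \<le> emeasure lborel {v..v + ?h * (T - v) powr (1 - \<theta>)}"
    by (rule emeasure_mono) simp
  also have "\<dots> = ennreal (?h * (T - v) powr (1 - \<theta>))"
    using h by simp
  also have "\<dots> = ennreal ((1 - \<theta>) * ?h) * ennreal ((T - v) powr (1 - \<theta>) / (1 - \<theta>))"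
    using h \<theta> by (subst ennreal_mult[symmetric]) auto
  also have "ennreal ((T - v) powr (1 - \<theta>) / (1 - \<theta>)) = (\<integral>\<^sup>+u\<in>{v..<T}. ennreal ((T - u) powr (-\<theta>)) \<partial>lborel)"
    using v \<theta> by (subst nn_integral_powr_tail) auto
  \<comment> \<open>The infimum \<open>v\<close> need not belong to the level set and may be 0;
    being a single point, it is discarded.\<close>
  also have "\<dots> \<le> ?I"
  proof (rule nn_integral_mono_AE, use AE_lborel_singleton[of v] in eventually_elim)
    fix u assume "u \<noteq> v"
    have "u \<in> {0<..<T} \<and> y \<le> a u" if u: "u \<in> {v..<T}"
    proof -
      have "v < u" using u \<open>u \<noteq> v\<close> by auto
      then obtain w where w: "w \<in> ?S" "w < u"
        unfolding v_def using cInf_lessD[OF False] by blast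
      then have "a w \<le> a u" using u by (intro a_le) auto
      then show ?thesis using w u by auto
    qed
    then show "ennreal ((T - u) powr - \<theta>) * indicator {v..<T} u
        \<le> ennreal ((T - u) powr - \<theta>) * indicator {u\<in>{0<..<T}. 0 < y \<and> y \<le> a u} u"
      using y by (auto simp: indicator_def)
  qed
  finally show ?thesis by (simp add: mult_left_mono)
qed (simp only: emeasure_empty zero_le)

text \<open>Both sides are linear in \<open>a\<close>; the layer cake formula reduces the claim to one level set.\<close>

lemma net_error_le:
  assumes \<tau>: "\<tau> \<in> time_nets T"
  shows "net_error \<tau> \<le> ennreal ((1 - \<theta>) * net_norm T \<theta> \<tau>) * energy"
proof -
  let ?c = "ennreal ((1 - \<theta>) * net_norm T \<theta> \<tau>)"
  \<comment> \<open>Cutting off outside (0,T) yields Borel functions on the whole line, as Fubini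
    requires; the error at u is then the length of the set of levels y in (B u, A u].\<close>
  define A where "A u = indicator {0<..<T} u * a u" for u
  define B where "B u = indicator {0<..<T} u * a (left_node \<tau> u)" for u
  have [measurable]: "A \<in> borel_measurable borel" "B \<in> borel_measurable borel"
    using a_open_measurable a_left_node_measurable[OF \<tau>] by (auto simp: A_def[abs_def] B_def[abs_def])
  have AB: "0 \<le> B u" "B u \<le> A u" "0 \<le> A u" for u
    using a_left_node[OF \<tau>, of u] by (auto simp: A_def B_def indicator_def)
  have "net_error \<tau> = (\<integral>\<^sup>+u. (\<integral>\<^sup>+y. indicator {B u<..A u} y \<partial>lborel) \<partial>lborel)"
    unfolding net_error_def
  proof (rule nn_integral_cong)
    fix u
    have "(\<integral>\<^sup>+y. indicator {B u<..A u} y \<partial>lborel) = ennreal (A u - B u)"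
      using AB[of u] by (subst nn_integral_indicator) auto
    then show "ennreal (a u - a (left_node \<tau> u)) * indicator {0<..<T} u
        = (\<integral>\<^sup>+y. indicator {B u<..A u} y \<partial>lborel)"
      by (cases "u \<in> {0<..<T}") (simp_all add: A_def B_def)
  qed
  also have "\<dots> = (\<integral>\<^sup>+u. (\<integral>\<^sup>+y. indicator {p. B (fst p) < snd p \<and> snd p \<le> A (fst p)} (u, y) \<partial>lborel) \<partial>lborel)"
    by (intro nn_integral_cong) (auto simp: indicator_def)
  also have "\<dots> = (\<integral>\<^sup>+y. (\<integral>\<^sup>+u. indicator {p. B (fst p) < snd p \<and> snd p \<le> A (fst p)} (u, y) \<partial>lborel) \<partial>lborel)"
    by (rule lborel_pair.Fubini[symmetric]) measurable
  also have "\<dots> \<le> (\<integral>\<^sup>+y. ?c * (\<integral>\<^sup>+u. ennreal ((T - u) powr (-\<theta>)) *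
      indicator {p. fst p \<in> {0<..<T} \<and> 0 < snd p \<and> snd p \<le> A (fst p)} (u, y) \<partial>lborel) \<partial>lborel)"
  proof (rule nn_integral_mono)
    fix y
    have "(\<integral>\<^sup>+u. indicator {p. B (fst p) < snd p \<and> snd p \<le> A (fst p)} (u, y) \<partial>lborel)
       = (\<integral>\<^sup>+u. indicator {u. B u < y \<and> y \<le> A u} u \<partial>lborel)"
      by (intro nn_integral_cong) (auto simp: indicator_def)
    also have "\<dots> = emeasure lborel {u. B u < y \<and> y \<le> A u}"
      by (rule nn_integral_indicator) measurable
    also have "{u. B u < y \<and> y \<le> A u} = {u\<in>{0<..<T}. a (left_node \<tau> u) < y \<and> y \<le> a u}"
      by (auto simp: A_def B_def indicator_def split: if_splits)
    also note level_set_bound[OF \<tau>, of y]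
    also have "(\<integral>\<^sup>+u\<in>{u\<in>{0<..<T}. 0 < y \<and> y \<le> a u}. ennreal ((T - u) powr (-\<theta>)) \<partial>lborel)
      = (\<integral>\<^sup>+u. ennreal ((T - u) powr (-\<theta>)) *
      indicator {p. fst p \<in> {0<..<T} \<and> 0 < snd p \<and> snd p \<le> A (fst p)} (u, y) \<partial>lborel)"
      by (intro nn_integral_cong) (auto simp: A_def indicator_def)
    finally show "(\<integral>\<^sup>+u. indicator {p. B (fst p) < snd p \<and> snd p \<le> A (fst p)} (u, y) \<partial>lborel)
      \<le> ?c * (\<integral>\<^sup>+u. ennreal ((T - u) powr (-\<theta>)) *
      indicator {p. fst p \<in> {0<..<T} \<and> 0 < snd p \<and> snd p \<le> A (fst p)} (u, y) \<partial>lborel)" .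
  qed
  also have "\<dots> = ?c * (\<integral>\<^sup>+y. (\<integral>\<^sup>+u. ennreal ((T - u) powr (-\<theta>)) *
      indicator {p. fst p \<in> {0<..<T} \<and> 0 < snd p \<and> snd p \<le> A (fst p)} (u, y) \<partial>lborel) \<partial>lborel)"
    by (rule nn_integral_cmult) measurable
  \<comment> \<open>The exchange in the opposite direction reassembles the level sets into
    \<open>A u\<close>, now with the weight of the energy.\<close>
  also have "(\<integral>\<^sup>+y. (\<integral>\<^sup>+u. ennreal ((T - u) powr (-\<theta>)) *
      indicator {p. fst p \<in> {0<..<T} \<and> 0 < snd p \<and> snd p \<le> A (fst p)} (u, y) \<partial>lborel) \<partial>lborel)
    = (\<integral>\<^sup>+u. (\<integral>\<^sup>+y. ennreal ((T - u) powr (-\<theta>)) *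
      indicator {p. fst p \<in> {0<..<T} \<and> 0 < snd p \<and> snd p \<le> A (fst p)} (u, y) \<partial>lborel) \<partial>lborel)"
    by (rule lborel_pair.Fubini'[where f = "\<lambda>u y. ennreal ((T - u) powr (-\<theta>)) *
      indicator {p. fst p \<in> {0<..<T} \<and> 0 < snd p \<and> snd p \<le> A (fst p)} (u, y)"]) measurable
  also have "\<dots> = (\<integral>\<^sup>+u. ennreal ((T - u) powr (-\<theta>) * A u) \<partial>lborel)"
  proof (intro nn_integral_cong)
    fix u
    have "(\<integral>\<^sup>+y. ennreal ((T - u) powr (-\<theta>)) *
      indicator {p. fst p \<in> {0<..<T} \<and> 0 < snd p \<and> snd p \<le> A (fst p)} (u, y) \<partial>lborel)
      = (\<integral>\<^sup>+y. ennreal ((T - u) powr (-\<theta>)) * indicator {0<..A u} y \<partial>lborel)"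
      by (intro nn_integral_cong) (auto simp: A_def indicator_def)
    also have "\<dots> = ennreal ((T - u) powr (-\<theta>)) * ennreal (A u)"
      using AB by (subst nn_integral_cmult_indicator) auto
    finally show "(\<integral>\<^sup>+y. ennreal ((T - u) powr (-\<theta>)) *
      indicator {p. fst p \<in> {0<..<T} \<and> 0 < snd p \<and> snd p \<le> A (fst p)} (u, y) \<partial>lborel)
      = ennreal ((T - u) powr (-\<theta>) * A u)"
      using AB by (simp add: ennreal_mult)
  qed
  also have "\<dots> \<le> energy"
    unfolding energy_def by (intro nn_integral_mono) (auto simp: A_def indicator_def)
  finally show ?thesis by (simp add: mult_left_mono)
qed

end


section \<open>Equidistant nets in the power coordinate\<close>

text \<open>For p = 1/\<theta> this is the solution of u' = (T^\<theta> / \<theta>) (T -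
  u)^(1-\<theta>) with u(0) = 0, so that to first order equal steps in x contribute equally to
  \<open>net_norm\<close>.\<close>

definition power_node :: "real \<Rightarrow> real \<Rightarrow> real \<Rightarrow> real" where
  "power_node T p x = T * (1 - (1 - x) powr p)"

definition clip :: "real \<Rightarrow> real" where
  "clip y = max 0 (min 1 y)"

text \<open>For \<open>\<sigma> = 0, 1\<close> the parameters of the nodes are the even and the odd multiples of \<open>1/(2 n)\<close>
  (clipped to the unit interval).\<close>

definition power_net :: "real \<Rightarrow> real \<Rightarrow> nat \<Rightarrow> nat \<Rightarrow> real list" where
  "power_net T p \<sigma> n = map (\<lambda>i. power_node T p (clip ((2 * real i - real \<sigma>) / (2 * real n)))) [0..<Suc (n + \<sigma>)]"

lemma power_net_nth:
  "i < Suc (n + \<sigma>) \<Longrightarrow>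
    power_net T p \<sigma> n ! i = power_node T p (clip ((2 * real i - real \<sigma>) / (2 * real n)))"
  by (simp add: power_net_def del: upt_Suc)

lemma power_node_less: "0 < T \<Longrightarrow> 0 < p \<Longrightarrow> y \<le> 1 \<Longrightarrow> x < y \<Longrightarrow> power_node T p x < power_node T p y"
  by (simp add: power_node_def powr_less_mono2)

lemma power_node_le: "0 < T \<Longrightarrow> 0 < p \<Longrightarrow> y \<le> 1 \<Longrightarrow> x \<le> y \<Longrightarrow> power_node T p x \<le> power_node T p y"
  using power_node_less[of T p y x] by (cases "x = y") simp_all

lemma power_node_0 [simp]: "power_node T p 0 = 0"
  by (simp add: power_node_def)

lemma power_node_1 [simp]: "power_node T p 1 = T"
  by (simp add: power_node_def)

lemma power_node_in:
  assumes "0 < T" "0 < p" "0 \<le> x" "x < 1"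
  shows "power_node T p x \<in> {0..<T}"
  using power_node_le[of T p x 0] power_node_less[of T p 1 x] assms by simp

lemma clip_less: "y < z \<Longrightarrow> y < 1 \<Longrightarrow> 0 < z \<Longrightarrow> clip y < clip z"
  by (simp add: clip_def min_def max_def)

lemma clip_bounds: "0 \<le> clip y" "clip y \<le> 1"
  by (simp_all add: clip_def)

text \<open>Clipping keeps the parameters strictly increasing because only the first of them can be
  \<le> 0 and only the last can be \<ge> 1.\<close>

lemma power_net_in_time_nets:
  assumes T: "0 < T" "0 < p" and n: "0 < n" and \<sigma>: "\<sigma> \<le> 1"
  shows "power_net T p \<sigma> n \<in> time_nets T"
proof -
  let ?y = "\<lambda>i::nat. (2 * real i - real \<sigma>) / (2 * real n)"
  let ?f = "\<lambda>i. power_node T p (clip (?y i))"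
  have "?y 0 \<le> 0" by simp
  then have first: "clip (?y 0) = 0" unfolding clip_def by linarith
  have "1 \<le> ?y (n + \<sigma>)" using n \<sigma> by (simp add: field_simps)
  then have last: "clip (?y (n + \<sigma>)) = 1" by (simp add: clip_def)
  have less: "?f i < ?f j" if "i < j" "j < Suc (n + \<sigma>)" for i j
  proof (rule power_node_less[OF T clip_bounds(2) clip_less])
    have "real i + 1 \<le> real j" "real j \<le> real n + real \<sigma>" "0 \<le> real i" "real \<sigma> \<le> 1" "0 < real n"
      using that n \<sigma> by linarith+
    then show "?y i < ?y j" "?y i < 1" "0 < ?y j" by (simp_all add: field_simps)
  qed
  have "sorted_wrt (<) (map ?f [0..<Suc (n + \<sigma>)])"
    unfolding sorted_wrt_iff_nth_less by (auto simp del: upt_Suc intro!: less)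
  moreover have "hd (map ?f [0..<Suc (n + \<sigma>)]) = 0"
    using first by (simp add: hd_map del: upt_Suc)
  moreover have "last (map ?f [0..<Suc (n + \<sigma>)]) = T"
    using last by simp
  ultimately show ?thesis unfolding time_nets_def power_net_def by simp
qed

text \<open>Mean value theorem for x^(1/\<theta>) on [1 - y, 1 - z]. As 1/\<theta> - 1 > 0, the
  derivative is largest at 1 - z, where it equals, up to a constant, the denominator (T -
  u(z))^(1-\<theta>).\<close>

lemma power_node_increment:
  assumes T: "0 < T" "0 < \<theta>" "\<theta> < 1" and zy: "0 \<le> z" "z < y" "y \<le> 1"
  shows "(power_node T (1/\<theta>) y - power_node T (1/\<theta>) z) / (T - power_node T (1/\<theta>) z) powr (1 - \<theta>)
    \<le> T powr \<theta> / \<theta> * (y - z)"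
proof -
  let ?p = "1 / \<theta>"
  have "\<exists>l x. 1 - y < x \<and> x < 1 - z \<and> ((\<lambda>x. x powr ?p) has_real_derivative l) (at x) \<and>
      (1 - z) powr ?p - (1 - y) powr ?p = ((1 - z) - (1 - y)) * l"
  proof (rule MVT)
    show "continuous_on {1 - y..1 - z} (\<lambda>x. x powr ?p)"
      using zy T by (intro continuous_on_powr' continuous_intros) auto
    fix x assume "1 - y < x" "x < 1 - z"
    then have "((\<lambda>x. x powr ?p) has_real_derivative (?p * x powr (?p - 1))) (at x)"
      using zy by (intro has_real_derivative_powr) auto
    then show "(\<lambda>x. x powr ?p) differentiable (at x)" by (auto simp: real_differentiable_def)
  qed (use zy in simp)
  then obtain l x where x: "1 - y < x" "x < 1 - z" "((\<lambda>x. x powr ?p) has_real_derivative l) (at x)"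
      "(1 - z) powr ?p - (1 - y) powr ?p = (y - z) * l" by auto
  have "((\<lambda>x. x powr ?p) has_real_derivative (?p * x powr (?p - 1))) (at x)"
    using zy x by (intro has_real_derivative_powr) auto
  then have l: "l = ?p * x powr (?p - 1)" using x(3) DERIV_unique by blast
  have "x powr (?p - 1) \<le> (1 - z) powr (?p - 1)"
    using x zy T by (intro powr_mono2) auto
  then have "l \<le> ?p * (1 - z) powr (?p - 1)" using T by (simp add: l divide_right_mono)
  then have le: "(1 - z) powr ?p - (1 - y) powr ?p \<le> (y - z) * (?p * (1 - z) powr (?p - 1))"
    using zy unfolding x(4) by (intro mult_left_mono) auto
  have "power_node T ?p y - power_node T ?p z \<le> T * ((y - z) * (?p * (1 - z) powr (?p - 1)))"
  proof -
    have "power_node T ?p y - power_node T ?p z = T * ((1 - z) powr ?p - (1 - y) powr ?p)"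
      by (simp add: power_node_def algebra_simps)
    then show ?thesis using le T by (simp only: mult_left_mono less_imp_le)
  qed
  moreover have "(T - power_node T ?p z) powr (1 - \<theta>) = T powr (1 - \<theta>) * (1 - z) powr (?p - 1)"
  proof -
    have "(T - power_node T ?p z) = T * (1 - z) powr ?p" by (simp add: power_node_def algebra_simps)
    moreover have "?p * (1 - \<theta>) = ?p - 1" using T by (simp add: field_simps)
    ultimately show ?thesis using T zy by (simp add: powr_mult powr_powr)
  qed
  moreover have "T * ((y - z) * (?p * (1 - z) powr (?p - 1)))
     = (T powr \<theta> / \<theta> * (y - z)) * (T powr (1 - \<theta>) * (1 - z) powr (?p - 1))"
  proof -
    have "T = T powr \<theta> * T powr (1 - \<theta>)" using T by (simp add: powr_add[symmetric])
    then show ?thesis by (metis (no_types, lifting) mult.assoc mult.commute mult.left_commute times_divide_eq_left mult_1)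
  qed
  moreover have "0 < T powr (1 - \<theta>) * (1 - z) powr (?p - 1)" using T zy by simp
  ultimately show ?thesis by (simp only: pos_divide_le_eq)
qed

lemma net_norm_power_net:
  assumes T: "0 < T" "0 < \<theta>" "\<theta> < 1" and n: "0 < n" and \<sigma>: "\<sigma> \<le> 1"
  shows "net_norm T \<theta> (power_net T (1/\<theta>) \<sigma> n) \<le> T powr \<theta> / \<theta> / real n"
  unfolding net_norm_def
proof (rule cSUP_least)
  let ?\<tau> = "power_net T (1/\<theta>) \<sigma> n"
  let ?y = "\<lambda>i::nat. (2 * real i - real \<sigma>) / (2 * real n)"
  show "{1..<length ?\<tau>} \<noteq> {}" using n by (simp add: power_net_def)
  fix i assume i: "i \<in> {1..<length ?\<tau>}"
  then have i': "1 \<le> i" "i < Suc (n + \<sigma>)" by (auto simp: power_net_def)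
  have nth: "?\<tau> ! i = power_node T (1/\<theta>) (clip (?y i))" "?\<tau> ! (i - 1) = power_node T (1/\<theta>) (clip (?y (i - 1)))"
    by (rule power_net_nth, use i' in simp)+
  have r: "real (i - 1) = real i - 1" using i' by simp
  have "?y (i - 1) < ?y i" "?y (i - 1) < 1" "0 < ?y i" "?y i - ?y (i - 1) = 1 / real n"
    using i' n \<sigma> unfolding r by (auto simp: field_simps)
  \<comment> \<open>Clipping does not increase distances, so the shortened first and last steps of
    the shifted net obey the same bound 1/n.\<close>
  then have less: "clip (?y (i - 1)) < clip (?y i)" and diff: "clip (?y i) - clip (?y (i - 1)) \<le> 1 / real n"
    by (auto intro: clip_less) (auto simp: clip_def min_def max_def)
  have "(?\<tau> ! i - ?\<tau> ! (i - 1)) / (T - ?\<tau> ! (i - 1)) powr (1 - \<theta>)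
      \<le> T powr \<theta> / \<theta> * (clip (?y i) - clip (?y (i - 1)))"
    unfolding nth by (rule power_node_increment[OF T clip_bounds(1) less clip_bounds(2)])
  also have "\<dots> \<le> T powr \<theta> / \<theta> * (1 / real n)"
    using diff T by (intro mult_left_mono) auto
  finally show "(?\<tau> ! i - ?\<tau> ! (i - 1)) / (T - ?\<tau> ! (i - 1)) powr (1 - \<theta>) \<le> T powr \<theta> / \<theta> / real n"
    by simp
qed

text \<open>The open interval \<open>(2 n x - 1, 2 n x)\<close> contains at most one integer, and \<open>\<sigma>\<close> is chosen to be of
  the other parity.\<close>

lemma left_node_power_net:
  assumes T: "0 < T" "0 < p" and n: "0 < n" and x: "1 / (2 * real n) \<le> x" "x < 1"
  shows "\<exists>\<sigma>\<le>1. left_node (power_net T p \<sigma> n) (power_node T p x) \<le> power_node T p (x - 1 / (2 * real n))"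
proof -
  let ?m = "2 * real n"
  \<comment> \<open>The largest integer strictly below 2 n x; strict because
    \<open>left_node\<close> excludes the point itself.\<close>
  define k where "k = \<lceil>?m * x\<rceil> - 1"
  have k: "real_of_int k < ?m * x" "?m * x \<le> real_of_int k + 1" unfolding k_def by linarith+
  define \<sigma> :: nat where "\<sigma> = (if even k then 1 else 0)"
  have x0: "0 < x" using x n by (smt (verit) divide_pos_pos of_nat_0_less_iff)
  have \<sigma>: "\<sigma> \<le> 1" by (simp add: \<sigma>_def)
  let ?\<tau> = "power_net T p \<sigma> n"
  have net: "?\<tau> \<in> time_nets T" by (rule power_net_in_time_nets[OF T n \<sigma>])
  have "left_node ?\<tau> (power_node T p x) \<le> power_node T p (x - 1 / ?m)"
    unfolding left_node_def
  proof (rule Max.boundedI)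
    have "0 \<in> set ?\<tau>" using net hd_in_set[of ?\<tau>] by (auto simp: time_nets_def)
    moreover have "0 < power_node T p x" using power_node_less[OF T, of x 0] x x0 by simp
    ultimately show "{t \<in> set ?\<tau>. t < power_node T p x} \<noteq> {}" by auto
    fix t assume "t \<in> {t \<in> set ?\<tau>. t < power_node T p x}"
    then obtain i where t: "t = power_node T p (clip ((2 * real i - real \<sigma>) / ?m))" "t < power_node T p x"
      by (auto simp: power_net_def simp del: upt_Suc)
    have "clip ((2 * real i - real \<sigma>) / ?m) < x"
      using t power_node_le[OF T clip_bounds(2), of x] by (meson not_le)
    then have y: "(2 * real i - real \<sigma>) / ?m < x" using x by (auto simp: clip_def)
    have "2 * int i - int \<sigma> \<noteq> k" by (auto simp: \<sigma>_def)
    moreover have "2 * int i - int \<sigma> \<le> k"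
    proof -
      have "real_of_int (2 * int i - int \<sigma>) < ?m * x" using y n by (simp add: field_simps)
      then have "real_of_int (2 * int i - int \<sigma>) < real_of_int (k + 1)" using k by simp
      then show ?thesis by linarith
    qed
    ultimately have "2 * int i - int \<sigma> + 1 \<le> k" by linarith
    then have "real_of_int (2 * int i - int \<sigma> + 1) \<le> real_of_int k" by linarith
    then have "2 * real i - real \<sigma> + 1 \<le> ?m * x" using k by simp
    then have "(2 * real i - real \<sigma>) / ?m \<le> (?m * x - 1) / ?m" by (intro divide_right_mono) auto
    then have "(2 * real i - real \<sigma>) / ?m \<le> x - 1 / ?m" using n by (simp add: diff_divide_distrib)
    then have "clip ((2 * real i - real \<sigma>) / ?m) \<le> x - 1 / ?m" using x by (simp add: clip_def)
    then show "t \<le> power_node T p (x - 1 / ?m)"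
      unfolding t using x x0 n by (intro power_node_le[OF T]) (auto intro: order_trans[of _ x])
  qed simp
  then show ?thesis using \<sigma> by blast
qed


lemma one_minus_powr_deriv:
  fixes q x :: real
  shows "x < 1 \<Longrightarrow> ((\<lambda>x. (1 - x) powr q) has_real_derivative - (q * (1 - x) powr (q - 1))) (at x)"
  by (rule DERIV_cong[OF DERIV_chain2[OF has_real_derivative_powr DERIV_diff[OF DERIV_const DERIV_ident]]]) auto

section \<open>The errors of the power nets in the coordinate x\<close>

context growth_profile
begin

definition node :: "real \<Rightarrow> real" where "node = power_node T (1/\<theta>)"
definition node' :: "real \<Rightarrow> real" where "node' x = T / \<theta> * (1 - x) powr (1/\<theta> - 1)"

lemma node_deriv: "x < 1 \<Longrightarrow> (node has_real_derivative node' x) (at x)"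
  unfolding node_def node'_def power_node_def[abs_def]
  by (rule DERIV_cong[OF DERIV_cmult[OF DERIV_diff[OF DERIV_const one_minus_powr_deriv]]]) auto

lemma node'_deriv:
  "x < 1 \<Longrightarrow> (node' has_real_derivative - (T / \<theta> * (1/\<theta> - 1) * (1 - x) powr (1/\<theta> - 2))) (at x)"
  unfolding node'_def[abs_def]
  by (rule DERIV_cong[OF DERIV_cmult[OF one_minus_powr_deriv]]) auto

lemma node'_measurable [measurable]: "node' \<in> borel_measurable borel"
  unfolding node'_def[abs_def] by measurable

lemma node'_nonneg: "0 \<le> node' x"
  using T_pos \<theta> by (simp add: node'_def)

text \<open>The exponent 1/\<theta> - 1 is positive. This sign makes the differences
  \<open>node' x - node' (x + h)\<close>, left over by the summation by parts, nonnegative.\<close>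

lemma node'_antimono: "x \<le> y \<Longrightarrow> y \<le> 1 \<Longrightarrow> node' y \<le> node' x"
  using T_pos \<theta> by (auto simp: node'_def intro!: mult_left_mono divide_right_mono powr_mono2)

lemma node_in: "0 \<le> x \<Longrightarrow> x < 1 \<Longrightarrow> node x \<in> {0..<T}"
  unfolding node_def using T_pos \<theta> by (intro power_node_in) auto

lemma node_le: "x \<le> y \<Longrightarrow> y \<le> 1 \<Longrightarrow> node x \<le> node y"
  unfolding node_def using T_pos \<theta> by (intro power_node_le) auto

lemma node_0: "node 0 = 0"
  by (simp add: node_def)

lemma node_pos: "0 < x \<Longrightarrow> x < 1 \<Longrightarrow> 0 < node x"
  unfolding node_def using power_node_less[of T "1/\<theta>" x 0] T_pos \<theta> by auto

text \<open>Since \<open>a\<close> is nonnegative on [0,T), the extension by 0 to negative x keeps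
  \<open>b\<close> nondecreasing on all of (-\<infinity>,1), from which measurability
  follows.\<close>

definition b :: "real \<Rightarrow> real" where "b x = indicator {0..<1} x * a (node x)"

lemma b_nonneg: "0 \<le> b x"
  using a_nonneg[OF node_in[of x]] by (simp add: b_def indicator_def)

lemma b_eq: "0 \<le> x \<Longrightarrow> x < 1 \<Longrightarrow> b x = a (node x)"
  by (simp add: b_def)

lemma b_mono: "x \<le> y \<Longrightarrow> y < 1 \<Longrightarrow> b x \<le> b y"
  using a_le[of "node x" "node y"] node_in[of x] node_in[of y] node_le[of x y] a_nonneg[OF node_in[of y]]
  by (auto simp: b_def indicator_def)

lemma b_measurable [measurable]: "b \<in> borel_measurable borel"
proof -
  have "b \<in> borel_measurable (restrict_space borel {..<1})"
    by (rule borel_measurable_mono_on_fnc) (auto intro!: mono_onI b_mono)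
  then have "(\<lambda>x. indicator {..<1} x * b x) \<in> borel_measurable borel"
    by (subst (asm) borel_measurable_restrict_space_iff) auto
  also have "(\<lambda>x. indicator {..<1} x * b x) = b"
    by (auto simp: b_def indicator_def)
  finally show ?thesis .
qed

text \<open>Change of variables u = node x. It is carried out on [0,r] with r < 1 because
  \<open>node_deriv\<close> is available only below 1. The point x = 0 is left out since
  \<open>left_node\<close> is unspecified there.\<close>

lemma net_error_ge_substituted:
  assumes \<tau>: "\<tau> \<in> time_nets T" and r: "0 \<le> r" "r < 1"
  shows "(\<integral>\<^sup>+x\<in>{0<..r}. ennreal ((b x - a (left_node \<tau> (node x))) * node' x) \<partial>lborel) \<le> net_error \<tau>"
proof -
  define f where "f u = indicator {0<..<T} u * a u - indicator {0<..<T} u * a (left_node \<tau> u)" for u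
  have [measurable]: "f \<in> borel_measurable borel"
    unfolding f_def[abs_def] using a_open_measurable a_left_node_measurable[OF \<tau>]
    by (rule borel_measurable_diff)
  have f0: "0 \<le> f u" for u
    using a_left_node[OF \<tau>, of u] by (auto simp: f_def indicator_def)
  have "(\<integral>\<^sup>+x\<in>{0<..r}. ennreal ((b x - a (left_node \<tau> (node x))) * node' x) \<partial>lborel)
    \<le> (\<integral>\<^sup>+x. ennreal (f (node x) * node' x * indicator {0..r} x) \<partial>lborel)"
  proof (rule nn_integral_mono)
    fix x
    show "ennreal ((b x - a (left_node \<tau> (node x))) * node' x) * indicator {0<..r} x
        \<le> ennreal (f (node x) * node' x * indicator {0..r} x)"
      using node_in[of x] node_pos[of x] r by (auto simp: indicator_def f_def b_eq)
  qed
  also have "\<dots> = (\<integral>\<^sup>+u. ennreal (f u * indicator {node 0..node r} u) \<partial>lborel)"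
  proof (rule nn_integral_substitution[symmetric])
    show "set_borel_measurable borel {node 0..node r} f"
      unfolding set_borel_measurable_def by measurable
    show "continuous_on {0..r} node'"
      using r by (intro DERIV_continuous_on[OF DERIV_subset[OF node'_deriv]]) auto
  qed (use r node_deriv node'_nonneg in auto)
  also have "\<dots> \<le> net_error \<tau>"
    unfolding net_error_def
    by (intro nn_integral_mono) (auto simp: indicator_def f_def)
  finally show ?thesis .
qed

text \<open>One net is not enough: where its last node is close behind \<open>node x\<close>, its
  error at that point may be arbitrarily small. Of the two shifted nets, one has its last node at or
  before \<open>node (x - h)\<close>, but which one depends on x. The sum of the two integrands
  dominates either of them.\<close>

lemma net_errors_ge:
  assumes n: "2 \<le> n"
  defines "h \<equiv> 1 / (2 * real n)"
  shows "(\<integral>\<^sup>+x\<in>{h..1-h}. ennreal ((b x - b (x - h)) * node' x) \<partial>lborel)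
    \<le> net_error (power_net T (1/\<theta>) 0 n) + net_error (power_net T (1/\<theta>) 1 n)"
proof -
  let ?\<tau> = "\<lambda>\<sigma>. power_net T (1/\<theta>) \<sigma> n"
  have h: "0 < h" "h < 1" using n by (auto simp: h_def)
  have net: "?\<tau> \<sigma> \<in> time_nets T" if "\<sigma> \<le> 1" for \<sigma>
    using that n T_pos \<theta> by (intro power_net_in_time_nets) auto
  let ?f = "\<lambda>\<sigma> x. ennreal ((b x - a (left_node (?\<tau> \<sigma>) (node x))) * node' x) * indicator {0<..1-h} x"
  have meas: "?f \<sigma> \<in> borel_measurable borel" if "\<sigma> \<le> 1" for \<sigma>
  proof -
    have "mono_on {0<..<1} (\<lambda>x. a (left_node (?\<tau> \<sigma>) (node x)))"
    proof (rule mono_onI)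
      fix x y :: real assume xy: "x \<in> {0<..<1}" "y \<in> {0<..<1}" "x \<le> y"
      then have "0 < node x" "node x \<le> node y" "0 < node y" "node y < T" "node x < T"
        using node_pos[of x] node_in[of x] node_in[of y] node_pos[of y] node_le[of x y] by auto
      then show "a (left_node (?\<tau> \<sigma>) (node x)) \<le> a (left_node (?\<tau> \<sigma>) (node y))"
        using left_node_mono[OF net[OF that], of "node x" "node y"]
          left_node_bounds[OF net[OF that], of "node x"] left_node_bounds[OF net[OF that], of "node y"]
        by (intro a_le) auto
    qed
    then have "(\<lambda>x. a (left_node (?\<tau> \<sigma>) (node x))) \<in> borel_measurable (restrict_space borel {0<..<1})"
      by (rule borel_measurable_mono_on_fnc)
    then have [measurable]: "(\<lambda>x. indicator {0<..<1} x * a (left_node (?\<tau> \<sigma>) (node x))) \<in> borel_measurable borel"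
      by (subst (asm) borel_measurable_restrict_space_iff) auto
    have "(\<lambda>x. ennreal ((b x - indicator {0<..<1} x * a (left_node (?\<tau> \<sigma>) (node x))) * node' x) * indicator {0<..1-h} x)
      \<in> borel_measurable borel" by measurable
    also have "(\<lambda>x. ennreal ((b x - indicator {0<..<1} x * a (left_node (?\<tau> \<sigma>) (node x))) * node' x) * indicator {0<..1-h} x) = ?f \<sigma>"
      using h by (auto simp: indicator_def)
    finally show ?thesis .
  qed
  have "(\<integral>\<^sup>+x\<in>{h..1-h}. ennreal ((b x - b (x - h)) * node' x) \<partial>lborel) \<le> (\<integral>\<^sup>+x. ?f 0 x + ?f 1 x \<partial>lborel)"
  proof (rule nn_integral_mono)
    fix x
    show "ennreal ((b x - b (x - h)) * node' x) * indicator {h..1-h} x \<le> ?f 0 x + ?f 1 x"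
    proof (cases "x \<in> {h..1-h}")
      case True
      then have x: "0 < x" "x < 1" "h \<le> x" "x \<le> 1 - h" using h by auto
      obtain \<sigma> where \<sigma>: "\<sigma> \<le> 1" "left_node (?\<tau> \<sigma>) (node x) \<le> node (x - h)"
        using left_node_power_net[of T "1/\<theta>" n x] T_pos \<theta> n x unfolding node_def h_def by auto
      have "a (left_node (?\<tau> \<sigma>) (node x)) \<le> a (node (x - h))"
        using left_node_bounds[OF net[OF \<sigma>(1)], of "node x"] node_pos[of x] node_in[of x] x \<sigma> node_in[of "x - h"] h
        by (intro a_le) auto
      then have "a (left_node (?\<tau> \<sigma>) (node x)) \<le> b (x - h)" using x h by (subst b_eq) auto
      then have "(b x - b (x - h)) * node' x \<le> (b x - a (left_node (?\<tau> \<sigma>) (node x))) * node' x"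
        using node'_nonneg by (intro mult_right_mono) auto
      then have "ennreal ((b x - b (x - h)) * node' x) * indicator {h..1-h} x \<le> ?f \<sigma> x"
        using x by (auto simp: ennreal_leI)
      also have "\<dots> \<le> ?f 0 x + ?f 1 x"
      proof -
        have "\<sigma> = 0 \<or> \<sigma> = 1" using \<sigma>(1) by auto
        then show ?thesis by (elim disjE; hypsubst) (rule add_increasing2 add_increasing, rule zero_le, rule order_refl)+
      qed
      finally show ?thesis .
    qed simp
  qed
  also have "\<dots> = (\<integral>\<^sup>+x. ?f 0 x \<partial>lborel) + (\<integral>\<^sup>+x. ?f 1 x \<partial>lborel)"
    using meas[of 0] meas[of 1] by (intro nn_integral_add) simp_all
  also have "\<dots> \<le> net_error (?\<tau> 0) + net_error (?\<tau> 1)"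
    using h by (intro add_mono net_error_ge_substituted net) auto
  finally show ?thesis .
qed

text \<open>Summation by parts, with the subtracted integrals moved to the other side.\<close>

lemma node'_difference_bound:
  assumes n: "2 \<le> n"
  defines "h \<equiv> 1 / (2 * real n)"
  shows "(\<integral>\<^sup>+x\<in>{0..1-2*h}. ennreal (b x * (node' x - node' (x + h))) \<partial>lborel)
    \<le> net_error (power_net T (1/\<theta>) 0 n) + net_error (power_net T (1/\<theta>) 1 n) + ennreal (h * (b h * node' 0))"
proof -
  have h: "0 < h" "2 * h < 1" using n by (auto simp: h_def)
  let ?E = "net_error (power_net T (1/\<theta>) 0 n) + net_error (power_net T (1/\<theta>) 1 n)"
  \<comment> \<open>The upper limit 1 - 2h is chosen such that the shift by h maps [0, 1 - 2h] onto
    the interval [h, 1 - h] of \<open>net_errors_ge\<close>.\<close>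
  let ?I = "\<integral>\<^sup>+x\<in>{0..1-2*h}. ennreal (b x * node' (x + h)) \<partial>lborel"
  let ?D = "\<integral>\<^sup>+x\<in>{0..1-2*h}. ennreal (b x * (node' x - node' (x + h))) \<partial>lborel"
  let ?P = "\<integral>\<^sup>+x\<in>{0..h}. ennreal (b x * node' x) \<partial>lborel"
  let ?G = "\<integral>\<^sup>+x\<in>{h..1-h}. ennreal ((b x - b (x - h)) * node' x) \<partial>lborel"
  \<comment> \<open>Away from x = 1 the integrand is bounded, so \<open>?I\<close> is finite;
    without this it could not be cancelled in \<open>ennreal\<close> below.\<close>
  have "?I \<le> (\<integral>\<^sup>+x\<in>{0..1-2*h}. ennreal (b (1 - 2*h) * node' 0) \<partial>lborel)"
    using h node'_nonneg b_nonneg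
    by (intro nn_integral_mono) (auto simp: indicator_def intro!: ennreal_leI mult_mono b_mono node'_antimono)
  also have "\<dots> < \<infinity>"
    using h by (subst nn_integral_cmult_indicator) (auto simp: ennreal_mult_less_top)
  finally have fin: "?I \<noteq> \<infinity>" by simp
  have "?I + ?D = (\<integral>\<^sup>+x. ennreal (b x * node' (x + h)) * indicator {0..1-2*h} x +
      ennreal (b x * (node' x - node' (x + h))) * indicator {0..1-2*h} x \<partial>lborel)"
    by (intro nn_integral_add[symmetric]) measurable
  also have "\<dots> = (\<integral>\<^sup>+x\<in>{0..1-2*h}. ennreal (b x * node' x) \<partial>lborel)"
  proof (rule nn_integral_cong)
    fix x
    have "ennreal (b x * node' (x + h)) + ennreal (b x * (node' x - node' (x + h))) = ennreal (b x * node' x)"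
      if "x \<in> {0..1-2*h}"
      using that h b_nonneg[of x] node'_nonneg[of "x + h"] node'_antimono[of x "x + h"]
        mult_left_mono[of "node' (x + h)" "node' x" "b x"]
      by (subst ennreal_plus[symmetric]) (auto simp: algebra_simps)
    then show "ennreal (b x * node' (x + h)) * indicator {0..1-2*h} x +
      ennreal (b x * (node' x - node' (x + h))) * indicator {0..1-2*h} x
      = ennreal (b x * node' x) * indicator {0..1-2*h} x"
      by (auto simp: indicator_def)
  qed
  \<comment> \<open>The interval [0, 1 - 2h] is covered by [0,h] and [h, 1 - h]. On the second one b
    x is split into its increment and b (x - h), and after a shift the latter part becomes
    \<open>?I\<close> again.\<close>
  also have "\<dots> \<le> (\<integral>\<^sup>+x. ennreal (b x * node' x) * indicator {0..h} x +
     (ennreal ((b x - b (x - h)) * node' x) * indicator {h..1-h} x +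
      ennreal (b (x - h) * node' x) * indicator {h..1-h} x) \<partial>lborel)"
  proof (rule nn_integral_mono)
    fix x
    have "ennreal ((b x - b (x - h)) * node' x) + ennreal (b (x - h) * node' x) = ennreal (b x * node' x)"
      if "x \<in> {h..1-h}"
      using that h b_nonneg[of "x - h"] node'_nonneg[of x] b_mono[of "x - h" x]
        mult_left_mono[of "b (x - h)" "b x" "node' x"]
      by (subst ennreal_plus[symmetric]) (auto simp: algebra_simps)
    then show "ennreal (b x * node' x) * indicator {0..1-2*h} x \<le> ennreal (b x * node' x) * indicator {0..h} x +
     (ennreal ((b x - b (x - h)) * node' x) * indicator {h..1-h} x +
      ennreal (b (x - h) * node' x) * indicator {h..1-h} x)"
      using h by (auto simp: indicator_def)
  qed
  also have "\<dots> = ?P + (?G + (\<integral>\<^sup>+x\<in>{h..1-h}. ennreal (b (x - h) * node' x) \<partial>lborel))"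
    by (subst nn_integral_add, measurable, subst nn_integral_add, measurable)
  also have "(\<integral>\<^sup>+x\<in>{h..1-h}. ennreal (b (x - h) * node' x) \<partial>lborel)
     = (\<integral>\<^sup>+x. ennreal (b (h + 1 * x - h) * node' (h + 1 * x)) * indicator {h..1-h} (h + 1 * x) \<partial>lborel)"
    by (subst nn_integral_real_affine[where c = 1 and t = h]) auto
  also have "\<dots> = ?I"
    by (intro nn_integral_cong) (auto simp: indicator_def add.commute)
  finally have "?I + ?D \<le> ?I + (?P + ?G)" by (simp add: ac_simps)
  then have "?D \<le> ?P + ?G" using fin by (simp add: ennreal_add_left_cancel_le)
  also have "?P + ?G \<le> ennreal (h * (b h * node' 0)) + ?E"
  proof (rule add_mono)
    have "?P \<le> (\<integral>\<^sup>+x\<in>{0..h}. ennreal (b h * node' 0) \<partial>lborel)"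
      using h node'_nonneg b_nonneg
      by (intro nn_integral_mono) (auto simp: indicator_def intro!: ennreal_leI mult_mono b_mono node'_antimono)
    also have "\<dots> = ennreal (b h * node' 0) * ennreal h"
      using h by (subst nn_integral_cmult_indicator) auto
    also have "\<dots> = ennreal (h * (b h * node' 0))"
      using h b_nonneg[of h] node'_nonneg[of 0] by (simp add: ennreal_mult[symmetric] mult.commute)
    finally show "?P \<le> ennreal (h * (b h * node' 0))" .
    show "?G \<le> ?E" unfolding h_def by (rule net_errors_ge[OF n])
  qed
  finally show ?thesis by (simp add: add.commute)
qed

text \<open>Monotone convergence along the dyadic times. The assumptions on nets and on the
  fractional integral are both exploited on intervals [0,t] with t < T only, and this lemma closes
  the gap in either case.\<close>

lemma energy_truncated_bound:
  assumes bound: "\<And>t. t \<in> {0..<T} \<Longrightarrow> (\<integral>\<^sup>+u\<in>{0..t}. ennreal ((T - u) powr (-\<theta>) * a u) \<partial>lborel) \<le> C"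
  shows "energy \<le> C"
proof -
  let ?t = "\<lambda>k. T * (1 - 2 powr (- real k))"
  have "energy = (\<integral>\<^sup>+u. (SUP k. ennreal ((T - u) powr (-\<theta>) * a u) * indicator {0..?t k} u) \<partial>lborel)"
    unfolding energy_def
  proof (rule nn_integral_cong)
    fix u
    show "ennreal ((T - u) powr (-\<theta>) * a u) * indicator {0..<T} u
      = (SUP k. ennreal ((T - u) powr (-\<theta>) * a u) * indicator {0..?t k} u)"
    proof (cases "u \<in> {0..<T}")
      case True
      then obtain k where k: "u \<in> {?t k..<?t (Suc k)}" using dyadic_covering[OF T_pos] by blast
      show ?thesis
      proof (rule antisym)
        show "ennreal ((T - u) powr (-\<theta>) * a u) * indicator {0..<T} u
          \<le> (SUP k. ennreal ((T - u) powr (-\<theta>) * a u) * indicator {0..?t k} u)"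
          using True k by (intro SUP_upper2[of "Suc k"]) (simp_all del: of_nat_Suc)
      qed (use True in \<open>auto simp: indicator_def intro!: SUP_least\<close>)
    next
      case False
      then have "u \<notin> {0..?t k}" for k using dyadic_in[of k] by auto
      then show ?thesis using False by simp
    qed
  qed
  also have "\<dots> = (SUP k. \<integral>\<^sup>+u\<in>{0..?t k}. ennreal ((T - u) powr (-\<theta>) * a u) \<partial>lborel)"
  proof (rule nn_integral_monotone_convergence_SUP)
    show "incseq (\<lambda>k u. ennreal ((T - u) powr (-\<theta>) * a u) * indicator {0..?t k} u)"
      using T_pos by (intro incseq_SucI le_funI) (auto simp: indicator_def intro: order_trans)
    fix k
    have "(\<lambda>u. ennreal ((T - u) powr (-\<theta>) * (indicator {0..<T} u * a u)) * indicator {0..?t k} u) \<in> borel_measurable lborel"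
      by measurable
    also have "(\<lambda>u. ennreal ((T - u) powr (-\<theta>) * (indicator {0..<T} u * a u)) * indicator {0..?t k} u)
       = (\<lambda>u. ennreal ((T - u) powr (-\<theta>) * a u) * indicator {0..?t k} u)"
      using dyadic_in[of k] by (intro ext) (simp add: indicator_def)
    finally show "(\<lambda>u. ennreal ((T - u) powr (-\<theta>) * a u) * indicator {0..?t k} u) \<in> borel_measurable lborel" .
  qed
  also have "\<dots> \<le> C" by (intro SUP_least bound dyadic_in)
  finally show ?thesis .
qed

end

section \<open>Passage to the limit in n and recovery of the energy\<close>

context growth_profile
begin

lemma node_quotient_LIMSEQ:
  assumes "0 \<le> x" "x < 1"
  shows "(\<lambda>n. real (2 * n) * (node' x - node' (x + 1 / real (2 * n))))
     \<longlonglongrightarrow> T / \<theta> * (1/\<theta> - 1) * (1 - x) powr (1/\<theta> - 2)"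
proof -
  have lim: "(\<lambda>n. 1 / real (2 * n)) \<longlonglongrightarrow> 0"
    by (rule tendsto_divide_0[OF tendsto_const], rule filterlim_at_top_imp_at_infinity,
        rule filterlim_compose[OF filterlim_real_sequentially]) (rule mult_nat_left_at_top, simp)
  then have "filterlim (\<lambda>n. 1 / real (2 * n)) (at 0) sequentially"
    unfolding filterlim_at by (auto intro!: eventually_sequentiallyI[of 1])
  from filterlim_compose[OF node'_deriv[OF assms(2), unfolded DERIV_def] this]
  have "(\<lambda>n. - ((node' (x + 1 / real (2 * n)) - node' x) / (1 / real (2 * n))))
     \<longlonglongrightarrow> - (- (T / \<theta> * (1/\<theta> - 1) * (1 - x) powr (1/\<theta> - 2)))"
    by (intro tendsto_minus)
  moreover have "(\<lambda>n. - ((node' (x + 1 / real (2 * n)) - node' x) / (1 / real (2 * n))))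
     = (\<lambda>n. real (2 * n) * (node' x - node' (x + 1 / real (2 * n))))"
    by (auto simp: algebra_simps)
  ultimately show ?thesis by (simp only: minus_minus)
qed

text \<open>Multiply \<open>node'_difference_bound\<close> by 1/h = 2n. The net norms are O(1/n), so
  the right-hand side stays bounded, while the difference quotients of \<open>node'\<close> converge
  pointwise to the negative second derivative of \<open>node\<close>, which is the weight in the
  statement. Fatou's lemma then applies.\<close>

lemma b_integral_bound:
  assumes c: "0 < c" and bound: "\<And>\<tau>. \<tau> \<in> time_nets T \<Longrightarrow> net_error \<tau> \<le> ennreal (c * net_norm T \<theta> \<tau>)"
  shows "(\<integral>\<^sup>+x\<in>{0..<1}. ennreal (b x * (T / \<theta> * (1/\<theta> - 1) * (1 - x) powr (1/\<theta> - 2))) \<partial>lborel) < \<infinity>"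
proof -
  \<comment> \<open>Each of the two nets contributes 2n c T^\<theta> / (\<theta> n). In the boundary
    term 2n h = 1, and h \<le> 1/2 bounds b h by b (1/2).\<close>
  define C where "C = 4 * c * (T powr \<theta> / \<theta>) + b (1/2) * node' 0"
  let ?f = "\<lambda>n x. ennreal (b x * (real (2 * n) * (node' x - node' (x + 1 / real (2 * n))))) * indicator {0..1-2*(1 / real (2 * n))} x"
  have f_le: "integral\<^sup>N lborel (?f n) \<le> ennreal C" if n: "2 \<le> n" for n
  proof -
    let ?m = "real (2 * n)"
    let ?h = "1 / (2 * real n)"
    have err: "net_error (power_net T (1/\<theta>) \<sigma> n) \<le> ennreal (c * (T powr \<theta> / \<theta> / real n))" if "\<sigma> \<le> 1" for \<sigma>
    proof -
      have net: "power_net T (1/\<theta>) \<sigma> n \<in> time_nets T"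
        using n T_pos \<theta> that by (intro power_net_in_time_nets) auto
      have "net_norm T \<theta> (power_net T (1/\<theta>) \<sigma> n) \<le> T powr \<theta> / \<theta> / real n"
        using n T_pos \<theta> that by (intro net_norm_power_net) auto
      then have "c * net_norm T \<theta> (power_net T (1/\<theta>) \<sigma> n) \<le> c * (T powr \<theta> / \<theta> / real n)"
        using c by (intro mult_left_mono) auto
      then show ?thesis using bound[OF net] by (elim order_trans) (rule ennreal_leI)
    qed
    have "integral\<^sup>N lborel (?f n) = (\<integral>\<^sup>+x. ennreal ?m * (ennreal (b x * (node' x - node' (x + ?h))) * indicator {0..1-2*?h} x) \<partial>lborel)"
    proof (rule nn_integral_cong)
      fix x
      show "?f n x = ennreal ?m * (ennreal (b x * (node' x - node' (x + ?h))) * indicator {0..1-2*?h} x)"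
      proof (cases "x \<in> {0..1-2*?h}")
        case True
        moreover have "0 < ?h" using n by simp
        ultimately have "0 \<le> b x * (node' x - node' (x + ?h))"
          using node'_antimono[of x "x + ?h"] b_nonneg[of x] unfolding atLeastAtMost_iff
          by (intro mult_nonneg_nonneg) linarith+
        then show ?thesis using True by (simp add: ennreal_mult[symmetric] ac_simps)
      qed simp
    qed
    also have "\<dots> = ennreal ?m * (\<integral>\<^sup>+x\<in>{0..1-2*?h}. ennreal (b x * (node' x - node' (x + ?h))) \<partial>lborel)"
      by (rule nn_integral_cmult) measurable
    also have "\<dots> \<le> ennreal ?m * (net_error (power_net T (1/\<theta>) 0 n) + net_error (power_net T (1/\<theta>) 1 n) + ennreal (?h * (b ?h * node' 0)))"
      by (intro mult_left_mono node'_difference_bound n) simp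
    also have "\<dots> \<le> ennreal ?m * (ennreal (c * (T powr \<theta> / \<theta> / real n)) + ennreal (c * (T powr \<theta> / \<theta> / real n)) + ennreal (?h * (b (1/2) * node' 0)))"
    proof -
      have "?h \<le> 1 / 2" using n by (simp add: field_simps)
      then have "b ?h \<le> b (1/2)" by (intro b_mono) auto
      then have le: "?h * (b ?h * node' 0) \<le> ?h * (b (1/2) * node' 0)"
        using node'_nonneg[of 0] by (intro mult_left_mono mult_right_mono) auto
      show ?thesis by (rule mult_left_mono[OF add_mono[OF add_mono[OF err err] ennreal_leI[OF le]]]) auto
    qed
    also have "\<dots> = ennreal (?m * (c * (T powr \<theta> / \<theta> / real n) + c * (T powr \<theta> / \<theta> / real n) + ?h * (b (1/2) * node' 0)))"
      using c \<theta> node'_nonneg[of 0] b_nonneg[of "1/2"]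
      by (subst ennreal_mult) (auto simp: ennreal_plus[symmetric] simp del: ennreal_plus)
    also have "?m * (c * (T powr \<theta> / \<theta> / real n) + c * (T powr \<theta> / \<theta> / real n) + ?h * (b (1/2) * node' 0)) = C"
      using n by (simp add: C_def algebra_simps)
    finally show ?thesis .
  qed
  have "(\<integral>\<^sup>+x\<in>{0..<1}. ennreal (b x * (T / \<theta> * (1/\<theta> - 1) * (1 - x) powr (1/\<theta> - 2))) \<partial>lborel)
     = (\<integral>\<^sup>+x. liminf (\<lambda>n. ?f n x) \<partial>lborel)"
  proof (rule nn_integral_cong)
    fix x
    show "ennreal (b x * (T / \<theta> * (1/\<theta> - 1) * (1 - x) powr (1/\<theta> - 2))) * indicator {0..<1} x
      = liminf (\<lambda>n. ?f n x)"
    proof (cases "x \<in> {0..<1}")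
      case True
      \<comment> \<open>Since 2h = 1/n, this says that x finally lies in the truncated interval
        [0, 1 - 2h].\<close>
      have "eventually (\<lambda>n. 1 / real n < 1 - x) sequentially"
        using True order_tendstoD(2)[OF lim_1_over_n, of "1 - x"] by simp
      then have ev: "eventually (\<lambda>n. ennreal (b x * (real (2 * n) * (node' x - node' (x + 1 / real (2 * n))))) = ?f n x) sequentially"
        by eventually_elim (use True in \<open>auto simp: indicator_def\<close>)
      have "(\<lambda>n. ennreal (b x * (real (2 * n) * (node' x - node' (x + 1 / real (2 * n))))))
        \<longlonglongrightarrow> ennreal (b x * (T / \<theta> * (1/\<theta> - 1) * (1 - x) powr (1/\<theta> - 2)))"
        using True by (intro tendsto_ennrealI tendsto_mult tendsto_const node_quotient_LIMSEQ) auto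
      then have "(\<lambda>n. ?f n x) \<longlonglongrightarrow> ennreal (b x * (T / \<theta> * (1/\<theta> - 1) * (1 - x) powr (1/\<theta> - 2)))"
        using ev by (rule Lim_transform_eventually)
      then have "liminf (\<lambda>n. ?f n x) = ennreal (b x * (T / \<theta> * (1/\<theta> - 1) * (1 - x) powr (1/\<theta> - 2)))"
        by (intro lim_imp_Liminf) auto
      then show ?thesis using True by simp
    next
      case False
      then have "b x = 0" by (simp add: b_def)
      then show ?thesis using False by (simp add: Liminf_const)
    qed
  qed
  also have "\<dots> \<le> liminf (\<lambda>n. integral\<^sup>N lborel (?f n))"
    by (rule nn_integral_liminf) measurable
  also have "\<dots> \<le> liminf (\<lambda>n. ennreal C)"
    using f_le by (intro Liminf_mono eventually_sequentiallyI[of 2]) auto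
  also have "\<dots> < \<infinity>" by (simp add: Liminf_const)
  finally show ?thesis .
qed

text \<open>Substituting u = node x, the energy weight (T - u)^(-\<theta>) u'(x) is proportional to
  (1 - x)^(1/\<theta> - 2), hence to the weight of \<open>b_integral_bound\<close>;
  \<open>?K\<close> is the ratio of the two.\<close>

lemma energy_finite_if_net_error_bound:
  assumes c: "0 < c" and bound: "\<And>\<tau>. \<tau> \<in> time_nets T \<Longrightarrow> net_error \<tau> \<le> ennreal (c * net_norm T \<theta> \<tau>)"
  shows "energy < \<infinity>"
proof -
  let ?B = "\<integral>\<^sup>+x\<in>{0..<1}. ennreal (b x * (T / \<theta> * (1/\<theta> - 1) * (1 - x) powr (1/\<theta> - 2))) \<partial>lborel"
  let ?K = "T powr (-\<theta>) / (1/\<theta> - 1)"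
  have q: "0 < 1/\<theta> - 1" using \<theta> by simp
  have "energy \<le> ennreal ?K * ?B"
  proof (rule energy_truncated_bound)
    fix t assume t: "t \<in> {0..<T}"
    \<comment> \<open>The parameter of t, that is, the solution of
      \<open>node r = t\<close>.\<close>
    define r where "r = 1 - ((T - t) / T) powr \<theta>"
    have r: "0 \<le> r" "r < 1" using t \<theta> by (auto simp: r_def powr_le1)
    have rt: "node r = t"
      using t \<theta> T_pos by (simp add: node_def power_node_def r_def powr_powr field_simps)
    define f where "f u = (T - u) powr (-\<theta>) * (indicator {0..<T} u * a u)" for u
    have [measurable]: "f \<in> borel_measurable borel" unfolding f_def[abs_def] by measurable
    have "(\<integral>\<^sup>+u\<in>{0..t}. ennreal ((T - u) powr (-\<theta>) * a u) \<partial>lborel)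
        = (\<integral>\<^sup>+u. ennreal (f u * indicator {node 0..node r} u) \<partial>lborel)"
      unfolding rt using t by (intro nn_integral_cong) (auto simp: f_def indicator_def node_0)
    also have "\<dots> = (\<integral>\<^sup>+x. ennreal (f (node x) * node' x * indicator {0..r} x) \<partial>lborel)"
    proof (rule nn_integral_substitution)
      show "set_borel_measurable borel {node 0..node r} f"
        unfolding set_borel_measurable_def by measurable
      show "continuous_on {0..r} node'"
        using r by (intro DERIV_continuous_on[OF DERIV_subset[OF node'_deriv]]) auto
    qed (use r node_deriv node'_nonneg in auto)
    also have "\<dots> \<le> (\<integral>\<^sup>+x. ennreal ?K * (ennreal (b x * (T / \<theta> * (1/\<theta> - 1) * (1 - x) powr (1/\<theta> - 2))) * indicator {0..<1} x) \<partial>lborel)"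
    proof (rule nn_integral_mono)
      fix x
      show "ennreal (f (node x) * node' x * indicator {0..r} x)
        \<le> ennreal ?K * (ennreal (b x * (T / \<theta> * (1/\<theta> - 1) * (1 - x) powr (1/\<theta> - 2))) * indicator {0..<1} x)"
      proof (cases "x \<in> {0..r}")
        case True
        then have x: "0 \<le> x" "x < 1" using r by auto
        have "T - node x = T * (1 - x) powr (1/\<theta>)"
          by (simp add: node_def power_node_def algebra_simps)
        then have 1: "(T - node x) powr (-\<theta>) = T powr (-\<theta>) * (1 - x) powr (-1)"
          using T_pos x \<theta> by (simp add: powr_mult powr_powr)
        have 2: "(1 - x) powr (-1) * (1 - x) powr (1/\<theta> - 1) = (1 - x) powr (1/\<theta> - 2)"
          unfolding powr_add[symmetric] by (simp add: algebra_simps)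
        have 3: "(T - node x) powr (-\<theta>) * node' x = T / \<theta> * T powr (-\<theta>) * (1 - x) powr (1/\<theta> - 2)"
          unfolding 1 node'_def 2[symmetric] by (simp only: ac_simps)
        have "f (node x) * node' x = b x * ((T - node x) powr (-\<theta>) * node' x)"
          using node_in[OF x] x by (simp add: f_def b_eq)
        also have "\<dots> = b x * (T / \<theta> * T powr (-\<theta>) * (1 - x) powr (1/\<theta> - 2))"
          unfolding 3 ..
        also have "\<dots> = ?K * (b x * (T / \<theta> * (1/\<theta> - 1) * (1 - x) powr (1/\<theta> - 2)))"
        proof -
          have "?K * (1/\<theta> - 1) = T powr (-\<theta>)" using q \<theta> by simp
          moreover have "?K * (b x * (T / \<theta> * (1/\<theta> - 1) * y)) = b x * (T / \<theta> * (?K * (1/\<theta> - 1)) * y)" for y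
            by (simp only: ac_simps)
          ultimately show ?thesis by (simp only:)
        qed
        finally show ?thesis
          using True x q T_pos \<theta> b_nonneg[of x] by (simp add: ennreal_mult[symmetric])
      qed simp
    qed
    also have "\<dots> = ennreal ?K * ?B" by (rule nn_integral_cmult) measurable
    finally show "(\<integral>\<^sup>+u\<in>{0..t}. ennreal ((T - u) powr (-\<theta>) * a u) \<partial>lborel) \<le> ennreal ?K * ?B" .
  qed
  also have "\<dots> < \<infinity>" using b_integral_bound[OF c bound] by (simp add: ennreal_mult_less_top)
  finally show ?thesis .
qed

lemma energy_finite_iff_net_error_bound:
  "energy < \<infinity> \<longleftrightarrow> (\<exists>c::real. 0 < c \<and> (\<forall>\<tau>\<in>time_nets T. net_error \<tau> \<le> ennreal (c * net_norm T \<theta> \<tau>)))"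
proof
  assume fin: "energy < \<infinity>"
  \<comment> \<open>The summand 1 makes \<open>c\<close> strictly positive even if the energy
    vanishes.\<close>
  define c where "c = (1 - \<theta>) * enn2real energy + 1"
  have c: "0 < c" using \<theta> by (auto simp: c_def intro!: add_nonneg_pos)
  have "net_error \<tau> \<le> ennreal (c * net_norm T \<theta> \<tau>)" if \<tau>: "\<tau> \<in> time_nets T" for \<tau>
  proof -
    have h: "0 \<le> net_norm T \<theta> \<tau>" by (rule net_norm_nonneg[OF \<tau> T_pos])
    have "net_error \<tau> \<le> ennreal ((1 - \<theta>) * net_norm T \<theta> \<tau>) * ennreal (enn2real energy)"
      using net_error_le[OF \<tau>] fin by simp
    also have "\<dots> = ennreal ((1 - \<theta>) * net_norm T \<theta> \<tau> * enn2real energy)"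
      using h \<theta> by (subst ennreal_mult) auto
    also have "\<dots> \<le> ennreal (c * net_norm T \<theta> \<tau>)"
      using h by (intro ennreal_leI) (simp add: c_def algebra_simps)
    finally show ?thesis .
  qed
  then show "\<exists>c::real. 0 < c \<and> (\<forall>\<tau>\<in>time_nets T. net_error \<tau> \<le> ennreal (c * net_norm T \<theta> \<tau>))"
    using c by blast
qed (use energy_finite_if_net_error_bound in blast)

end


section \<open>Real interpolation\<close>

lemma nn_integral_powr_atLeast:
  fixes r s :: real
  assumes "0 < r" "0 < s"
  shows "(\<integral>\<^sup>+v\<in>{r..}. ennreal (v powr (- s - 1)) \<partial>lborel) = ennreal (r powr (- s) / s)"
proof -
  have "(\<integral>\<^sup>+v\<in>{r..}. ennreal (v powr (- s - 1)) \<partial>lborel) = ennreal (0 - (- (r powr (- s) / s)))"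
  proof (rule nn_integral_FTC_atLeast)
    fix v assume "r \<le> v"
    then have "((\<lambda>v. v powr (- s)) has_real_derivative (- s * v powr (- s - 1))) (at v)"
      using assms by (intro has_real_derivative_powr) auto
    then show "((\<lambda>v. - (v powr (- s) / s)) has_real_derivative v powr (- s - 1)) (at v)"
      using assms \<open>r \<le> v\<close> by (auto intro!: derivative_eq_intros)
    show "0 \<le> v powr (- s - 1)" by simp
  next
    have "((\<lambda>v. v powr (- s)) \<longlongrightarrow> 0) at_top"
      using assms by (intro tendsto_neg_powr filterlim_ident) auto
    then show "((\<lambda>v. - (v powr (- s) / s)) \<longlongrightarrow> 0) at_top"
      using tendsto_minus[OF tendsto_divide[OF _ tendsto_const]] assms by fastforce
  qed simp
  then show ?thesis by simp
qed

lemma L2_norm_nonneg: "0 \<le> L2_norm M f"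
  by (simp add: L2_norm_def)

lemma L2_norm_power2: "(L2_norm M f)\<^sup>2 = (\<integral>\<omega>. (f \<omega>)\<^sup>2 \<partial>M)"
  by (simp add: L2_norm_def)

lemma L2_norm_0: "L2_norm M (\<lambda>_. 0) = 0"
  by (simp add: L2_norm_def)

text \<open>Up to the factor 2 this is the triangle inequality, squared.\<close>

lemma L2_norm_add_power2_le:
  assumes "f \<in> L2_space M" "g \<in> L2_space M" "h \<in> borel_measurable M" "AE \<omega> in M. h \<omega> = f \<omega> + g \<omega>"
  shows "(L2_norm M h)\<^sup>2 \<le> 2 * ((L2_norm M f)\<^sup>2 + (L2_norm M g)\<^sup>2)"
proof -
  have [measurable]: "f \<in> borel_measurable M" "g \<in> borel_measurable M" "h \<in> borel_measurable M"
    and int: "integrable M (\<lambda>\<omega>. (f \<omega>)\<^sup>2)" "integrable M (\<lambda>\<omega>. (g \<omega>)\<^sup>2)"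
    using assms by (auto simp: L2_space_def)
  have "AE \<omega> in M. (h \<omega>)\<^sup>2 \<le> 2 * (f \<omega>)\<^sup>2 + 2 * (g \<omega>)\<^sup>2"
    using assms(4)
  proof eventually_elim
    case (elim \<omega>)
    have "0 \<le> (f \<omega> - g \<omega>)\<^sup>2" by simp
    then show ?case unfolding elim by (simp add: power2_eq_square algebra_simps)
  qed
  then have "(\<integral>\<omega>. (h \<omega>)\<^sup>2 \<partial>M) \<le> (\<integral>\<omega>. 2 * (f \<omega>)\<^sup>2 + 2 * (g \<omega>)\<^sup>2 \<partial>M)"
    using int by (intro integral_mono_AE') auto
  also have "\<dots> = 2 * ((\<integral>\<omega>. (f \<omega>)\<^sup>2 \<partial>M) + (\<integral>\<omega>. (g \<omega>)\<^sup>2 \<partial>M))"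
    using int by simp
  finally show ?thesis by (simp add: L2_norm_power2)
qed

lemma ennreal_mult_finiteD: "0 < c \<Longrightarrow> ennreal c * S < \<infinity> \<Longrightarrow> S < \<infinity>"
  by (auto simp: ennreal_mult_less_top)

lemma bounded_abs_bdd_above:
  fixes c :: "nat \<Rightarrow> real"
  shows "bounded (range c) \<Longrightarrow> bdd_above (range (\<lambda>k. \<bar>c k\<bar>))"
  by (auto simp: bounded_iff bdd_above_def)

lemma lq_norm_nonneg:
  assumes "in_lq q c"
  shows "0 \<le> lq_norm q c"
proof (cases "q = \<infinity>")
  case True
  then have "bdd_above (range (\<lambda>k. \<bar>c k\<bar>))"
    using assms True bounded_abs_bdd_above by (simp add: in_lq_def)
  then have "\<bar>c 0\<bar> \<le> (SUP k. \<bar>c k\<bar>)" by (intro cSUP_upper) auto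
  then show ?thesis using True by (simp add: lq_norm_def)
qed (simp add: lq_norm_def)

lemma lq_norm_infinity_ge:
  assumes "in_lq \<infinity> c"
  shows "\<bar>c k\<bar> \<le> lq_norm \<infinity> c"
proof -
  have "bdd_above (range (\<lambda>k. \<bar>c k\<bar>))"
    using assms bounded_abs_bdd_above by (simp add: in_lq_def)
  then have "\<bar>c k\<bar> \<le> (SUP k. \<bar>c k\<bar>)" by (intro cSUP_upper) auto
  then show ?thesis by (simp add: lq_norm_def)
qed

lemma enn2real_2: "enn2real 2 = 2"
  by (rule enn2real_numeral)

lemma in_l2_iff: "in_lq 2 c \<longleftrightarrow> summable (\<lambda>k. (c k)\<^sup>2)"
  by (simp add: in_lq_def enn2real_2)

lemma l2_norm_power2:
  assumes "in_lq 2 c"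
  shows "(lq_norm 2 c)\<^sup>2 = (\<Sum>k. (c k)\<^sup>2)"
proof -
  have "0 \<le> (\<Sum>k. (c k)\<^sup>2)" using assms unfolding in_l2_iff by (intro suminf_nonneg) auto
  then show ?thesis by (simp add: lq_norm_def enn2real_2 powr_half_sqrt)
qed

lemma weight_power2: "(2 powr (real k * (-1/2)) * y)\<^sup>2 = 2 powr (- real k) * y\<^sup>2"
  by (simp add: power_mult_distrib powr_power)

lemma weighted_l2_iff:
  "x \<in> fst (weighted_lq M 2 (-1/2)) \<longleftrightarrow>
    (\<forall>k. x k \<in> L2_space M) \<and> summable (\<lambda>k. 2 powr (- real k) * (L2_norm M (x k))\<^sup>2)"
  unfolding weighted_lq_def fst_conv mem_Collect_eq in_l2_iff weight_power2 ..

lemma weighted_l2_norm_power2: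
  assumes "x \<in> fst (weighted_lq M 2 (-1/2))"
  shows "(snd (weighted_lq M 2 (-1/2)) x)\<^sup>2 = (\<Sum>k. 2 powr (- real k) * (L2_norm M (x k))\<^sup>2)"
  using assms unfolding weighted_lq_def fst_conv snd_conv mem_Collect_eq
  by (simp only: l2_norm_power2 weight_power2)

lemma weighted_norm_nonneg:
  assumes "x \<in> fst (weighted_lq M q s)"
  shows "0 \<le> snd (weighted_lq M q s) x"
  using assms by (simp add: weighted_lq_def lq_norm_nonneg)

lemma weighted_infinity_norm_ge:
  assumes "x \<in> fst (weighted_lq M \<infinity> 0)"
  shows "L2_norm M (x k) \<le> snd (weighted_lq M \<infinity> 0) x"
  using assms lq_norm_infinity_ge[of "\<lambda>k. L2_norm M (x k)" k] by (simp add: weighted_lq_def L2_norm_nonneg)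

lemma K_functional_le:
  fixes x0 x1 :: "nat \<Rightarrow> 'a \<Rightarrow> real"
  assumes "x0 \<in> fst (weighted_lq M q0 s0)" "x1 \<in> fst (weighted_lq M q1 s1)" "eq x (x0 + x1)" "0 \<le> v"
  shows "K_functional eq (weighted_lq M q0 s0) (weighted_lq M q1 s1) v x
    \<le> snd (weighted_lq M q0 s0) x0 + v * snd (weighted_lq M q1 s1) x1"
  unfolding K_functional_def
  by (rule cInf_lower)
     (use assms in \<open>auto intro!: bdd_belowI[of _ 0] add_nonneg_nonneg mult_nonneg_nonneg weighted_norm_nonneg\<close>)

text \<open>The infimum of an empty set of reals is unspecified; membership in
  \<open>sum_space\<close> guarantees that there is a decomposition.\<close>

lemma K_functional_ge:
  assumes "x \<in> sum_space eq E0 E1"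
    and "\<And>x0 x1. x0 \<in> fst E0 \<Longrightarrow> x1 \<in> fst E1 \<Longrightarrow> eq x (x0 + x1) \<Longrightarrow> B \<le> snd E0 x0 + v * snd E1 x1"
  shows "B \<le> K_functional eq E0 E1 v x"
  unfolding K_functional_def
  by (rule cInf_greatest) (use assms in \<open>auto simp: sum_space_def\<close>)

text \<open>Of a decomposition x = y + z only the coordinate k is used. For v \<ge> 2^(-k/2), the
  weighted norm of \<open>y k\<close> is at most the norm of y, and 2^(-k/2) times the norm of
  \<open>z k\<close> at most v times the norm of z, so K(v)^2 \<ge> D k / 2. Integrating this over a
  band of v adjacent to 2^(-k/2), a different band for each k, yields the k-th term of the dyadic
  energy.\<close>

lemma dyadic_energy_finite_if_interpolation:
  fixes x :: "nat \<Rightarrow> 'a \<Rightarrow> real"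
  assumes x: "\<And>k. x k \<in> L2_space M" and \<theta>: "0 < \<theta>" "\<theta> < 1"
    and interp: "x \<in> real_interpolation (seq_eq M) (weighted_lq M 2 (-1/2)) (weighted_lq M \<infinity> 0) \<theta> 2"
  shows "(\<Sum>k. ennreal (2 powr (- (1 - \<theta>) * real k) * (L2_norm M (x k))\<^sup>2)) < \<infinity>"
proof -
  let ?E0 = "weighted_lq M 2 (-1/2)" and ?E1 = "weighted_lq M \<infinity> 0"
  define K where "K v = K_functional (seq_eq M) ?E0 ?E1 v x" for v
  define D where "D k = 2 powr (- real k) * (L2_norm M (x k))\<^sup>2" for k
  define g where "g v = ennreal (\<bar>v powr (-\<theta>) * K v\<bar> powr enn2real 2 / v) * indicator {0<..} v" for v
  have sum: "x \<in> sum_space (seq_eq M) ?E0 ?E1" and fin: "(\<integral>\<^sup>+v. g v \<partial>lborel) < \<infinity>"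
    using interp by (auto simp: real_interpolation_def Lq_finite_def K_def g_def)
  have K_ge: "sqrt (D k / 2) \<le> K v" if v: "2 powr (- real k / 2) \<le> v" for k v
    unfolding K_def
  proof (rule K_functional_ge[OF sum])
    fix y z assume y: "y \<in> fst ?E0" and z: "z \<in> fst ?E1" and eq: "seq_eq M x (y + z)"
    have "y k \<in> L2_space M" "z k \<in> L2_space M" "x k \<in> borel_measurable M"
      using y z x[of k] by (auto simp: weighted_lq_def L2_space_def)
    moreover have "AE \<omega> in M. x k \<omega> = y k \<omega> + z k \<omega>" using eq by (simp add: seq_eq_def)
    ultimately have "(L2_norm M (x k))\<^sup>2 \<le> 2 * ((L2_norm M (y k))\<^sup>2 + (L2_norm M (z k))\<^sup>2)"
      by (rule L2_norm_add_power2_le)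
    then have "D k \<le> 2 powr (- real k) * (2 * ((L2_norm M (y k))\<^sup>2 + (L2_norm M (z k))\<^sup>2))"
      unfolding D_def by (intro mult_left_mono) auto
    then have "D k / 2 \<le> 2 powr (- real k) * (L2_norm M (y k))\<^sup>2 + 2 powr (- real k) * (L2_norm M (z k))\<^sup>2"
      by (simp add: algebra_simps)
    also have "2 powr (- real k) * (L2_norm M (y k))\<^sup>2 \<le> (snd ?E0 y)\<^sup>2"
      unfolding weighted_l2_norm_power2[OF y]
      using sum_le_suminf[of "\<lambda>k. 2 powr (- real k) * (L2_norm M (y k))\<^sup>2" "{k}"]
        y[unfolded weighted_l2_iff] by simp
    also have "2 powr (- real k) * (L2_norm M (z k))\<^sup>2 \<le> (v * snd ?E1 z)\<^sup>2"
    proof -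
      have "2 powr (- real k / 2) * L2_norm M (z k) \<le> v * snd ?E1 z"
        using v weighted_infinity_norm_ge[OF z, of k] L2_norm_nonneg
        by (intro mult_mono) (auto intro: order_trans[OF powr_ge_zero])
      then have "(2 powr (- real k / 2) * L2_norm M (z k))\<^sup>2 \<le> (v * snd ?E1 z)\<^sup>2"
        by (intro power_mono mult_nonneg_nonneg L2_norm_nonneg) auto
      then show ?thesis by (simp add: power_mult_distrib powr_power)
    qed
    also have "(snd ?E0 y)\<^sup>2 + (v * snd ?E1 z)\<^sup>2 \<le> (snd ?E0 y + v * snd ?E1 z)\<^sup>2"
    proof -
      have "0 \<le> v" using v by (rule order_trans[OF powr_ge_zero])
      then have "0 \<le> v * (snd ?E1 z * snd ?E0 y)"
        using weighted_norm_nonneg[OF y] weighted_norm_nonneg[OF z] by simp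
      then show ?thesis by (simp add: power2_sum)
    qed
    finally have "D k / 2 \<le> (snd ?E0 y + v * snd ?E1 z)\<^sup>2" by simp
    moreover have "0 \<le> snd ?E0 y + v * snd ?E1 z"
      using order_trans[OF powr_ge_zero v] weighted_norm_nonneg[OF y] weighted_norm_nonneg[OF z] by simp
    ultimately show "sqrt (D k / 2) \<le> snd ?E0 y + v * snd ?E1 z"
      by (metis real_sqrt_le_mono real_sqrt_abs abs_of_nonneg)
  qed
  let ?r = "\<lambda>k::nat. 2 powr (- real k / 2) :: real"
  \<comment> \<open>As \<open>?r k * sqrt 2\<close> is 2^(-(k-1)/2), consecutive bands touch without
    overlapping.\<close>
  let ?A = "\<lambda>k. {?r k..<?r k * sqrt 2}"
  let ?c = "\<lambda>k. (?r k * sqrt 2) powr (- 2 * \<theta> - 1) * (D k / 2)"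
  have step: "?r n * sqrt 2 \<le> ?r m" if "m < n" for m n
  proof -
    have "?r n * sqrt 2 = 2 powr (- real n / 2 + 1 / 2)" unfolding powr_add by (simp add: powr_half_sqrt)
    also have "\<dots> \<le> ?r m" using that by (intro powr_mono) auto
    finally show ?thesis .
  qed
  have "disjoint_family ?A"
    unfolding disjoint_family_on_def
  proof (intro ballI impI)
    fix m n :: nat assume "m \<noteq> n"
    then consider "m < n" | "n < m" by linarith
    then show "?A m \<inter> ?A n = {}" by cases (use step[of m n] step[of n m] in auto)
  qed
  \<comment> \<open>Only monotonicity of \<open>nn_integral\<close> is behind this rule, and it
    holds for arbitrary functions; so the question whether the K-functional is measurable in v does
    not arise.\<close>
  then have "(\<Sum>k. ennreal (?c k) * emeasure lborel (?A k)) \<le> (\<integral>\<^sup>+v. g v \<partial>lborel)"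
  proof (rule nn_integral_ge_suminf_disjoint)
    fix k v assume v: "v \<in> ?A k"
    then have v0: "0 < v" by (auto intro: less_le_trans[of 0 "?r k"])
    have D0: "0 \<le> D k" by (simp add: D_def)
    have "?c k \<le> v powr (- 2 * \<theta> - 1) * (K v)\<^sup>2"
    proof (rule mult_mono)
      show "(?r k * sqrt 2) powr (- 2 * \<theta> - 1) \<le> v powr (- 2 * \<theta> - 1)"
        using v v0 \<theta> by (intro powr_mono2') auto
      have "(sqrt (D k / 2))\<^sup>2 \<le> (K v)\<^sup>2"
        using K_ge[of k v] v D0 by (intro power_mono) auto
      then show "D k / 2 \<le> (K v)\<^sup>2" using D0 by simp
    qed (use D0 in auto)
    also have "\<dots> = \<bar>v powr (-\<theta>) * K v\<bar> powr enn2real 2 / v"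
      using v0 by (simp add: enn2real_2 power_mult_distrib powr_power powr_diff mult.commute)
    finally show "ennreal (?c k) \<le> g v" using v0 by (simp add: g_def ennreal_leI)
  qed simp
  also note fin
  finally have *: "(\<Sum>k. ennreal (?c k) * emeasure lborel (?A k)) < \<infinity>" .
  \<comment> \<open>The three factors come from the value of v^(-2\<theta>-1) at the right end of a
    band, from the relative length of the band, and from the 1/2 in the lower bound for
    K(v)^2.\<close>
  let ?C = "(sqrt 2) powr (- 2 * \<theta> - 1) * (sqrt 2 - 1) / 2"
  have C: "0 < ?C" by simp
  have "ennreal (?c k) * emeasure lborel (?A k) = ennreal ?C * ennreal (2 powr (- (1 - \<theta>) * real k) * (L2_norm M (x k))\<^sup>2)" for k
  proof -
    have 1: "emeasure lborel (?A k) = ennreal (?r k * (sqrt 2 - 1))"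
      by (simp add: algebra_simps)
    have 2: "?c k * (?r k * (sqrt 2 - 1)) = ?C * ((?r k powr (- 2 * \<theta> - 1) * ?r k * 2 powr (- real k)) * (L2_norm M (x k))\<^sup>2)"
      by (simp add: D_def powr_mult)
    have 3: "?r k powr (- 2 * \<theta> - 1) * ?r k * 2 powr (- real k) = 2 powr (- (1 - \<theta>) * real k)"
      unfolding powr_powr powr_add[symmetric] by (rule arg_cong[of _ _ "\<lambda>z. 2 powr z"]) (simp add: field_simps)
    have "ennreal (?c k) * ennreal (?r k * (sqrt 2 - 1)) = ennreal (?c k * (?r k * (sqrt 2 - 1)))"
      by (rule ennreal_mult[symmetric]) (auto simp: D_def)
    then have "ennreal (?c k) * emeasure lborel (?A k) = ennreal (?C * (2 powr (- (1 - \<theta>) * real k) * (L2_norm M (x k))\<^sup>2))"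
      unfolding 1 2 3 .
    then show ?thesis using C by (subst ennreal_mult[symmetric]) auto
  qed
  then have "ennreal ?C * (\<Sum>k. ennreal (2 powr (- (1 - \<theta>) * real k) * (L2_norm M (x k))\<^sup>2)) < \<infinity>"
    using * by (simp only: ennreal_suminf_cmult)
  then show ?thesis by (rule ennreal_mult_finiteD[OF C])
qed


text \<open>If v is about 2^(-m/2), put the coordinates up to m into the second space and the rest
  into the first. Since the norms increase, the bounded part has norm at most that of
  \<open>x m\<close>, at a squared cost of at most D m; the rest costs the sum of D k over k > m.
  Together they form a tail of a convergent series.\<close>

lemma interpolation_if_dyadic_energy_finite:
  fixes x :: "nat \<Rightarrow> 'a \<Rightarrow> real"
  assumes x: "\<And>k. x k \<in> L2_space M" and \<theta>: "0 < \<theta>" "\<theta> < 1"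
    and mono: "\<And>k m. k \<le> m \<Longrightarrow> L2_norm M (x k) \<le> L2_norm M (x m)"
    and fin: "(\<Sum>k. ennreal (2 powr (- (1 - \<theta>) * real k) * (L2_norm M (x k))\<^sup>2)) < \<infinity>"
  shows "x \<in> real_interpolation (seq_eq M) (weighted_lq M 2 (-1/2)) (weighted_lq M \<infinity> 0) \<theta> 2"
proof -
  let ?E0 = "weighted_lq M 2 (-1/2)" and ?E1 = "weighted_lq M \<infinity> 0"
  define K where "K v = K_functional (seq_eq M) ?E0 ?E1 v x" for v
  define D where "D k = 2 powr (- real k) * (L2_norm M (x k))\<^sup>2" for k
  have D0: "0 \<le> D k" for k by (simp add: D_def)
  have "summable (\<lambda>k. 2 powr (- (1 - \<theta>) * real k) * (L2_norm M (x k))\<^sup>2)"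
    using fin by (intro summable_suminf_not_top) auto
  moreover have "norm (D k) \<le> 2 powr (- (1 - \<theta>) * real k) * (L2_norm M (x k))\<^sup>2" for k
  proof -
    have "- real k \<le> - (1 - \<theta>) * real k" using \<theta> by (simp add: algebra_simps)
    then have "D k \<le> 2 powr (- (1 - \<theta>) * real k) * (L2_norm M (x k))\<^sup>2"
      unfolding D_def by (intro mult_right_mono powr_mono) auto
    then show ?thesis using D0[of k] by simp
  qed
  ultimately have D: "summable D" by (rule summable_comparison_test'[where N = 0])
  have zero: "(\<lambda>_ _. 0) \<in> fst ?E1"
    by (auto simp: weighted_lq_def L2_space_def L2_norm_0 in_lq_def)
  have xE0: "x \<in> fst ?E0" unfolding weighted_l2_iff using D x by (simp add: D_def[abs_def])
  have eq0: "seq_eq M x (x + (\<lambda>_ _. 0))" by (simp add: seq_eq_def)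
  have sum: "x \<in> sum_space (seq_eq M) ?E0 ?E1"
    unfolding sum_space_def using xE0 zero eq0 by blast
  have K0: "0 \<le> K v" if "0 < v" for v
    unfolding K_def using that
    by (intro K_functional_ge[OF sum] add_nonneg_nonneg mult_nonneg_nonneg weighted_norm_nonneg) auto
  \<comment> \<open>A bound by indicators of half-lines lets the v-integral be evaluated term by
    term, without splitting (0,\<infinity>) into bands. The index is \<open>Suc k\<close> because
    for the cut at m the value v can be as small as 2^(-(m+1)/2).\<close>
  let ?r = "\<lambda>k::nat. 2 powr (- real (Suc k) / 2) :: real"
  have K_le: "ennreal ((K v)\<^sup>2) \<le> (\<Sum>k. ennreal (2 * D k) * indicator {?r k..} v)" if v: "0 < v" for v
  proof (cases "1 \<le> v")
    case True
    \<comment> \<open>For v \<ge> 1 all of x goes into the first space, and every indicator in the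
      sum equals 1.\<close>
    have "snd ?E1 (\<lambda>_ _. 0) = 0" by (simp add: weighted_lq_def L2_norm_0 lq_norm_def)
    then have "K v \<le> snd ?E0 x"
      unfolding K_def using K_functional_le[OF xE0 zero, of "seq_eq M" x v] eq0 v by simp
    then have "(K v)\<^sup>2 \<le> (snd ?E0 x)\<^sup>2" using K0[OF v] by (intro power_mono)
    also have "\<dots> = (\<Sum>k. D k)" unfolding weighted_l2_norm_power2[OF xE0] D_def ..
    finally have "ennreal ((K v)\<^sup>2) \<le> (\<Sum>k. ennreal (D k))"
      using D D0 by (subst suminf_ennreal2) (auto intro: ennreal_leI)
    also have "\<dots> \<le> (\<Sum>k. ennreal (2 * D k) * indicator {?r k..} v)"
    proof (intro suminf_le summableI)
      fix k
      have "?r k \<le> 2 powr 0" by (intro powr_mono) auto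
      then show "ennreal (D k) \<le> ennreal (2 * D k) * indicator {?r k..} v"
        using True D0[of k] by (auto intro!: ennreal_leI)
    qed
    finally show ?thesis .
  next
    case False
    \<comment> \<open>The largest integer strictly below -2 log 2 v; it is nonnegative because v <
      1.\<close>
    define m where "m = nat (\<lceil>- 2 * log 2 v\<rceil> - 1)"
    have "log 2 v < 0" using v False by simp
    then have m: "real m < - 2 * log 2 v" "- 2 * log 2 v \<le> real (Suc m)"
      unfolding m_def by linarith+
    have vm: "v \<le> 2 powr (- real m / 2)" "?r m \<le> v"
    proof -
      have p: "2 powr (log 2 v) = v" using v by simp
      have "2 powr (log 2 v) \<le> 2 powr (- real m / 2)" "?r m \<le> 2 powr (log 2 v)"
        by (rule powr_mono; use m in simp)+
      then show "v \<le> 2 powr (- real m / 2)" "?r m \<le> v" unfolding p .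
    qed
    define y where "y k = (if k \<le> m then (\<lambda>_. 0) else x k)" for k
    define z where "z k = (if k \<le> m then x k else (\<lambda>_. 0))" for k
    have zero_L2: "(\<lambda>_. 0) \<in> L2_space M" by (simp add: L2_space_def)
    have y_norm: "2 powr (- real k) * (L2_norm M (y k))\<^sup>2 = (if k \<le> m then 0 else D k)" for k
      by (simp add: y_def D_def L2_norm_0)
    have y_sum: "summable (\<lambda>k. if k \<le> m then 0 else D k)"
      by (rule summable_comparison_test_ev[OF _ D]) (use D0 in \<open>auto intro!: always_eventually\<close>)
    have yE0: "y \<in> fst ?E0"
      unfolding weighted_l2_iff y_norm using y_sum x zero_L2 by (auto simp: y_def)
    have z_le: "L2_norm M (z k) \<le> L2_norm M (x m)" for k
      using mono[of k m] by (simp add: z_def L2_norm_0 L2_norm_nonneg)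
    have zE1: "z \<in> fst ?E1"
      using x zero_L2 z_le
      by (auto simp: weighted_lq_def z_def in_lq_def bounded_iff L2_norm_nonneg L2_norm_0 intro!: exI[of _ "L2_norm M (x m)"] mono)
    have z_norm: "snd ?E1 z \<le> L2_norm M (x m)"
      using z_le by (auto simp: weighted_lq_def lq_norm_def L2_norm_nonneg intro!: cSUP_least)
    have "seq_eq M x (y + z)" by (simp add: seq_eq_def y_def z_def)
    then have "K v \<le> snd ?E0 y + v * snd ?E1 z"
      unfolding K_def using K_functional_le[OF yE0 zE1] v by simp
    also have "\<dots> \<le> snd ?E0 y + 2 powr (- real m / 2) * L2_norm M (x m)"
      using vm z_norm v weighted_norm_nonneg[OF zE1] by (intro add_left_mono mult_mono) auto
    finally have "(K v)\<^sup>2 \<le> (snd ?E0 y + 2 powr (- real m / 2) * L2_norm M (x m))\<^sup>2"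
      using K0[OF v] by (intro power_mono)
    also have "\<dots> \<le> 2 * ((snd ?E0 y)\<^sup>2 + (2 powr (- real m / 2) * L2_norm M (x m))\<^sup>2)"
      using sum_squares_ge_zero[of "snd ?E0 y - 2 powr (- real m / 2) * L2_norm M (x m)" 0]
      by (simp add: power2_eq_square algebra_simps)
    also have "(2 powr (- real m / 2) * L2_norm M (x m))\<^sup>2 = D m"
      by (simp add: D_def power_mult_distrib powr_power)
    also have "(snd ?E0 y)\<^sup>2 = (\<Sum>k. if k \<le> m then 0 else D k)"
      unfolding weighted_l2_norm_power2[OF yE0] y_norm ..
    also have "\<dots> + D m = (\<Sum>k. (if k \<le> m then 0 else D k) + (if k = m then D k else 0))"
      using y_sum sums_single[of m D] by (subst suminf_add[symmetric]) (auto simp: sums_iff)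
    also have "\<dots> = (\<Sum>k. if m \<le> k then D k else 0)"
      by (intro suminf_cong) auto
    finally have "(K v)\<^sup>2 \<le> 2 * (\<Sum>k. if m \<le> k then D k else 0)" .
    moreover have s: "summable (\<lambda>k. if m \<le> k then D k else 0)"
      by (rule summable_comparison_test_ev[OF _ D]) (use D0 in \<open>auto intro!: always_eventually\<close>)
    ultimately have "(K v)\<^sup>2 \<le> (\<Sum>k. 2 * (if m \<le> k then D k else 0))"
      by (simp add: suminf_mult)
    then have "ennreal ((K v)\<^sup>2) \<le> (\<Sum>k. ennreal (2 * (if m \<le> k then D k else 0)))"
      using s D0 by (subst suminf_ennreal2) (auto intro!: ennreal_leI summable_mult)
    also have "\<dots> \<le> (\<Sum>k. ennreal (2 * D k) * indicator {?r k..} v)"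
    proof (intro suminf_le summableI)
      fix k
      show "ennreal (2 * (if m \<le> k then D k else 0)) \<le> ennreal (2 * D k) * indicator {?r k..} v"
      proof (cases "m \<le> k")
        case True
        then have "?r k \<le> ?r m" by (intro powr_mono) auto
        then have "?r k \<le> v" using vm(2) by (rule order_trans)
        then show ?thesis using True by (simp del: of_nat_Suc)
      qed simp
    qed
    finally show ?thesis .
  qed
  have "(\<integral>\<^sup>+v\<in>{0<..}. ennreal (\<bar>v powr (-\<theta>) * K v\<bar> powr enn2real 2 / v) \<partial>lborel)
    \<le> (\<integral>\<^sup>+v. (\<Sum>k. ennreal (2 * D k) * (ennreal (v powr (- (2 * \<theta>) - 1)) * indicator {?r k..} v)) \<partial>lborel)"
  proof (rule nn_integral_mono)
    fix v :: real
    show "ennreal (\<bar>v powr (-\<theta>) * K v\<bar> powr enn2real 2 / v) * indicator {0<..} v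
      \<le> (\<Sum>k. ennreal (2 * D k) * (ennreal (v powr (- (2 * \<theta>) - 1)) * indicator {?r k..} v))"
    proof (cases "0 < v")
      case True
      have "\<bar>v powr (-\<theta>) * K v\<bar> powr enn2real 2 / v = v powr (- (2 * \<theta>) - 1) * (K v)\<^sup>2"
        using True by (simp add: enn2real_2 power_mult_distrib powr_power powr_diff mult.commute)
      then have "ennreal (\<bar>v powr (-\<theta>) * K v\<bar> powr enn2real 2 / v) = ennreal (v powr (- (2 * \<theta>) - 1)) * ennreal ((K v)\<^sup>2)"
        by (simp add: ennreal_mult)
      also have "\<dots> \<le> ennreal (v powr (- (2 * \<theta>) - 1)) * (\<Sum>k. ennreal (2 * D k) * indicator {?r k..} v)"
        by (intro mult_left_mono K_le True) simp
      also have "\<dots> = (\<Sum>k. ennreal (2 * D k) * (ennreal (v powr (- (2 * \<theta>) - 1)) * indicator {?r k..} v))"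
        unfolding ennreal_suminf_cmult[symmetric] by (simp only: ac_simps)
      finally show ?thesis using True by simp
    qed simp
  qed
  also have "\<dots> = (\<Sum>k. ennreal (2 * D k) * (\<integral>\<^sup>+v\<in>{?r k..}. ennreal (v powr (- (2 * \<theta>) - 1)) \<partial>lborel))"
    by (subst nn_integral_suminf, measurable, subst nn_integral_cmult, measurable)
  also have "\<dots> = (\<Sum>k. ennreal (2 powr \<theta> / \<theta>) * ennreal (2 powr (- (1 - \<theta>) * real k) * (L2_norm M (x k))\<^sup>2))"
  proof (intro suminf_cong)
    fix k
    have "(\<integral>\<^sup>+v\<in>{?r k..}. ennreal (v powr (- (2 * \<theta>) - 1)) \<partial>lborel) = ennreal (?r k powr (- (2 * \<theta>)) / (2 * \<theta>))"
      using \<theta> by (intro nn_integral_powr_atLeast) auto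
    also have "?r k powr (- (2 * \<theta>)) = 2 powr \<theta> * 2 powr (\<theta> * real k)"
      unfolding powr_powr powr_add[symmetric] by (rule arg_cong[of _ _ "\<lambda>z. 2 powr z"]) (simp add: field_simps)
    finally have i: "(\<integral>\<^sup>+v\<in>{?r k..}. ennreal (v powr (- (2 * \<theta>) - 1)) \<partial>lborel)
       = ennreal (2 powr \<theta> * 2 powr (\<theta> * real k) / (2 * \<theta>))" .
    have "(2::real) powr (- (1 - \<theta>) * real k) = 2 powr (- real k) * 2 powr (\<theta> * real k)"
      unfolding powr_add[symmetric] by (simp add: algebra_simps)
    then have "2 * D k * (2 powr \<theta> * 2 powr (\<theta> * real k) / (2 * \<theta>))
       = 2 powr \<theta> / \<theta> * (2 powr (- (1 - \<theta>) * real k) * (L2_norm M (x k))\<^sup>2)"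
      by (simp add: D_def)
    then show "ennreal (2 * D k) * (\<integral>\<^sup>+v\<in>{?r k..}. ennreal (v powr (- (2 * \<theta>) - 1)) \<partial>lborel)
       = ennreal (2 powr \<theta> / \<theta>) * ennreal (2 powr (- (1 - \<theta>) * real k) * (L2_norm M (x k))\<^sup>2)"
      unfolding i using D0[of k] \<theta> by (subst (1 2) ennreal_mult[symmetric]) auto
  qed
  also have "\<dots> < \<infinity>" using fin by (simp add: ennreal_mult_less_top)
  finally show ?thesis
    using sum by (simp add: real_interpolation_def Lq_finite_def K_def)
qed


section \<open>Martingales in \<open>L\<^sub>2\<close>\<close>

lemma (in prob_space) L2_mult_integrable:
  assumes "f \<in> L2_space M" "g \<in> L2_space M"
  shows "integrable M (\<lambda>\<omega>. f \<omega> * g \<omega>)"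
proof (rule Bochner_Integration.integrable_bound)
  show "integrable M (\<lambda>\<omega>. (f \<omega>)\<^sup>2 + (g \<omega>)\<^sup>2)"
    using assms by (auto simp: L2_space_def)
  show "(\<lambda>\<omega>. f \<omega> * g \<omega>) \<in> borel_measurable M"
    using assms by (auto simp: L2_space_def)
  show "AE \<omega> in M. norm (f \<omega> * g \<omega>) \<le> norm ((f \<omega>)\<^sup>2 + (g \<omega>)\<^sup>2)"
  proof (rule AE_I2)
    fix \<omega>
    have "0 \<le> (\<bar>f \<omega>\<bar> - \<bar>g \<omega>\<bar>)\<^sup>2" by simp
    then have "2 * (\<bar>f \<omega>\<bar> * \<bar>g \<omega>\<bar>) \<le> (f \<omega>)\<^sup>2 + (g \<omega>)\<^sup>2" by (simp add: power2_diff)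
    moreover have "0 \<le> \<bar>f \<omega>\<bar> * \<bar>g \<omega>\<bar>" by simp
    ultimately have "\<bar>f \<omega>\<bar> * \<bar>g \<omega>\<bar> \<le> (f \<omega>)\<^sup>2 + (g \<omega>)\<^sup>2" by linarith
    then show "norm (f \<omega> * g \<omega>) \<le> norm ((f \<omega>)\<^sup>2 + (g \<omega>)\<^sup>2)" by (simp add: abs_mult)
  qed
qed

lemma L2_spaceD:
  assumes "f \<in> L2_space M"
  shows "f \<in> borel_measurable M" "integrable M (\<lambda>\<omega>. (f \<omega>)\<^sup>2)"
  using assms by (auto simp: L2_space_def)

lemma (in prob_space) indicator_L2:
  assumes "A \<in> sets M"
  shows "indicat_real A \<in> L2_space M"
proof -
  have "(\<lambda>\<omega>. (indicat_real A \<omega>)\<^sup>2) = indicat_real A" by (auto simp: indicator_def)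
  then show ?thesis using assms by (simp add: L2_space_def emeasure_eq_measure)
qed

lemma (in prob_space) L2_integrable: "f \<in> L2_space M \<Longrightarrow> integrable M f"
  using L2_mult_integrable[of f "\<lambda>_. 1"] by (simp add: L2_space_def)

lemma (in prob_space) L2_diff:
  assumes "f \<in> L2_space M" "g \<in> L2_space M"
  shows "(\<lambda>\<omega>. f \<omega> - g \<omega>) \<in> L2_space M"
  using assms L2_mult_integrable[OF assms] unfolding L2_space_def by (auto simp: power2_diff mult.assoc)

lemma (in prob_space) L2_diff_power2:
  assumes "f \<in> L2_space M" "g \<in> L2_space M"
  shows "(\<integral>\<omega>. (f \<omega> - g \<omega>)\<^sup>2 \<partial>M) = (\<integral>\<omega>. (f \<omega>)\<^sup>2 \<partial>M) + (\<integral>\<omega>. (g \<omega>)\<^sup>2 \<partial>M) - 2 * (\<integral>\<omega>. f \<omega> * g \<omega> \<partial>M)"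
  using L2_spaceD[OF assms(1)] L2_spaceD[OF assms(2)] L2_mult_integrable[OF assms]
  by (simp add: power2_diff mult.assoc)

lemma (in prob_space) integral_power2_le:
  fixes f :: "'a \<Rightarrow> real"
  assumes "integrable M f" "integrable M (\<lambda>\<omega>. (f \<omega>)\<^sup>2)"
  shows "(\<integral>\<omega>. f \<omega> \<partial>M)\<^sup>2 \<le> (\<integral>\<omega>. (f \<omega>)\<^sup>2 \<partial>M)"
  using variance_positive[of f] variance_eq[OF assms] by simp

lemma (in prob_space) L1_le_L2:
  assumes "f \<in> L2_space M"
  shows "(\<integral>\<omega>. \<bar>f \<omega>\<bar> \<partial>M)\<^sup>2 \<le> (\<integral>\<omega>. (f \<omega>)\<^sup>2 \<partial>M)"
  using integral_power2_le[of "\<lambda>\<omega>. \<bar>f \<omega>\<bar>"] L2_integrable[OF assms] L2_spaceD[OF assms] by simp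

context filtered_prob_space
begin

lemma space_F: "t \<in> {0..T} \<Longrightarrow> space (F t) = space M"
  using subalgebra_F by (auto simp: subalgebra_def)

lemma subalgebra_F_mono:
  assumes "0 \<le> s" "s \<le> t" "t \<le> T"
  shows "subalgebra (F t) (F s)"
  using F_mono[OF assms] space_F[of s] space_F[of t] assms by (auto simp: subalgebra_def)

lemma sigma_finite_subalgebra_F: "t \<in> {0..T} \<Longrightarrow> sigma_finite_subalgebra M (F t)"
  by (intro finite_measure_subalgebra_is_sigma_finite finite_measure_subalgebra.intro
      finite_measure_subalgebra_axioms.intro subalgebra_F) unfold_locales

end

text \<open>Interpreted for \<open>L\<close> and, under the name \<open>frac\<close>, for its
  fractional integral. Path regularity enters only in the extension
  \<open>cadlag_L2_martingale\<close>, so the paths of the fractional integral never have to be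
  studied.\<close>

locale L2_martingale = filtered_prob_space M F T
  for M :: "'a measure" and F :: "real \<Rightarrow> 'a measure" and T :: real +
  fixes X :: "real \<Rightarrow> 'a \<Rightarrow> real"
  assumes mart: "martingale M F T X"
    and X_L2: "\<And>t. t \<in> {0..<T} \<Longrightarrow> X t \<in> L2_space M"
begin

definition moment :: "real \<Rightarrow> real" where
  "moment t = (\<integral>\<omega>. (X t \<omega>)\<^sup>2 \<partial>M)"

lemma X_measurable_F:
  assumes "0 \<le> s" "s \<le> t" "t \<le> T" "s < T"
  shows "X s \<in> borel_measurable (F t)"
  using mart assms
  by (intro measurable_from_subalg[OF subalgebra_F_mono[of s t]]) (auto simp: martingale_def)

lemma cond_exp_X: "0 \<le> s \<Longrightarrow> s \<le> t \<Longrightarrow> t < T \<Longrightarrow> AE \<omega> in M. real_cond_exp M (F s) (X t) \<omega> = X s \<omega>"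
  using mart by (auto simp: martingale_def)

lemma integral_mult_X:
  assumes st: "0 \<le> s" "s \<le> t" "t < T" and Z: "Z \<in> L2_space M" "Z \<in> borel_measurable (F s)"
  shows "(\<integral>\<omega>. Z \<omega> * X t \<omega> \<partial>M) = (\<integral>\<omega>. Z \<omega> * X s \<omega> \<partial>M)"
proof -
  interpret sigma_finite_subalgebra M "F s"
    using st by (intro sigma_finite_subalgebra_F) auto
  have [measurable]: "X t \<in> borel_measurable M" "X s \<in> borel_measurable M" "Z \<in> borel_measurable M"
    using st by (auto intro!: L2_spaceD X_L2 Z)
  have "(\<integral>\<omega>. Z \<omega> * X t \<omega> \<partial>M) = (\<integral>\<omega>. Z \<omega> * real_cond_exp M (F s) (X t) \<omega> \<partial>M)"
    using st by (intro real_cond_exp_intg(2)[symmetric] L2_mult_integrable Z X_L2) auto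
  also have "\<dots> = (\<integral>\<omega>. Z \<omega> * X s \<omega> \<partial>M)"
    using cond_exp_X[OF st] by (intro integral_cong_AE) auto
  finally show ?thesis .
qed

lemma integral_X_mult_X:
  assumes "0 \<le> s" "s \<le> t" "t < T"
  shows "(\<integral>\<omega>. X s \<omega> * X t \<omega> \<partial>M) = moment s"
  using integral_mult_X[OF assms, of "X s"] X_L2[of s] X_measurable_F[of s s] assms
  by (simp add: moment_def power2_eq_square)

lemma moment_diff:
  assumes "0 \<le> s" "s \<le> t" "t < T"
  shows "(\<integral>\<omega>. (X t \<omega> - X s \<omega>)\<^sup>2 \<partial>M) = moment t - moment s"
  using L2_diff_power2[of "X t" "X s"] X_L2[of s] X_L2[of t] integral_X_mult_X[OF assms] assms
  by (simp add: moment_def[symmetric] mult.commute)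

lemma moment_nonneg: "0 \<le> moment t"
  by (simp add: moment_def)

lemma moment_mono:
  assumes "0 \<le> s" "s \<le> t" "t < T"
  shows "moment s \<le> moment t"
  using moment_diff[OF assms] Bochner_Integration.integral_nonneg[of M "\<lambda>\<omega>. (X t \<omega> - X s \<omega>)\<^sup>2"] by simp

text \<open>Conditional expectation is an orthogonal projection: E (Y - X t)^2 = E Y^2 -
  \<open>moment t\<close>, and the left-hand side is nonnegative.\<close>

lemma moment_bounded_if_closable:
  assumes "closable_L2 M F T X"
  shows "\<exists>C. \<forall>t\<in>{0..<T}. moment t \<le> C"
proof -
  obtain Y where Y: "Y \<in> L2_space M" "\<And>t. t \<in> {0..<T} \<Longrightarrow> AE \<omega> in M. X t \<omega> = real_cond_exp M (F t) Y \<omega>"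
    using assms by (auto simp: closable_L2_def)
  have "moment t \<le> (\<integral>\<omega>. (Y \<omega>)\<^sup>2 \<partial>M)" if t: "t \<in> {0..<T}" for t
  proof -
    interpret sigma_finite_subalgebra M "F t"
      using t by (intro sigma_finite_subalgebra_F) auto
    have [measurable]: "X t \<in> borel_measurable M" "Y \<in> borel_measurable M"
      using L2_spaceD(1)[OF X_L2[OF t]] L2_spaceD(1)[OF Y(1)] by auto
    have "moment t = (\<integral>\<omega>. X t \<omega> * real_cond_exp M (F t) Y \<omega> \<partial>M)"
      unfolding moment_def power2_eq_square using Y(2)[OF t] by (intro integral_cong_AE) auto
    also have "\<dots> = (\<integral>\<omega>. X t \<omega> * Y \<omega> \<partial>M)"
      using t by (intro real_cond_exp_intg(2) L2_mult_integrable X_L2 Y X_measurable_F) auto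
    finally have "(\<integral>\<omega>. (Y \<omega> - X t \<omega>)\<^sup>2 \<partial>M) = (\<integral>\<omega>. (Y \<omega>)\<^sup>2 \<partial>M) - moment t"
      using L2_diff_power2[OF Y(1) X_L2[OF t]] by (simp add: moment_def[symmetric] mult.commute)
    then show ?thesis using Bochner_Integration.integral_nonneg[of M "\<lambda>\<omega>. (Y \<omega> - X t \<omega>)\<^sup>2"] by simp
  qed
  then show ?thesis by blast
qed

text \<open>The moments increase to a finite limit, and squared distances along \<open>t n\<close>
  are differences of moments, so the sequence is Cauchy in the second and hence in the first mean.
  An almost surely convergent subsequence supplies the candidate \<open>Y\<close>; Fatou's lemma
  transfers the distance estimates to it.\<close>

lemma closable_if_moment_bounded:
  assumes bound: "\<And>t. t \<in> {0..<T} \<Longrightarrow> moment t \<le> C"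
  shows "closable_L2 M F T X"
proof -
  define t where "t n = T - T / (real n + 1)" for n
  have t_in: "t n \<in> {0..<T}" for n using T_pos by (simp add: t_def field_simps)
  have t_mono: "t i \<le> t j" if "i \<le> j" for i j
    using T_pos that by (simp add: t_def frac_le)
  have t_lim: "t \<longlonglongrightarrow> T"
    unfolding t_def[abs_def] using tendsto_diff[OF tendsto_const[of T] tendsto_mult_left[OF LIMSEQ_inverse_real_of_nat, of T]]
    by (simp add: divide_inverse add.commute)
  have inc: "incseq (\<lambda>n. moment (t n))"
    using t_in t_mono by (intro incseq_SucI moment_mono) (auto simp del: of_nat_Suc)
  obtain l where l: "(\<lambda>n. moment (t n)) \<longlonglongrightarrow> l" "\<And>n. moment (t n) \<le> l"
    using incseq_convergent[OF inc, of C] bound[OF t_in] by auto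
  have L2t: "X (t n) \<in> L2_space M" for n using X_L2[OF t_in] .
  have [measurable]: "X (t n) \<in> borel_measurable M" for n using L2_spaceD(1)[OF L2t] .
  have dist: "(\<integral>\<omega>. (X (t i) \<omega> - X (t j) \<omega>)\<^sup>2 \<partial>M) = \<bar>moment (t i) - moment (t j)\<bar>" for i j
  proof (cases "j \<le> i")
    case True
    then show ?thesis
      using moment_diff[of "t j" "t i"] moment_mono[of "t j" "t i"] t_mono[of j i] t_in[of i] t_in[of j] by simp
  next
    case False
    then show ?thesis
      using moment_diff[of "t i" "t j"] moment_mono[of "t i" "t j"] t_mono[of i j] t_in[of i] t_in[of j]
      by (simp add: power2_commute)
  qed
  have "\<exists>N. \<forall>i\<ge>N. \<forall>j\<ge>N. (\<integral>\<omega>. norm (X (t i) \<omega> - X (t j) \<omega>) \<partial>M) < e" if e: "0 < e" for e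
  proof -
    have "Cauchy (\<lambda>n. moment (t n))" using l(1) by (rule LIMSEQ_imp_Cauchy)
    moreover have "0 < e\<^sup>2" using e by simp
    ultimately obtain N where N: "\<And>i j. i \<ge> N \<Longrightarrow> j \<ge> N \<Longrightarrow> \<bar>moment (t i) - moment (t j)\<bar> < e\<^sup>2"
      unfolding Cauchy_def dist_real_def by blast
    have "(\<integral>\<omega>. norm (X (t i) \<omega> - X (t j) \<omega>) \<partial>M) < e" if "i \<ge> N" "j \<ge> N" for i j
    proof -
      have "(\<integral>\<omega>. norm (X (t i) \<omega> - X (t j) \<omega>) \<partial>M)\<^sup>2 < e\<^sup>2"
        using L1_le_L2[OF L2_diff[OF L2t[of i] L2t[of j]]] N[OF that] dist[of i j] by simp
      then show ?thesis using e by (intro power2_less_imp_less[of _ e]) auto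
    qed
    then show ?thesis by blast
  qed
  then obtain r where r: "strict_mono r" "AE \<omega> in M. Cauchy (\<lambda>i. X (t (r i)) \<omega>)"
    using cauchy_L1_AE_cauchy_subseq[of M "\<lambda>n. X (t n)"] L2_integrable[OF L2t] by blast
  define Y where "Y \<omega> = lim (\<lambda>i. X (t (r i)) \<omega>)" for \<omega>
  have Y_meas [measurable]: "Y \<in> borel_measurable M" unfolding Y_def[abs_def] by measurable
  have Y_lim: "AE \<omega> in M. (\<lambda>i. X (t (r i)) \<omega>) \<longlonglongrightarrow> Y \<omega>"
    using r(2) by eventually_elim (simp add: Y_def Cauchy_convergent_iff convergent_LIMSEQ_iff)
  \<comment> \<open>Used with Z = 0 to place \<open>Y\<close> in the space, and with Z =
    \<open>X (t n)\<close> to obtain a rate of convergence.\<close>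
  have Fatou: "(\<integral>\<^sup>+\<omega>. ennreal ((Y \<omega> - Z \<omega>)\<^sup>2) \<partial>M) \<le> ennreal B"
    if [measurable]: "Z \<in> borel_measurable M" and Z: "Z \<in> L2_space M"
      and B: "eventually (\<lambda>i. (\<integral>\<omega>. (X (t (r i)) \<omega> - Z \<omega>)\<^sup>2 \<partial>M) \<le> B) sequentially" for Z B
  proof -
    have "(\<integral>\<^sup>+\<omega>. ennreal ((Y \<omega> - Z \<omega>)\<^sup>2) \<partial>M) = (\<integral>\<^sup>+\<omega>. liminf (\<lambda>i. ennreal ((X (t (r i)) \<omega> - Z \<omega>)\<^sup>2)) \<partial>M)"
    proof (rule nn_integral_cong_AE, use Y_lim in eventually_elim)
      fix \<omega> assume "(\<lambda>i. X (t (r i)) \<omega>) \<longlonglongrightarrow> Y \<omega>"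
      then have "(\<lambda>i. ennreal ((X (t (r i)) \<omega> - Z \<omega>)\<^sup>2)) \<longlonglongrightarrow> ennreal ((Y \<omega> - Z \<omega>)\<^sup>2)"
        by (intro tendsto_ennrealI tendsto_power tendsto_diff tendsto_const)
      then show "ennreal ((Y \<omega> - Z \<omega>)\<^sup>2) = liminf (\<lambda>i. ennreal ((X (t (r i)) \<omega> - Z \<omega>)\<^sup>2))"
        by (intro lim_imp_Liminf[symmetric]) auto
    qed
    also have "\<dots> \<le> liminf (\<lambda>i. \<integral>\<^sup>+\<omega>. ennreal ((X (t (r i)) \<omega> - Z \<omega>)\<^sup>2) \<partial>M)"
      by (rule nn_integral_liminf) measurable
    also have "\<dots> \<le> liminf (\<lambda>i. ennreal B)"
    proof (rule Liminf_mono, use B in eventually_elim)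
      fix i assume "(\<integral>\<omega>. (X (t (r i)) \<omega> - Z \<omega>)\<^sup>2 \<partial>M) \<le> B"
      then show "(\<integral>\<^sup>+\<omega>. ennreal ((X (t (r i)) \<omega> - Z \<omega>)\<^sup>2) \<partial>M) \<le> ennreal B"
        using L2_spaceD(2)[OF L2_diff[OF L2t[of "r i"] Z]]
        by (subst nn_integral_eq_integral) (auto intro: ennreal_leI)
    qed
    finally show ?thesis by (simp add: Liminf_const)
  qed
  have "(\<integral>\<^sup>+\<omega>. ennreal ((Y \<omega> - (\<lambda>_. 0) \<omega>)\<^sup>2) \<partial>M) \<le> ennreal l"
    by (rule Fatou) (use l(2) in \<open>auto simp: L2_space_def moment_def intro!: always_eventually\<close>)
  then have "(\<integral>\<^sup>+\<omega>. ennreal (norm ((Y \<omega>)\<^sup>2)) \<partial>M) < \<infinity>"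
    by (simp add: order.strict_trans1[OF _ ennreal_less_top])
  then have "integrable M (\<lambda>\<omega>. (Y \<omega>)\<^sup>2)"
    by (intro integrableI_bounded) auto
  then have Y_L2: "Y \<in> L2_space M" by (simp add: L2_space_def)
  have dist_Y: "(\<integral>\<omega>. \<bar>Y \<omega> - X (t n) \<omega>\<bar> \<partial>M) \<le> sqrt (l - moment (t n))" for n
  proof -
    have "(\<integral>\<^sup>+\<omega>. ennreal ((Y \<omega> - X (t n) \<omega>)\<^sup>2) \<partial>M) \<le> ennreal (l - moment (t n))"
    proof (rule Fatou[OF _ L2t])
      show "eventually (\<lambda>i. (\<integral>\<omega>. (X (t (r i)) \<omega> - X (t n) \<omega>)\<^sup>2 \<partial>M) \<le> l - moment (t n)) sequentially"
      proof (rule eventually_sequentiallyI[of n])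
        fix i assume "n \<le> i"
        then have "n \<le> r i" using seq_suble[OF r(1), of i] by linarith
        then have "moment (t n) \<le> moment (t (r i))" using inc by (auto dest: incseqD)
        then show "(\<integral>\<omega>. (X (t (r i)) \<omega> - X (t n) \<omega>)\<^sup>2 \<partial>M) \<le> l - moment (t n)"
          using l(2)[of "r i"] dist[of "r i" n] by simp
      qed
    qed simp
    then have "ennreal (\<integral>\<omega>. (Y \<omega> - X (t n) \<omega>)\<^sup>2 \<partial>M) \<le> ennreal (l - moment (t n))"
      using L2_spaceD(2)[OF L2_diff[OF Y_L2 L2t[of n]]] by (subst (asm) nn_integral_eq_integral) auto
    then have "(\<integral>\<omega>. (Y \<omega> - X (t n) \<omega>)\<^sup>2 \<partial>M) \<le> l - moment (t n)"
      using l(2)[of n] by simp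
    then have "(\<integral>\<omega>. \<bar>Y \<omega> - X (t n) \<omega>\<bar> \<partial>M)\<^sup>2 \<le> l - moment (t n)"
      using L1_le_L2[OF L2_diff[OF Y_L2 L2t[of n]]] by simp
    then show ?thesis by (rule real_le_rsqrt)
  qed
  have "AE \<omega> in M. X s \<omega> = real_cond_exp M (F s) Y \<omega>" if s: "s \<in> {0..<T}" for s
  proof -
    interpret sigma_finite_subalgebra M "F s"
      using s by (intro sigma_finite_subalgebra_F) auto
    have "AE \<omega> in M. real_cond_exp M (F s) Y \<omega> = X s \<omega>"
    proof (rule real_cond_exp_charact)
      fix A assume A: "A \<in> sets (F s)"
      then have [measurable]: "A \<in> sets M" using subalg by (auto simp: subalgebra_def)
      have ind: "indicat_real A \<in> L2_space M" by (rule indicator_L2) measurable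
      let ?d = "(\<integral>\<omega>. indicator A \<omega> * Y \<omega> \<partial>M) - (\<integral>\<omega>. indicator A \<omega> * X s \<omega> \<partial>M)"
      \<comment> \<open>The number \<open>?d\<close> does not depend on n, whereas by the martingale
        property \<open>X s\<close> may be replaced by \<open>X (t n)\<close> under the integral
        over A. Letting n tend to infinity forces \<open>?d\<close> to vanish.\<close>
      have le: "\<bar>?d\<bar> \<le> sqrt (l - moment (t n))" if n: "s \<le> t n" for n
      proof -
        have "(\<integral>\<omega>. indicator A \<omega> * X s \<omega> \<partial>M) = (\<integral>\<omega>. indicator A \<omega> * X (t n) \<omega> \<partial>M)"
          using s n t_in[of n] A by (intro integral_mult_X[symmetric] ind) auto
        then have "?d = (\<integral>\<omega>. indicator A \<omega> * Y \<omega> - indicator A \<omega> * X (t n) \<omega> \<partial>M)"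
          using L2_mult_integrable[OF ind Y_L2] L2_mult_integrable[OF ind L2t[of n]] by simp
        then have "\<bar>?d\<bar> \<le> (\<integral>\<omega>. \<bar>indicator A \<omega> * Y \<omega> - indicator A \<omega> * X (t n) \<omega>\<bar> \<partial>M)"
          using integral_abs_bound by metis
        also have "\<dots> \<le> (\<integral>\<omega>. \<bar>Y \<omega> - X (t n) \<omega>\<bar> \<partial>M)"
          using L2_integrable[OF L2_diff[OF Y_L2 L2t[of n]]]
          by (intro integral_mono_AE') (auto simp: indicator_def)
        also note dist_Y[of n]
        finally show ?thesis .
      qed
      have "(\<lambda>n. sqrt (l - moment (t n))) \<longlonglongrightarrow> sqrt (l - l)"
        by (intro tendsto_intros l)
      moreover have "eventually (\<lambda>n. s \<le> t n) sequentially"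
        using order_tendstoD(1)[OF t_lim, of s] s by (auto elim: eventually_mono)
      then have "eventually (\<lambda>n. \<bar>?d\<bar> \<le> sqrt (l - moment (t n))) sequentially"
        by eventually_elim (rule le)
      ultimately have "\<bar>?d\<bar> \<le> sqrt (l - l)"
        by (intro tendsto_lowerbound[of _ _ sequentially]) auto
      then show "(LINT x:A|M. Y x) = (LINT x:A|M. X s x)"
        by (simp add: set_lebesgue_integral_def)
    qed (use s in \<open>auto intro!: L2_integrable Y_L2 X_L2 X_measurable_F\<close>)
    then show ?thesis by eventually_elim simp
  qed
  then show ?thesis unfolding closable_L2_def using Y_L2 by blast
qed

lemma closable_iff_moment_bounded:
  "closable_L2 M F T X \<longleftrightarrow> (\<exists>C. \<forall>t\<in>{0..<T}. moment t \<le> C)"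
  using moment_bounded_if_closable closable_if_moment_bounded by blast

end


section \<open>The fractional integral\<close>

text \<open>Jensen's inequality in a form that applies to single paths, whose square integrability
  is not known in advance: if it fails, the right-hand side is infinite.\<close>

lemma (in prob_space) ennreal_integral_power2_le:
  fixes f :: "'a \<Rightarrow> real"
  assumes [measurable]: "f \<in> borel_measurable M"
  shows "ennreal ((\<integral>\<omega>. f \<omega> \<partial>M)\<^sup>2) \<le> (\<integral>\<^sup>+\<omega>. ennreal ((f \<omega>)\<^sup>2) \<partial>M)"
proof (cases "integrable M (\<lambda>\<omega>. (f \<omega>)\<^sup>2)")
  case True
  then have "f \<in> L2_space M" by (simp add: L2_space_def)
  then have "(\<integral>\<omega>. f \<omega> \<partial>M)\<^sup>2 \<le> (\<integral>\<omega>. (f \<omega>)\<^sup>2 \<partial>M)"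
    using integral_power2_le[OF L2_integrable True] by simp
  then show ?thesis using True by (subst nn_integral_eq_integral) (auto intro: ennreal_leI)
next
  case False
  have "(\<integral>\<^sup>+\<omega>. ennreal ((f \<omega>)\<^sup>2) \<partial>M) = \<infinity>"
  proof (rule ccontr)
    assume "(\<integral>\<^sup>+\<omega>. ennreal ((f \<omega>)\<^sup>2) \<partial>M) \<noteq> \<infinity>"
    then have "integrable M (\<lambda>\<omega>. (f \<omega>)\<^sup>2)"
      by (intro integrableI_bounded) (auto simp: less_top)
    then show False using False by simp
  qed
  then show ?thesis by simp
qed

lemma less_grid_point:
  fixes w :: real
  shows "w < (real (nat \<lfloor>real (Suc n) * w\<rfloor>) + 1) / real (Suc n)"
proof -
  have "real (Suc n) * w < real (nat \<lfloor>real (Suc n) * w\<rfloor>) + 1" by linarith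
  then show ?thesis by (simp add: pos_less_divide_eq mult.commute del: of_nat_Suc)
qed

text \<open>The approximation is strictly from the right, as right-continuity demands, and for each
  n it takes only countably many values, which makes the discretised process measurable.\<close>

lemma grid_point_tendsto:
  fixes w :: real
  assumes "0 \<le> w"
  defines "q n \<equiv> (real (nat \<lfloor>real (Suc n) * w\<rfloor>) + 1) / real (Suc n)"
  shows "filterlim q (at_right w) sequentially"
proof -
  have gt: "w < q n" for n unfolding q_def by (rule less_grid_point)
  have le: "q n \<le> w + 1 / real (Suc n)" for n
  proof -
    have "0 \<le> real (Suc n) * w" using assms by simp
    then have "real (nat \<lfloor>real (Suc n) * w\<rfloor>) \<le> real (Suc n) * w" by linarith
    then have "q n \<le> (real (Suc n) * w + 1) / real (Suc n)"
      unfolding q_def by (intro divide_right_mono) auto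
    also have "\<dots> = w + 1 / real (Suc n)" by (simp add: add_divide_distrib del: of_nat_Suc)
    finally show ?thesis .
  qed
  have "(\<lambda>n. w + 1 / real (Suc n)) \<longlonglongrightarrow> w + 0"
    by (intro tendsto_intros LIMSEQ_Suc[OF lim_1_over_n])
  then have "q \<longlonglongrightarrow> w"
    using gt le by (intro tendsto_sandwich[of "\<lambda>_. w" q sequentially "\<lambda>n. w + 1 / real (Suc n)"])
      (auto intro!: always_eventually less_imp_le)
  then show ?thesis using gt by (auto simp: filterlim_at intro!: always_eventually)
qed

locale cadlag_L2_martingale = L2_martingale M F T L
  for M :: "'a measure" and F :: "real \<Rightarrow> 'a measure" and T :: real and L :: "real \<Rightarrow> 'a \<Rightarrow> real" +
  assumes cadlag: "cadlag M T L"
begin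

text \<open>The clamping at 0 keeps the time argument in [0,T) for every real u, so that the process
  can be integrated against measures on the whole line.\<close>

definition stopped :: "real \<Rightarrow> 'a \<Rightarrow> real \<Rightarrow> real" where
  "stopped t \<omega> u = L (max 0 (min u t)) \<omega>"

text \<open>Progressive measurability of an adapted right-continuous process. Grid times are capped
  at \<open>t\<close>, so only variables measurable for \<open>F t\<close> occur. Before
  \<open>t\<close> the limit exists by right-continuity; from \<open>t\<close> on the capped time is
  constantly \<open>t\<close>.\<close>

lemma stopped_measurable_F:
  assumes t: "t \<in> {0..<T}"
  shows "(\<lambda>(\<omega>, u). stopped t \<omega> u) \<in> borel_measurable (F t \<Otimes>\<^sub>M borel)"
proof -
  define q where "q n u = (real (nat \<lfloor>real (Suc n) * max 0 u\<rfloor>) + 1) / real (Suc n)" for n u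
  have "(\<lambda>p. L (min t (q n (snd p))) (fst p)) \<in> borel_measurable (F t \<Otimes>\<^sub>M borel)" for n
    unfolding q_def
  proof (rule measurable_compose_countable[where f = "\<lambda>i p. L (min t ((real i + 1) / real (Suc n))) (fst p)"])
    fix i :: nat
    have [measurable]: "L (min t ((real i + 1) / real (Suc n))) \<in> borel_measurable (F t)"
      using t by (intro X_measurable_F) auto
    show "(\<lambda>p. L (min t ((real i + 1) / real (Suc n))) (fst p)) \<in> borel_measurable (F t \<Otimes>\<^sub>M borel)"
      by measurable
  qed measurable
  then show ?thesis
  proof (rule borel_measurable_LIMSEQ_real[rotated])
    fix p assume p: "p \<in> space (F t \<Otimes>\<^sub>M (borel :: real measure))"
    obtain \<omega> u where pu: "p = (\<omega>, u)" by (cases p)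
    have \<omega>: "\<omega> \<in> space M" using p space_F[of t] t by (auto simp: pu space_pair_measure)
    let ?w = "max 0 u"
    have lim: "filterlim (\<lambda>n. q n u) (at_right ?w) sequentially"
      unfolding q_def by (rule grid_point_tendsto) simp
    show "(\<lambda>n. L (min t (q n (snd p))) (fst p)) \<longlonglongrightarrow> (case p of (\<omega>, u) \<Rightarrow> stopped t \<omega> u)"
    proof (cases "?w < t")
      case True
      have "((\<lambda>s. L s \<omega>) \<longlongrightarrow> L ?w \<omega>) (at_right ?w)"
        using cadlag \<omega> t True by (auto simp: cadlag_def continuous_within)
      then have "(\<lambda>n. L (q n u) \<omega>) \<longlonglongrightarrow> L ?w \<omega>" using lim by (rule filterlim_compose)
      moreover have "eventually (\<lambda>n. q n u < t) sequentially"
        using lim True by (auto simp: filterlim_at intro: order_tendstoD(2))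
      then have "eventually (\<lambda>n. L (q n u) \<omega> = L (min t (q n u)) \<omega>) sequentially"
        by eventually_elim simp
      ultimately have "(\<lambda>n. L (min t (q n u)) \<omega>) \<longlonglongrightarrow> L ?w \<omega>"
        by (rule Lim_transform_eventually)
      moreover have "max 0 (min u t) = ?w" using True t by auto
      ultimately show ?thesis by (simp add: pu stopped_def)
    next
      case False
      have "t \<le> q n u" for n
      proof -
        have "?w < q n u" unfolding q_def by (rule less_grid_point)
        then show ?thesis using False by linarith
      qed
      then have "min t (q n u) = t" for n by (simp add: min_def)
      moreover have "max 0 (min u t) = t" using False t by (auto simp: max_def min_def split: if_splits)
      ultimately show ?thesis by (simp add: pu stopped_def)
    qed
  qed
qed

lemma stopped_measurable:
  assumes t: "t \<in> {0..<T}"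
  shows "(\<lambda>(\<omega>, u). stopped t \<omega> u) \<in> borel_measurable (M \<Otimes>\<^sub>M borel)"
proof -
  have "subalgebra M (F t)" using t by (intro subalgebra_F) auto
  then have "(\<lambda>\<omega>. \<omega>) \<in> M \<rightarrow>\<^sub>M F t" by (auto simp: subalgebra_def measurable_def)
  then have "fst \<in> M \<Otimes>\<^sub>M borel \<rightarrow>\<^sub>M F t" by (rule measurable_compose[OF measurable_fst])
  then have "(\<lambda>p. (fst p, snd p)) \<in> (M \<Otimes>\<^sub>M borel) \<rightarrow>\<^sub>M (F t \<Otimes>\<^sub>M borel)"
    by (rule measurable_Pair[OF _ measurable_snd])
  from measurable_compose[OF this stopped_measurable_F[OF t]]
  show ?thesis by simp
qed

lemma stopped_time: "t \<in> {0..<T} \<Longrightarrow> max 0 (min u t) \<in> {0..<T}"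
  by auto

lemma stopped_L2: "t \<in> {0..<T} \<Longrightarrow> (\<lambda>\<omega>. stopped t \<omega> u) \<in> L2_space M"
  unfolding stopped_def by (intro X_L2 stopped_time)

definition stopped_moment :: "real \<Rightarrow> real \<Rightarrow> real" where
  "stopped_moment t u = moment (max 0 (min u t))"

lemma stopped_moment_mono: "t \<in> {0..<T} \<Longrightarrow> u \<le> v \<Longrightarrow> stopped_moment t u \<le> stopped_moment t v"
  unfolding stopped_moment_def by (intro moment_mono) auto

lemma stopped_moment_le: "t \<in> {0..<T} \<Longrightarrow> stopped_moment t u \<le> moment t"
  unfolding stopped_moment_def by (intro moment_mono) auto

lemma stopped_moment_nonneg: "0 \<le> stopped_moment t u"
  unfolding stopped_moment_def by (rule moment_nonneg)

lemma stopped_moment_measurable: "t \<in> {0..<T} \<Longrightarrow> stopped_moment t \<in> borel_measurable borel"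
  by (intro borel_measurable_mono monoI stopped_moment_mono)

lemma integral_stopped_mult:
  assumes t: "t \<in> {0..<T}"
  shows "(\<integral>\<omega>. stopped t \<omega> u * stopped t \<omega> v \<partial>M) = stopped_moment t (min u v)"
proof -
  have *: "(\<integral>\<omega>. stopped t \<omega> u * stopped t \<omega> v \<partial>M) = stopped_moment t u" if "u \<le> v" for u v
    unfolding stopped_def stopped_moment_def using t that by (intro integral_X_mult_X) auto
  show ?thesis
    using *[of u v] *[of v u] by (cases "u \<le> v") (simp_all add: mult.commute min_def)
qed

end

locale frac_setting = cadlag_L2_martingale M F T L
  for M :: "'a measure" and F :: "real \<Rightarrow> 'a measure" and T :: real and L :: "real \<Rightarrow> 'a \<Rightarrow> real" +
  fixes \<theta> \<alpha> :: real
  assumes \<theta>: "0 < \<theta>" "\<theta> < 1" and \<alpha>: "\<alpha> = (1 - \<theta>) / 2"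
begin

definition frac_density :: "real \<Rightarrow> real" where
  "frac_density u = indicator {0..T} u * (\<alpha> / T powr \<alpha> * (T - u) powr (\<alpha> - 1))"

definition frac_measure :: "real measure" where
  "frac_measure = density lborel (\<lambda>u. ennreal (frac_density u))"

abbreviation "X \<equiv> frac_integral T \<alpha> L"

lemma frac_density_measurable [measurable]: "frac_density \<in> borel_measurable borel"
  unfolding frac_density_def[abs_def] by measurable

lemma alpha_pos: "0 < \<alpha>" "\<alpha> < 1"
  using \<theta> \<alpha> by auto

lemma frac_density_nonneg: "0 \<le> frac_density u"
  using alpha_pos T_pos by (simp add: frac_density_def)

lemma sets_frac_measure [measurable_cong]: "sets frac_measure = sets borel"
  by (simp add: frac_measure_def)

text \<open>Both closed and open half-lines are needed, since the square is later split along its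
  diagonal into v < u and u \<le> v.\<close>

lemma frac_measure_tail:
  assumes v: "0 \<le> v" "v \<le> T"
  shows "emeasure frac_measure {v..} = ennreal (((T - v) / T) powr \<alpha>)"
    and "emeasure frac_measure {v<..} = ennreal (((T - v) / T) powr \<alpha>)"
proof -
  have "emeasure frac_measure {v..} = (\<integral>\<^sup>+u. ennreal (frac_density u) * indicator {v..} u \<partial>lborel)"
    unfolding frac_measure_def by (subst emeasure_density) auto
  also have "\<dots> = (\<integral>\<^sup>+u. ennreal (\<alpha> / T powr \<alpha>) * (ennreal ((T - u) powr (- (1 - \<alpha>))) * indicator {v..<T} u) \<partial>lborel)"
  proof (rule nn_integral_cong)
    fix u
    show "ennreal (frac_density u) * indicator {v..} u
        = ennreal (\<alpha> / T powr \<alpha>) * (ennreal ((T - u) powr (- (1 - \<alpha>))) * indicator {v..<T} u)"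
      using v alpha_pos T_pos by (cases "u = T") (auto simp: frac_density_def indicator_def ennreal_mult[symmetric])
  qed
  also have "\<dots> = ennreal (\<alpha> / T powr \<alpha>) * ennreal ((T - v) powr (1 - (1 - \<alpha>)) / (1 - (1 - \<alpha>)))"
    using v alpha_pos by (subst nn_integral_cmult, measurable, subst nn_integral_powr_tail) auto
  also have "\<dots> = ennreal (((T - v) / T) powr \<alpha>)"
    using alpha_pos T_pos v by (subst ennreal_mult[symmetric]) (auto simp: powr_divide)
  finally show *: "emeasure frac_measure {v..} = ennreal (((T - v) / T) powr \<alpha>)" .
  have "emeasure frac_measure {v<..} = emeasure frac_measure {v..}"
    unfolding frac_measure_def
    by (intro emeasure_eq_AE, subst AE_density) (use AE_lborel_singleton[of v] in \<open>auto elim!: eventually_mono\<close>)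
  then show "emeasure frac_measure {v<..} = ennreal (((T - v) / T) powr \<alpha>)" using * by simp
qed

lemma prob_space_frac_measure: "prob_space frac_measure"
proof
  have "emeasure frac_measure {0..} = emeasure frac_measure (space frac_measure)"
    unfolding frac_measure_def
    by (intro emeasure_eq_AE, subst AE_density) (auto simp: frac_density_def indicator_def intro!: AE_I2)
  then show "emeasure frac_measure (space frac_measure) = 1"
    using frac_measure_tail(1)[of 0] T_pos by simp
qed

sublocale \<nu>: prob_space frac_measure by (rule prob_space_frac_measure)
sublocale M\<nu>: pair_sigma_finite M frac_measure ..

lemma stopped_measurable_pair [measurable]:
  "t \<in> {0..<T} \<Longrightarrow> (\<lambda>(\<omega>, u). stopped t \<omega> u) \<in> borel_measurable (M \<Otimes>\<^sub>M frac_measure)"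
  using stopped_measurable[of t] by (simp cong: measurable_cong_sets)

lemma frac_integral_eq:
  assumes t: "t \<in> {0..<T}" and \<omega>: "\<omega> \<in> space M"
  shows "X t \<omega> = (\<integral>u. stopped t \<omega> u \<partial>frac_measure)"
proof -
  have [measurable]: "stopped t \<omega> \<in> borel_measurable borel"
    using measurable_compose[OF measurable_Pair1'[OF \<omega>] stopped_measurable[OF t]] by simp
  have "(\<integral>u. stopped t \<omega> u \<partial>frac_measure) = (\<integral>u. frac_density u * stopped t \<omega> u \<partial>lborel)"
    unfolding frac_measure_def using frac_density_nonneg by (subst integral_density) auto
  also have "\<dots> = (\<integral>u. \<alpha> / T powr \<alpha> * (indicator {0..T} u * ((T - u) powr (\<alpha> - 1) * L (min u t) \<omega>)) \<partial>lborel)"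
    by (intro Bochner_Integration.integral_cong)
       (use t in \<open>auto simp: frac_density_def stopped_def indicator_def max_def\<close>)
  also have "\<dots> = X t \<omega>"
    by (simp add: frac_integral_def set_lebesgue_integral_def)
  finally show ?thesis ..
qed

lemma X_measurable:
  assumes t: "t \<in> {0..<T}"
  shows "X t \<in> borel_measurable (F t)"
proof -
  have [measurable]: "(\<lambda>(\<omega>, u). stopped t \<omega> u) \<in> borel_measurable (F t \<Otimes>\<^sub>M frac_measure)"
    using stopped_measurable_F[OF t] by (simp cong: measurable_cong_sets)
  have "(\<lambda>\<omega>. \<integral>u. stopped t \<omega> u \<partial>frac_measure) \<in> borel_measurable (F t)"
    by measurable
  moreover have "X t \<in> borel_measurable (F t) \<longleftrightarrow>
      (\<lambda>\<omega>. \<integral>u. stopped t \<omega> u \<partial>frac_measure) \<in> borel_measurable (F t)"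
    using space_F[of t] t by (intro measurable_cong frac_integral_eq) auto
  ultimately show ?thesis by simp
qed

lemma X_measurable_M: "t \<in> {0..<T} \<Longrightarrow> X t \<in> borel_measurable M"
  by (rule measurable_from_subalg[OF subalgebra_F X_measurable]) auto

lemma nn_integral_stopped_power2:
  assumes t: "t \<in> {0..<T}"
  shows "(\<integral>\<^sup>+\<omega>. ennreal ((stopped t \<omega> u)\<^sup>2) \<partial>M) = ennreal (stopped_moment t u)"
  using L2_spaceD[OF stopped_L2[OF t, of u]] integral_stopped_mult[OF t, of u u]
  by (subst nn_integral_eq_integral) (auto simp: power2_eq_square)

text \<open>Jensen's inequality for each path, then Tonelli; the second moment of the stopped
  process never exceeds \<open>moment t\<close>.\<close>

lemma X_frac_L2:
  assumes t: "t \<in> {0..<T}"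
  shows "X t \<in> L2_space M"
proof -
  note [measurable] = stopped_measurable_pair[OF t] X_measurable_M[OF t]
  have "(\<integral>\<^sup>+\<omega>. ennreal ((X t \<omega>)\<^sup>2) \<partial>M) \<le> (\<integral>\<^sup>+\<omega>. \<integral>\<^sup>+u. ennreal ((stopped t \<omega> u)\<^sup>2) \<partial>frac_measure \<partial>M)"
  proof (rule nn_integral_mono)
    fix \<omega> assume \<omega>: "\<omega> \<in> space M"
    have "stopped t \<omega> \<in> borel_measurable frac_measure"
      using measurable_compose[OF measurable_Pair1'[OF \<omega>] stopped_measurable_pair[OF t]] by simp
    then show "ennreal ((X t \<omega>)\<^sup>2) \<le> (\<integral>\<^sup>+u. ennreal ((stopped t \<omega> u)\<^sup>2) \<partial>frac_measure)"
      unfolding frac_integral_eq[OF t \<omega>] by (rule \<nu>.ennreal_integral_power2_le)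
  qed
  also have "\<dots> = (\<integral>\<^sup>+u. \<integral>\<^sup>+\<omega>. ennreal ((stopped t \<omega> u)\<^sup>2) \<partial>M \<partial>frac_measure)"
    by (rule M\<nu>.Fubini'[symmetric]) measurable
  also have "\<dots> \<le> (\<integral>\<^sup>+u. ennreal (moment t) \<partial>frac_measure)"
    unfolding nn_integral_stopped_power2[OF t]
    by (intro nn_integral_mono ennreal_leI stopped_moment_le t)
  also have "\<dots> = ennreal (moment t)" by (simp add: \<nu>.emeasure_space_1)
  finally have "(\<integral>\<^sup>+\<omega>. ennreal (norm ((X t \<omega>)\<^sup>2)) \<partial>M) < \<infinity>"
    by (simp add: order.strict_trans1[OF _ ennreal_less_top])
  then have "integrable M (\<lambda>\<omega>. (X t \<omega>)\<^sup>2)" by (intro integrableI_bounded) auto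
  then show ?thesis by (simp add: L2_space_def)
qed

text \<open>Fubini for the product with a square integrable factor, dominated by Z^2 plus the square
  of the stopped process. Indicators as Z give the martingale property; \<open>X t\<close> and the
  stopped process itself as Z give the second moment.\<close>

lemma integral_mult_frac:
  assumes t: "t \<in> {0..<T}" and Z: "Z \<in> L2_space M"
  shows "(\<integral>\<omega>. Z \<omega> * X t \<omega> \<partial>M) = (\<integral>u. (\<integral>\<omega>. Z \<omega> * stopped t \<omega> u \<partial>M) \<partial>frac_measure)"
proof -
  note [measurable] = stopped_measurable_pair[OF t] X_measurable_M[OF t] L2_spaceD(1)[OF Z]
  let ?f = "\<lambda>(\<omega>, u). Z \<omega> * stopped t \<omega> u"
  have "(\<integral>\<^sup>+p. ennreal (norm (?f p)) \<partial>(M \<Otimes>\<^sub>M frac_measure))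
    = (\<integral>\<^sup>+u. \<integral>\<^sup>+\<omega>. ennreal (norm (?f (\<omega>, u))) \<partial>M \<partial>frac_measure)"
    by (rule M\<nu>.nn_integral_snd[symmetric]) measurable
  also have "\<dots> \<le> (\<integral>\<^sup>+u. ennreal ((\<integral>\<omega>. (Z \<omega>)\<^sup>2 \<partial>M) + moment t) \<partial>frac_measure)"
  proof (rule nn_integral_mono)
    fix u
    have "(\<integral>\<^sup>+\<omega>. ennreal (norm (?f (\<omega>, u))) \<partial>M) \<le> (\<integral>\<^sup>+\<omega>. ennreal ((Z \<omega>)\<^sup>2 + (stopped t \<omega> u)\<^sup>2) \<partial>M)"
    proof (intro nn_integral_mono ennreal_leI)
      fix \<omega>
      have "0 \<le> (\<bar>Z \<omega>\<bar> - \<bar>stopped t \<omega> u\<bar>)\<^sup>2" by simp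
      then have "2 * (\<bar>Z \<omega>\<bar> * \<bar>stopped t \<omega> u\<bar>) \<le> (Z \<omega>)\<^sup>2 + (stopped t \<omega> u)\<^sup>2" by (simp add: power2_diff)
      moreover have "0 \<le> \<bar>Z \<omega>\<bar> * \<bar>stopped t \<omega> u\<bar>" by simp
      ultimately have "\<bar>Z \<omega>\<bar> * \<bar>stopped t \<omega> u\<bar> \<le> (Z \<omega>)\<^sup>2 + (stopped t \<omega> u)\<^sup>2" by linarith
      then show "norm (?f (\<omega>, u)) \<le> (Z \<omega>)\<^sup>2 + (stopped t \<omega> u)\<^sup>2" by (simp add: abs_mult)
    qed
    also have "\<dots> = ennreal ((\<integral>\<omega>. (Z \<omega>)\<^sup>2 \<partial>M) + stopped_moment t u)"
      using L2_spaceD(2)[OF Z] L2_spaceD(2)[OF stopped_L2[OF t, of u]] integral_stopped_mult[OF t, of u u]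
      by (subst nn_integral_eq_integral) (auto simp: power2_eq_square)
    also have "\<dots> \<le> ennreal ((\<integral>\<omega>. (Z \<omega>)\<^sup>2 \<partial>M) + moment t)"
      using stopped_moment_le[OF t] by (intro ennreal_leI) auto
    finally show "(\<integral>\<^sup>+\<omega>. ennreal (norm (?f (\<omega>, u))) \<partial>M) \<le> ennreal ((\<integral>\<omega>. (Z \<omega>)\<^sup>2 \<partial>M) + moment t)" .
  qed
  also have "\<dots> < \<infinity>" by (simp add: \<nu>.emeasure_space_1)
  finally have "integrable (M \<Otimes>\<^sub>M frac_measure) ?f"
    by (intro integrableI_bounded) auto
  then have "(\<integral>u. (\<integral>\<omega>. Z \<omega> * stopped t \<omega> u \<partial>M) \<partial>frac_measure) = (\<integral>\<omega>. (\<integral>u. Z \<omega> * stopped t \<omega> u \<partial>frac_measure) \<partial>M)"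
    by (rule M\<nu>.Fubini_integral)
  also have "\<dots> = (\<integral>\<omega>. Z \<omega> * X t \<omega> \<partial>M)"
    by (intro Bochner_Integration.integral_cong) (simp_all add: frac_integral_eq[OF t])
  finally show ?thesis ..
qed

text \<open>For A in \<open>F s\<close> the integrals over A of the processes stopped at t and at s
  agree for each single u: if u \<le> s the variables coincide, otherwise the martingale property of
  \<open>L\<close> applies. Averaging over u preserves the equality.\<close>

lemma martingale_frac: "martingale M F T X"
  unfolding martingale_def
proof (intro conjI ballI)
  fix s t assume s: "s \<in> {0..<T}" and t: "t \<in> {s..<T}"
  have t0: "t \<in> {0..<T}" using s t by auto
  interpret sigma_finite_subalgebra M "F s"
    using s by (intro sigma_finite_subalgebra_F) auto
  show "AE \<omega> in M. real_cond_exp M (F s) (X t) \<omega> = X s \<omega>"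
  proof (rule real_cond_exp_charact)
    fix A assume A: "A \<in> sets (F s)"
    then have [measurable]: "A \<in> sets M" using subalg by (auto simp: subalgebra_def)
    have ind: "indicat_real A \<in> L2_space M" by (rule indicator_L2) measurable
    have "(\<integral>\<omega>. indicator A \<omega> * stopped t \<omega> u \<partial>M) = (\<integral>\<omega>. indicator A \<omega> * stopped s \<omega> u \<partial>M)" for u
    proof (cases "u \<le> s")
      case True
      then show ?thesis using s t by (simp add: stopped_def min_def)
    next
      case False
      then have eq: "max 0 (min u s) = s" using s by auto
      show ?thesis unfolding stopped_def eq
        using s t False A by (intro integral_mult_X ind) auto
    qed
    then have "(\<integral>\<omega>. indicator A \<omega> * X t \<omega> \<partial>M) = (\<integral>\<omega>. indicator A \<omega> * X s \<omega> \<partial>M)"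
      unfolding integral_mult_frac[OF t0 ind] integral_mult_frac[OF s ind] by simp
    then show "(LINT x:A|M. X t x) = (LINT x:A|M. X s x)"
      by (simp add: set_lebesgue_integral_def)
  qed (use s t0 in \<open>auto intro!: L2_integrable X_frac_L2 X_measurable\<close>)
qed (use X_measurable L2_integrable[OF X_frac_L2] in auto)

sublocale frac: L2_martingale M F T X
  by unfold_locales (use martingale_frac X_frac_L2 in auto)

end


lemma ennreal_le_divide:
  assumes c: "0 < c" "0 \<le> C" and le: "ennreal c * x \<le> ennreal C"
  shows "x \<le> ennreal (C / c)"
proof -
  have "x = ennreal (1 / c) * (ennreal c * x)"
    using c by (simp add: mult.assoc[symmetric] ennreal_mult[symmetric])
  also have "\<dots> \<le> ennreal (1 / c) * ennreal C" using le by (rule mult_left_mono) simp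
  also have "\<dots> = ennreal (C / c)" using c by (simp add: ennreal_mult[symmetric])
  finally show ?thesis .
qed

section \<open>The second moment of the fractional integral and the energy\<close>

context frac_setting
begin

sublocale gp: growth_profile T \<theta> moment
  using T_pos \<theta> moment_mono moment_nonneg by unfold_locales (auto intro!: mono_onI)

text \<open>\<open>integral_mult_frac\<close> is applied twice, once for each factor of the square.
  All integrands are bounded by \<open>moment t\<close>, which permits the change to nonnegative
  integrals.\<close>

lemma frac_moment_iterated:
  assumes t: "t \<in> {0..<T}"
  shows "ennreal (frac.moment t) =
    (\<integral>\<^sup>+u. \<integral>\<^sup>+v. ennreal (stopped_moment t (min u v)) \<partial>frac_measure \<partial>frac_measure)"
proof -
  let ?A = "stopped_moment t"
  have [measurable]: "?A \<in> borel_measurable borel" by (rule stopped_moment_measurable[OF t])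
  have bound: "norm (?A u) \<le> moment t" for u
    using stopped_moment_nonneg[of t u] stopped_moment_le[OF t, of u] by simp
  have int: "integrable frac_measure (\<lambda>v. ?A (min u v))" for u
    using bound by (intro \<nu>.integrable_const_bound[of _ "moment t"]) auto
  define I where "I u = (\<integral>v. ?A (min u v) \<partial>frac_measure)" for u
  have I_meas [measurable]: "I \<in> borel_measurable frac_measure"
    unfolding I_def[abs_def] by measurable
  have I_nonneg: "0 \<le> I u" for u
    unfolding I_def by (intro Bochner_Integration.integral_nonneg stopped_moment_nonneg)
  have I_le: "I u \<le> moment t" for u
  proof -
    have "I u \<le> (\<integral>v. moment t \<partial>frac_measure)"
      unfolding I_def using int stopped_moment_le[OF t] by (intro integral_mono) auto
    then show ?thesis by (simp add: \<nu>.prob_space)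
  qed
  have "frac.moment t = (\<integral>u. (\<integral>\<omega>. X t \<omega> * stopped t \<omega> u \<partial>M) \<partial>frac_measure)"
    unfolding frac.moment_def power2_eq_square using t by (intro integral_mult_frac X_frac_L2)
  also have "\<dots> = (\<integral>u. I u \<partial>frac_measure)"
  proof (rule Bochner_Integration.integral_cong)
    fix u
    have "(\<integral>\<omega>. X t \<omega> * stopped t \<omega> u \<partial>M) = (\<integral>\<omega>. stopped t \<omega> u * X t \<omega> \<partial>M)"
      by (simp add: mult.commute)
    also have "\<dots> = I u"
      unfolding I_def integral_mult_frac[OF t stopped_L2[OF t]] integral_stopped_mult[OF t] ..
    finally show "(\<integral>\<omega>. X t \<omega> * stopped t \<omega> u \<partial>M) = I u" .
  qed simp
  finally have "ennreal (frac.moment t) = ennreal (\<integral>u. I u \<partial>frac_measure)" by simp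
  also have "\<dots> = (\<integral>\<^sup>+u. ennreal (I u) \<partial>frac_measure)"
    using I_nonneg I_le
    by (intro nn_integral_eq_integral[symmetric] \<nu>.integrable_const_bound[of _ "moment t"]) auto
  also have "\<dots> = (\<integral>\<^sup>+u. \<integral>\<^sup>+v. ennreal (?A (min u v)) \<partial>frac_measure \<partial>frac_measure)"
    unfolding I_def using int stopped_moment_nonneg
    by (intro nn_integral_cong nn_integral_eq_integral[symmetric]) auto
  finally show ?thesis .
qed

text \<open>The density contributes (T - v)^(\<alpha>-1) and the tail (T - v)^\<alpha>; by the
  choice of \<alpha> the product is (T - v)^(-\<theta>). The family \<open>S\<close> stands for the
  open or the closed half-lines.\<close>

lemma nn_integral_frac_measure_tail:
  assumes [measurable]: "f \<in> borel_measurable borel"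
    and S: "\<And>v. v \<in> {0..T} \<Longrightarrow> emeasure frac_measure (S v) = ennreal (((T - v) / T) powr \<alpha>)"
    and f: "\<And>v. 0 \<le> f v"
    and m [measurable]: "(\<lambda>v. emeasure frac_measure (S v)) \<in> borel_measurable borel"
  shows "(\<integral>\<^sup>+v. ennreal (f v) * emeasure frac_measure (S v) \<partial>frac_measure) =
    ennreal (\<alpha> / T powr (2 * \<alpha>)) * (\<integral>\<^sup>+v\<in>{0..<T}. ennreal ((T - v) powr (-\<theta>) * f v) \<partial>lborel)"
proof -
  have "(\<integral>\<^sup>+v. ennreal (f v) * emeasure frac_measure (S v) \<partial>frac_measure)
    = (\<integral>\<^sup>+v. ennreal (frac_density v) * (ennreal (f v) * emeasure frac_measure (S v)) \<partial>lborel)"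
    unfolding frac_measure_def by (subst nn_integral_density) (use m in \<open>auto simp: frac_measure_def\<close>)
  also have "\<dots> = (\<integral>\<^sup>+v. ennreal (\<alpha> / T powr (2 * \<alpha>)) * (ennreal ((T - v) powr (-\<theta>) * f v) * indicator {0..<T} v) \<partial>lborel)"
  proof (rule nn_integral_cong)
    fix v
    show "ennreal (frac_density v) * (ennreal (f v) * emeasure frac_measure (S v))
       = ennreal (\<alpha> / T powr (2 * \<alpha>)) * (ennreal ((T - v) powr (-\<theta>) * f v) * indicator {0..<T} v)"
    proof (cases "v \<in> {0..<T}")
      case True
      have "(T - v) powr (\<alpha> - 1) * (T - v) powr \<alpha> = (T - v) powr (-\<theta>)"
        unfolding powr_add[symmetric] by (simp add: \<alpha>)
      moreover have "T powr (2 * \<alpha>) = T powr \<alpha> * T powr \<alpha>"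
        unfolding powr_add[symmetric] by simp
      ultimately have "frac_density v * (f v * ((T - v) / T) powr \<alpha>) = \<alpha> / T powr (2 * \<alpha>) * ((T - v) powr (-\<theta>) * f v)"
        using True T_pos by (simp add: frac_density_def powr_divide flip: \<open>_ = (T - v) powr (-\<theta>)\<close>)
      moreover have "ennreal (frac_density v) * (ennreal (f v) * ennreal (((T - v) / T) powr \<alpha>))
          = ennreal (frac_density v * (f v * ((T - v) / T) powr \<alpha>))"
        using frac_density_nonneg[of v] f[of v] by (simp add: ennreal_mult)
      moreover have "ennreal (\<alpha> / T powr (2 * \<alpha>)) * ennreal ((T - v) powr (-\<theta>) * f v)
          = ennreal (\<alpha> / T powr (2 * \<alpha>) * ((T - v) powr (-\<theta>) * f v))"
        using f[of v] alpha_pos T_pos by (intro ennreal_mult[symmetric]) auto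
      ultimately show ?thesis using True S[of v] by simp
    next
      case False
      then have "frac_density v = 0" by (cases "v = T") (auto simp: frac_density_def)
      then show ?thesis using False by simp
    qed
  qed
  also have "\<dots> = ennreal (\<alpha> / T powr (2 * \<alpha>)) * (\<integral>\<^sup>+v\<in>{0..<T}. ennreal ((T - v) powr (-\<theta>) * f v) \<partial>lborel)"
    by (rule nn_integral_cmult) measurable
  finally show ?thesis .
qed

text \<open>Off and on the diagonal, min u v is v where v < u and u where u \<le> v. Integrating out
  the larger variable leaves a tail of the measure; both halves give the same value, hence the
  factor 2.\<close>

lemma frac_moment_eq:
  assumes t: "t \<in> {0..<T}"
  shows "ennreal (frac.moment t) = ennreal (2 * \<alpha> / T powr (2 * \<alpha>)) *
    (\<integral>\<^sup>+u\<in>{0..<T}. ennreal ((T - u) powr (-\<theta>) * stopped_moment t u) \<partial>lborel)"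
proof -
  let ?A = "stopped_moment t"
  let ?J = "\<integral>\<^sup>+u\<in>{0..<T}. ennreal ((T - u) powr (-\<theta>) * ?A u) \<partial>lborel"
  have [measurable]: "?A \<in> borel_measurable borel" by (rule stopped_moment_measurable[OF t])
  interpret \<nu>\<nu>: pair_sigma_finite frac_measure frac_measure ..
  have m1: "(\<lambda>v. emeasure frac_measure {v..}) \<in> borel_measurable borel"
  proof -
    have "mono (\<lambda>v. - \<nu>.prob {v..})"
      by (auto simp: mono_def intro!: \<nu>.finite_measure_mono)
    then have "(\<lambda>v. - \<nu>.prob {v..}) \<in> borel_measurable borel"
      by (rule borel_measurable_mono)
    then have "(\<lambda>v. \<nu>.prob {v..}) \<in> borel_measurable borel" by simp
    then show ?thesis by (simp add: \<nu>.emeasure_eq_measure)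
  qed
  have m2: "(\<lambda>v. emeasure frac_measure {v<..}) \<in> borel_measurable borel"
  proof -
    have "mono (\<lambda>v. - \<nu>.prob {v<..})"
      by (auto simp: mono_def intro!: \<nu>.finite_measure_mono)
    then have "(\<lambda>v. - \<nu>.prob {v<..}) \<in> borel_measurable borel"
      by (rule borel_measurable_mono)
    then have "(\<lambda>v. \<nu>.prob {v<..}) \<in> borel_measurable borel" by simp
    then show ?thesis by (simp add: \<nu>.emeasure_eq_measure)
  qed
  have "ennreal (frac.moment t) = (\<integral>\<^sup>+u. \<integral>\<^sup>+v. ennreal (?A v) * indicator {p. snd p < fst p} (u, v) +
      ennreal (?A u) * indicator {p. fst p \<le> snd p} (u, v) \<partial>frac_measure \<partial>frac_measure)"
    unfolding frac_moment_iterated[OF t]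
    by (intro nn_integral_cong) (auto simp: indicator_def min_def)
  also have "\<dots> = (\<integral>\<^sup>+u. (\<integral>\<^sup>+v. ennreal (?A v) * indicator {p. snd p < fst p} (u, v) \<partial>frac_measure) +
      (\<integral>\<^sup>+v. ennreal (?A u) * indicator {p. fst p \<le> snd p} (u, v) \<partial>frac_measure) \<partial>frac_measure)"
    by (intro nn_integral_cong nn_integral_add) measurable
  also have "\<dots> = (\<integral>\<^sup>+u. \<integral>\<^sup>+v. ennreal (?A v) * indicator {p. snd p < fst p} (u, v) \<partial>frac_measure \<partial>frac_measure) +
      (\<integral>\<^sup>+u. \<integral>\<^sup>+v. ennreal (?A u) * indicator {p. fst p \<le> snd p} (u, v) \<partial>frac_measure \<partial>frac_measure)"
    by (intro nn_integral_add) measurable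
  also have "(\<integral>\<^sup>+u. \<integral>\<^sup>+v. ennreal (?A v) * indicator {p. snd p < fst p} (u, v) \<partial>frac_measure \<partial>frac_measure)
     = (\<integral>\<^sup>+v. \<integral>\<^sup>+u. ennreal (?A v) * indicator {p. snd p < fst p} (u, v) \<partial>frac_measure \<partial>frac_measure)"
    by (rule \<nu>\<nu>.Fubini'[symmetric]) measurable
  also have "\<dots> = (\<integral>\<^sup>+v. ennreal (?A v) * emeasure frac_measure {v<..} \<partial>frac_measure)"
  proof (rule nn_integral_cong)
    fix v
    have "(\<integral>\<^sup>+u. ennreal (?A v) * indicator {p. snd p < fst p} (u, v) \<partial>frac_measure)
      = (\<integral>\<^sup>+u. ennreal (?A v) * indicator {v<..} u \<partial>frac_measure)"
      by (intro nn_integral_cong) (auto simp: indicator_def)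
    also have "\<dots> = ennreal (?A v) * emeasure frac_measure {v<..}"
      by (rule nn_integral_cmult_indicator) simp
    finally show "(\<integral>\<^sup>+u. ennreal (?A v) * indicator {p. snd p < fst p} (u, v) \<partial>frac_measure)
      = ennreal (?A v) * emeasure frac_measure {v<..}" .
  qed
  also have "\<dots> = ennreal (\<alpha> / T powr (2 * \<alpha>)) * ?J"
    using frac_measure_tail(2) stopped_moment_nonneg m2 by (intro nn_integral_frac_measure_tail) auto
  also have "(\<integral>\<^sup>+u. \<integral>\<^sup>+v. ennreal (?A u) * indicator {p. fst p \<le> snd p} (u, v) \<partial>frac_measure \<partial>frac_measure)
     = (\<integral>\<^sup>+u. ennreal (?A u) * emeasure frac_measure {u..} \<partial>frac_measure)"
  proof (rule nn_integral_cong)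
    fix u
    have "(\<integral>\<^sup>+v. ennreal (?A u) * indicator {p. fst p \<le> snd p} (u, v) \<partial>frac_measure)
      = (\<integral>\<^sup>+v. ennreal (?A u) * indicator {u..} v \<partial>frac_measure)"
      by (intro nn_integral_cong) (auto simp: indicator_def)
    also have "\<dots> = ennreal (?A u) * emeasure frac_measure {u..}"
      by (rule nn_integral_cmult_indicator) simp
    finally show "(\<integral>\<^sup>+v. ennreal (?A u) * indicator {p. fst p \<le> snd p} (u, v) \<partial>frac_measure)
      = ennreal (?A u) * emeasure frac_measure {u..}" .
  qed
  also have "\<dots> = ennreal (\<alpha> / T powr (2 * \<alpha>)) * ?J"
    using frac_measure_tail(1) stopped_moment_nonneg m1 by (intro nn_integral_frac_measure_tail) auto
  also have "ennreal (\<alpha> / T powr (2 * \<alpha>)) * ?J + ennreal (\<alpha> / T powr (2 * \<alpha>)) * ?J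
     = ennreal (2 * \<alpha> / T powr (2 * \<alpha>)) * ?J"
    using alpha_pos T_pos by (simp add: distrib_right[symmetric] ennreal_plus[symmetric] del: ennreal_plus)
  finally show ?thesis .
qed

text \<open>On [0,t] the stopped moment coincides with \<open>moment\<close>, so a bound for the
  fractional moment controls the truncated energies. Conversely the stopped moment lies below
  \<open>moment\<close> on all of [0,T).\<close>

lemma frac_moment_bounded_iff_energy_finite:
  "(\<exists>C. \<forall>t\<in>{0..<T}. frac.moment t \<le> C) \<longleftrightarrow> gp.energy < \<infinity>"
proof
  let ?c = "2 * \<alpha> / T powr (2 * \<alpha>)"
  have c: "0 < ?c" using alpha_pos T_pos by simp
  assume "\<exists>C. \<forall>t\<in>{0..<T}. frac.moment t \<le> C"
  then obtain C where C: "\<And>t. t \<in> {0..<T} \<Longrightarrow> frac.moment t \<le> C" by blast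
  have "gp.energy \<le> ennreal (C / ?c)"
  proof (rule gp.energy_truncated_bound)
    fix t assume t: "t \<in> {0..<T}"
    let ?I = "\<integral>\<^sup>+u\<in>{0..t}. ennreal ((T - u) powr (-\<theta>) * moment u) \<partial>lborel"
    have "?I \<le> (\<integral>\<^sup>+u\<in>{0..<T}. ennreal ((T - u) powr (-\<theta>) * stopped_moment t u) \<partial>lborel)"
      using t by (intro nn_integral_mono) (auto simp: indicator_def stopped_moment_def)
    then have "ennreal ?c * ?I \<le> ennreal (frac.moment t)"
      unfolding frac_moment_eq[OF t] by (rule mult_left_mono) simp
    also have "\<dots> \<le> ennreal C" using C[OF t] by (rule ennreal_leI)
    finally have "ennreal ?c * ?I \<le> ennreal C" .
    moreover have "0 \<le> C" using C[OF t] frac.moment_nonneg[of t] by simp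
    ultimately show "?I \<le> ennreal (C / ?c)" using c by (intro ennreal_le_divide)
  qed
  then show "gp.energy < \<infinity>" by (rule order.strict_trans1) simp
next
  let ?c = "2 * \<alpha> / T powr (2 * \<alpha>)"
  assume fin: "gp.energy < \<infinity>"
  have "frac.moment t \<le> enn2real (ennreal ?c * gp.energy)" if t: "t \<in> {0..<T}" for t
  proof -
    have "ennreal (frac.moment t) \<le> ennreal ?c * gp.energy"
      unfolding frac_moment_eq[OF t] gp.energy_def
    proof (intro mult_left_mono nn_integral_mono)
      fix u
      have "stopped_moment t u \<le> moment u" if "u \<in> {0..<T}"
        unfolding stopped_moment_def using that t by (intro moment_mono) auto
      then show "ennreal ((T - u) powr (-\<theta>) * stopped_moment t u) * indicator {0..<T} u
          \<le> ennreal ((T - u) powr (-\<theta>) * moment u) * indicator {0..<T} u"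
        by (auto simp: indicator_def intro!: ennreal_leI mult_left_mono)
    qed simp
    moreover have "ennreal ?c * gp.energy < top" using fin by (simp add: ennreal_mult_less_top)
    ultimately show ?thesis
      using frac.moment_nonneg[of t] enn2real_mono by fastforce
  qed
  then show "\<exists>C. \<forall>t\<in>{0..<T}. frac.moment t \<le> C" by blast
qed

end


section \<open>The approximation error\<close>

context frac_setting
begin

text \<open>Approximation by the processes stopped at the dyadic times: for fixed u < T this
  sequence is eventually constant.\<close>

lemma L_measurable_pair:
  "(\<lambda>p. indicator {0<..<T} (snd p) * L (snd p) (fst p)) \<in> borel_measurable (M \<Otimes>\<^sub>M borel)"
proof -
  let ?t = "\<lambda>k. T * (1 - 2 powr (- real k))"
  have "(\<lambda>p. indicator {0<..<T} (snd p) * stopped (?t k) (fst p) (snd p)) \<in> borel_measurable (M \<Otimes>\<^sub>M borel)" for k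
    using stopped_measurable[OF gp.dyadic_in[of k]] by (simp add: split_beta')
  then show ?thesis
  proof (rule borel_measurable_LIMSEQ_real[rotated])
    fix p :: "'a \<times> real"
    show "(\<lambda>k. indicator {0<..<T} (snd p) * stopped (?t k) (fst p) (snd p))
       \<longlonglongrightarrow> indicator {0<..<T} (snd p) * L (snd p) (fst p)"
    proof (cases "snd p \<in> {0<..<T}")
      case True
      then obtain k0 where k0: "snd p \<in> {?t k0..<?t (Suc k0)}"
        using dyadic_covering[OF T_pos, of "snd p"] by auto
      have "stopped (?t k) (fst p) (snd p) = L (snd p) (fst p)" if "Suc k0 \<le> k" for k
      proof -
        have "?t (Suc k0) \<le> ?t k" using that T_pos by (auto intro!: mult_left_mono powr_mono)
        then have "snd p \<le> ?t k" using k0 by simp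
        then have "max 0 (min (snd p) (?t k)) = snd p" using True by auto
        then show ?thesis by (simp add: stopped_def)
      qed
      then show ?thesis
        by (intro tendsto_mult tendsto_const tendsto_eventually eventually_sequentiallyI[of "Suc k0"])
    qed simp
  qed
qed

text \<open>Restricted to 0 < u < T because \<open>left_node\<close> is unspecified at 0 and the
  process ends before T; both points are Lebesgue null.\<close>

definition sq_error :: "real list \<Rightarrow> 'a \<times> real \<Rightarrow> real" where
  "sq_error \<tau> p = indicator {0<..<T} (snd p) * (L (snd p) (fst p) - L (left_node \<tau> (snd p)) (fst p))\<^sup>2"

lemma sq_error_measurable:
  assumes \<tau>: "\<tau> \<in> time_nets T"
  shows "sq_error \<tau> \<in> borel_measurable (M \<Otimes>\<^sub>M borel)"
proof -
  have L_node: "L (\<tau> ! (i - 1)) \<in> borel_measurable M" if "i \<in> {1..<length \<tau>}" for i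
  proof -
    have "\<tau> ! (i - 1) < \<tau> ! i" "0 \<le> \<tau> ! (i - 1)" "\<tau> ! i \<le> T"
      using time_nets_nth_less[OF \<tau>, of "i - 1" i] time_nets_nth_bounds[OF \<tau>, of "i - 1"]
        time_nets_nth_bounds[OF \<tau>, of i] that by auto
    then show ?thesis by (intro L2_spaceD(1) X_L2) auto
  qed
  have "(\<lambda>p. L (\<tau> ! (i - 1)) (fst p) * indicator {\<tau> ! (i - 1)<..\<tau> ! i} (snd p))
      \<in> borel_measurable (M \<Otimes>\<^sub>M borel)" if "i \<in> {1..<length \<tau>}" for i
    using L_node[OF that] by measurable
  then have [measurable]: "(\<lambda>p. \<Sum>i = 1..<length \<tau>. L (\<tau> ! (i - 1)) (fst p) * indicator {\<tau> ! (i - 1)<..\<tau> ! i} (snd p))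
      \<in> borel_measurable (M \<Otimes>\<^sub>M borel)"
    by (rule borel_measurable_sum)
  note [measurable] = L_measurable_pair
  have "(\<lambda>p. indicator {0<..<T} (snd p) * (indicator {0<..<T} (snd p) * L (snd p) (fst p) -
      (\<Sum>i = 1..<length \<tau>. L (\<tau> ! (i - 1)) (fst p) * indicator {\<tau> ! (i - 1)<..\<tau> ! i} (snd p)))\<^sup>2)
    \<in> borel_measurable (M \<Otimes>\<^sub>M borel)"
    by measurable
  also have "(\<lambda>p. indicator {0<..<T} (snd p) * (indicator {0<..<T} (snd p) * L (snd p) (fst p) -
      (\<Sum>i = 1..<length \<tau>. L (\<tau> ! (i - 1)) (fst p) * indicator {\<tau> ! (i - 1)<..\<tau> ! i} (snd p)))\<^sup>2) = sq_error \<tau>"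
  proof
    fix p
    show "indicator {0<..<T} (snd p) * (indicator {0<..<T} (snd p) * L (snd p) (fst p) -
      (\<Sum>i = 1..<length \<tau>. L (\<tau> ! (i - 1)) (fst p) * indicator {\<tau> ! (i - 1)<..\<tau> ! i} (snd p)))\<^sup>2 = sq_error \<tau> p"
      using step_process_left_node[OF \<tau>, of "snd p" "\<lambda>s. L s (fst p)"]
      by (cases "snd p \<in> {0<..<T}") (auto simp: sq_error_def)
  qed
  finally show ?thesis .
qed

lemma approx_error_T_eq:
  assumes \<tau>: "\<tau> \<in> time_nets T" and \<omega>: "\<omega> \<in> space M"
  shows "approx_error_T T L \<tau> \<omega> = (\<integral>\<^sup>+u. ennreal (sq_error \<tau> (\<omega>, u)) \<partial>lborel)"
proof -
  have [measurable]: "(\<lambda>u. sq_error \<tau> (\<omega>, u)) \<in> borel_measurable borel"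
    using measurable_compose[OF measurable_Pair1'[OF \<omega>] sq_error_measurable[OF \<tau>]] by simp
  have eq: "approx_error L \<tau> a \<omega> = (\<integral>\<^sup>+u. ennreal (sq_error \<tau> (\<omega>, u)) * indicator {..a} u \<partial>lborel)" if a: "a < T" for a
    unfolding approx_error_def
  \<comment> \<open>At u = 0 all indicators of the step process vanish, so the integrand there is
    the square of \<open>L 0\<close> instead of an increment; one point does not matter.\<close>
  proof (rule nn_integral_cong_AE, use AE_lborel_singleton[of 0] in eventually_elim)
    fix u :: real assume "u \<noteq> 0"
    show "ennreal (\<bar>L u \<omega> - (\<Sum>i = 1..<length \<tau>. L (\<tau> ! (i - 1)) \<omega> * indicator {\<tau> ! (i - 1)<..\<tau> ! i} u)\<bar>\<^sup>2) * indicator {0..a} u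
       = ennreal (sq_error \<tau> (\<omega>, u)) * indicator {..a} u"
    proof (cases "0 < u \<and> u \<le> a")
      case True
      then show ?thesis
        using a step_process_left_node[OF \<tau>, of u "\<lambda>s. L s \<omega>"] by (simp add: sq_error_def)
    next
      case False
      then show ?thesis using \<open>u \<noteq> 0\<close> by (auto simp: sq_error_def indicator_def)
    qed
  qed
  have "((\<lambda>a. approx_error L \<tau> a \<omega>) \<longlongrightarrow> (\<integral>\<^sup>+u. ennreal (sq_error \<tau> (\<omega>, u)) \<partial>lborel)) (at_left T)"
  \<comment> \<open>Along increasing sequences the limit is a case of monotone convergence, which
    also covers an infinite value.\<close>
  proof (rule tendsto_at_left_sequentially[OF T_pos])
    fix S :: "nat \<Rightarrow> real"
    assume S: "\<And>n. S n < T" "incseq S" "S \<longlonglongrightarrow> T"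
    have "(\<lambda>n. \<integral>\<^sup>+u. ennreal (sq_error \<tau> (\<omega>, u)) * indicator {..S n} u \<partial>lborel)
       \<longlonglongrightarrow> (\<integral>\<^sup>+u. ennreal (sq_error \<tau> (\<omega>, u)) \<partial>lborel)"
    proof (rule nn_integral_LIMSEQ)
      show "incseq (\<lambda>n u. ennreal (sq_error \<tau> (\<omega>, u)) * indicator {..S n} u)"
        using S(2) by (auto simp: incseq_def le_fun_def indicator_def intro: order_trans)
      fix u
      show "(\<lambda>n. ennreal (sq_error \<tau> (\<omega>, u)) * indicator {..S n} u) \<longlonglongrightarrow> ennreal (sq_error \<tau> (\<omega>, u))"
      proof (cases "u < T")
        case True
        have "eventually (\<lambda>n. u < S n) sequentially" by (rule order_tendstoD(1)[OF S(3) True])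
        then have "eventually (\<lambda>n. ennreal (sq_error \<tau> (\<omega>, u)) * indicator {..S n} u = ennreal (sq_error \<tau> (\<omega>, u))) sequentially"
          by eventually_elim simp
        then show ?thesis by (rule tendsto_eventually)
      next
        case False
        then have "sq_error \<tau> (\<omega>, u) = 0" by (simp add: sq_error_def)
        then show ?thesis by simp
      qed
    qed measurable
    then show "(\<lambda>n. approx_error L \<tau> (S n) \<omega>) \<longlonglongrightarrow> (\<integral>\<^sup>+u. ennreal (sq_error \<tau> (\<omega>, u)) \<partial>lborel)"
      using eq[OF S(1)] by simp
  qed
  then show ?thesis unfolding approx_error_T_def by (intro tendsto_Lim) auto
qed

text \<open>Tonelli, and then orthogonality of increments: the second moment of
  \<open>L u - L (left_node \<tau> u)\<close> is a difference of moments.\<close>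

lemma nn_integral_approx_error_T:
  assumes \<tau>: "\<tau> \<in> time_nets T"
  shows "(\<integral>\<^sup>+\<omega>. approx_error_T T L \<tau> \<omega> \<partial>M) = gp.net_error \<tau>"
proof -
  interpret Ml: pair_sigma_finite M lborel ..
  have [measurable]: "sq_error \<tau> \<in> borel_measurable (M \<Otimes>\<^sub>M lborel)"
    using sq_error_measurable[OF \<tau>] by (simp cong: measurable_cong_sets)
  have "(\<integral>\<^sup>+\<omega>. approx_error_T T L \<tau> \<omega> \<partial>M) = (\<integral>\<^sup>+\<omega>. \<integral>\<^sup>+u. ennreal (sq_error \<tau> (\<omega>, u)) \<partial>lborel \<partial>M)"
    by (intro nn_integral_cong approx_error_T_eq[OF \<tau>])
  also have "\<dots> = (\<integral>\<^sup>+u. \<integral>\<^sup>+\<omega>. ennreal (sq_error \<tau> (\<omega>, u)) \<partial>M \<partial>lborel)"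
    by (rule Ml.Fubini[symmetric]) measurable
  also have "\<dots> = gp.net_error \<tau>"
    unfolding gp.net_error_def
  proof (rule nn_integral_cong)
    fix u
    show "(\<integral>\<^sup>+\<omega>. ennreal (sq_error \<tau> (\<omega>, u)) \<partial>M)
        = ennreal (moment u - moment (left_node \<tau> u)) * indicator {0<..<T} u"
    proof (cases "u \<in> {0<..<T}")
      case True
      then have l: "0 \<le> left_node \<tau> u" "left_node \<tau> u \<le> u" "u < T"
        using left_node_bounds[OF \<tau>, of u] by auto
      have "(\<integral>\<^sup>+\<omega>. ennreal (sq_error \<tau> (\<omega>, u)) \<partial>M) = (\<integral>\<^sup>+\<omega>. ennreal ((L u \<omega> - L (left_node \<tau> u) \<omega>)\<^sup>2) \<partial>M)"
        using True by (simp add: sq_error_def)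
      also have "\<dots> = ennreal (moment u - moment (left_node \<tau> u))"
        unfolding moment_diff[OF l, symmetric]
        using L2_spaceD(2)[OF L2_diff[OF X_L2[of u] X_L2[of "left_node \<tau> u"]]] l
        by (intro nn_integral_eq_integral) auto
      finally show ?thesis using True by simp
    qed (simp add: sq_error_def)
  qed
  finally show ?thesis .
qed

lemma interpolation_iff_energy_finite:
  "dyadic_seq T L \<in> real_interpolation (seq_eq M) (weighted_lq M 2 (-1/2)) (weighted_lq M \<infinity> 0) \<theta> 2
    \<longleftrightarrow> gp.energy < \<infinity>"
proof -
  have L2: "dyadic_seq T L k \<in> L2_space M" for k
    unfolding dyadic_seq_def by (intro X_L2 gp.dyadic_in)
  have norm: "(L2_norm M (dyadic_seq T L k))\<^sup>2 = moment (T * (1 - 2 powr (- real k)))" for k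
    by (simp add: L2_norm_power2 dyadic_seq_def moment_def)
  have mono: "L2_norm M (dyadic_seq T L k) \<le> L2_norm M (dyadic_seq T L m)" if "k \<le> m" for k m
  proof (rule power2_le_imp_le)
    have "T * (1 - 2 powr (- real k)) \<le> T * (1 - 2 powr (- real m))"
      using that T_pos by (auto intro!: mult_left_mono powr_mono)
    then show "(L2_norm M (dyadic_seq T L k))\<^sup>2 \<le> (L2_norm M (dyadic_seq T L m))\<^sup>2"
      unfolding norm using gp.dyadic_in[of k] gp.dyadic_in[of m] by (intro moment_mono) auto
  qed (rule L2_norm_nonneg)
  have energy: "gp.dyadic_energy = (\<Sum>k. ennreal (2 powr (- (1 - \<theta>) * real k) * (L2_norm M (dyadic_seq T L k))\<^sup>2))"
    unfolding gp.dyadic_energy_def norm ..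
  show ?thesis
    unfolding gp.energy_finite_iff energy
    by (rule iffI) (rule dyadic_energy_finite_if_interpolation[OF L2 \<theta>] interpolation_if_dyadic_energy_finite[OF L2 \<theta> mono]; assumption)+
qed

end

theorem theorem3p7:
  fixes M :: "'a measure" and F :: "real \<Rightarrow> 'a measure" and T \<theta> \<alpha> :: real
    and L :: "real \<Rightarrow> 'a \<Rightarrow> real"
  assumes "filtered_prob_space M F T"
    and "\<theta> \<in> {0<..<1}"
    and "\<alpha> = (1 - \<theta>) / 2"
    and "martingale M F T L"
    and "cadlag M T L"
    and "\<forall>t\<in>{0..<T}. L t \<in> L2_space M"
  shows "(dyadic_seq T L \<in>
            real_interpolation (seq_eq M) (weighted_lq M 2 (-1/2)) (weighted_lq M \<infinity> 0) \<theta> 2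
          \<longleftrightarrow> closable_L2 M F T (frac_integral T \<alpha> L))
       \<and> (closable_L2 M F T (frac_integral T \<alpha> L)
          \<longleftrightarrow> (\<exists>c::real. c > 0 \<and> (\<forall>\<tau>\<in>time_nets T.
                (\<integral>\<^sup>+\<omega>. approx_error_T T L \<tau> \<omega> \<partial>M) \<le> ennreal (c * net_norm T \<theta> \<tau>))))"
proof -
  interpret filtered_prob_space M F T by fact
  interpret frac_setting M F T L \<theta> \<alpha>
    by unfold_locales (use assms in auto)
  show ?thesis
    \<comment> \<open>The first two assertions become finiteness of the energy, which is then
      rewritten as the bound on \<open>gp.net_error\<close>; only the identification of that
      quantity with the expected error remains.\<close>
    unfolding interpolation_iff_energy_finite frac.closable_iff_moment_bounded
      frac_moment_bounded_iff_energy_finite gp.energy_finite_iff_net_error_bound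
    using nn_integral_approx_error_T by simp
qed


end
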